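(* Let $d\ge3$, let $h$ and $\lambda>0$ be as in the context, and let $\mathbf y$ be a cavitating solution, extended by $\mathbf y(\mathbf x,t)=\lambda\mathbf x$ for $t\le0$. If $$\lim_{v\to\infty}\frac{h'(v^d)}{v}=0,$$ then $\mathbf y$ is a slic-solution of $\mathbf y_{tt}-\operatorname{div}\mathbf S(\nabla\mathbf y)=0$. If $$\liminf_{v\to\infty}\frac{h'(v^d)}{v}>0,$$ then $\mathbf y$ is not a slic-solution.
   Context: Material. Let $d\ge3$ and let $h:(0,\infty)\to[0,\infty)$ be three times differentiable with $h''>0$, $h'''<0$, $\lim_{v\to0}h(v)=\lim_{v\to\infty}h(v)=\infty$. $H>0$ denotes the unique number with $h'(H)=0$. For $\mathbf F\in\mathbb{R}^{d\times d}$ with $\det\mathbf F>0$, $W(\mathbf F)=\frac12\sum_{i=1}^d\lambda_i^2+h\big(\prod_{i=1}^d\lambda_i\big)$, where $\lambda_1,\dots,\lambda_d$ are the eigenvalues of $\sqrt{\mathbf F\mathbf F^T}$, and $\mathbf S=\partial W/\partial\mathbf F$. Cavitating solution (of K.A. Pericak-Spector and S. Spector) for the stretch $\lambda>0$: $\mathbf y(\mathbf x,t)=w(|\mathbf x|,t)\frac{\mathbf x}{|\mathbf x|}$, $w(R,t)=t\,r(R/t)$ for $t>0$, where for some $\sigma>0$ the function $r:[0,\infty)\to(0,\infty)$ is continuous, $r(0)>0$, $r(s)=\lambda s$ for $s\ge\sigma$, $r$ is $C^2$ on $(0,\sigma)$ and $C^1$ up to $\sigma$ from the left. With $v(s)=r'(s)(r(s)/s)^{d-1}$,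 $P_1=r'+(r/s)^{d-1}h'(v)$, $P_2=\frac rs+r'(r/s)^{d-2}h'(v)$: (i) $s^2r''=\frac{d}{ds}P_1+\frac{d-1}{s}(P_1-P_2)$ on $(0,\sigma)$; (ii) $\sigma^2(\lambda-r'(\sigma-))=\lambda+\lambda^{d-1}h'(\lambda^d)-P_1(\sigma-)$; (iii) the Cauchy stress vanishes at the cavity surface, i.e. $v(s)\to H$ as $s\to0^+$. Known properties of this solution, which may be used: $H\le v\le\lambda^d$; $r'\ge0$ is strictly increasing on $(0,\sigma]$ and $r'(\sigma-)<\lambda$; $v$ is strictly increasing on $(0,\sigma)$; $r(s)>\lambda s>s\,r'(s)$ for $0<s<\sigma$. The extended function $\mathbf y$ satisfies $\int_{\mathbb{R}}\int_{\mathbb{R}^d}\mathbf y\cdot\partial_{tt}\boldsymbol\psi+\mathbf S(\nabla\mathbf y):\nabla\boldsymbol\psi\,d\mathbf x\,dt=0$ for all $\boldsymbol\psi\in C_c^\infty(\mathbb{R}^d\times\mathbb{R};\mathbb{R}^d)$. Averaging. An admissible mollifier is $\phi\in C_c^\infty(\mathbb{R})$ with $\phi\ge0$, $\phi(-x)=\phi(x)$, $\int\phi=1$, $\operatorname{supp}\phi\subset[-1,1]$, $\phi(0)>0$; $\phi_n(R)=n\phi(nR)$. Set $$w^n(R,t)=\int_0^\infty\big[\phi_n(R-\tilde R)-\phi_n(R+\tilde R)\big]w(\tilde R,t)\,d\tilde R,\qquad \mathbf y^n(\mathbf x,t)=w^n(|\mathbf x|,t)\frac{\mathbf x}{|\mathbf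 x|}.$$ Definition (slic-solution). Let $\mathbf y\in L^\infty_{loc}(\mathbb{R};L^1_{loc}(\mathbb{R}^d;\mathbb{R}^d))$ be of the form $w(|\mathbf x|,t)\frac{\mathbf x}{|\mathbf x|}$ with $w(\cdot,t)$ monotone increasing, $\mathbf y(\mathbf x,t)=\lambda\mathbf x$ for $t\le0$ and for $|\mathbf x|>\bar rt$, $t>0$, for some $\bar r>0$. It is a slic-solution of $\mathbf y_{tt}-\operatorname{div}\mathbf S(\nabla\mathbf y)=0$ if, for all admissible mollifiers $\phi$: $\det\nabla\mathbf y^n\ge\varepsilon_n>0$ for every $n\in\mathbb{N}$ (with constants $\varepsilon_n$), and for all $\boldsymbol\psi\in C_c^2(\mathbb{R}^d\times\mathbb{R};\mathbb{R}^d)$ $$\int_{\mathbb{R}}\int_{\mathbb{R}^d}\mathbf y^n\cdot\partial_{tt}\boldsymbol\psi+\mathbf S(\nabla\mathbf y^n):\nabla\boldsymbol\psi\,d\mathbf x\,dt\to0\quad(n\to\infty).$$ *)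

theory Defs
  imports "HOL-Analysis.Analysis"
begin

section \<open>Stored energy and stress\<close>

definition energy_function :: "(real \<Rightarrow> real) \<Rightarrow> bool" where
  "energy_function h \<longleftrightarrow>
     (\<forall>v>0. h v \<ge> 0) \<and>
     (\<forall>k<3. \<forall>v>0. ((deriv ^^ k) h) field_differentiable at v) \<and>
     (\<forall>v>0. (deriv ^^ 2) h v > 0) \<and>
     (\<forall>v>0. (deriv ^^ 3) h v < 0) \<and>
     filterlim h at_top (at_right 0) \<and>
     filterlim h at_top at_top"

definition matrix_sqrt :: "real^'d^'d \<Rightarrow> real^'d^'d" where
  "matrix_sqrt A =
     (THE U. transpose U = U \<and> (\<forall>x. 0 \<le> x \<bullet> (U *v x)) \<and> U ** U = A)"

text \<open>
  \<open>l\<close> lists the eigenvalues of \<open>A\<close> with algebraic multiplicity.  Such an \<open>l\<close> is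
  determined only up to a permutation, which symmetric functions of it do not see.
\<close>
definition eigenvalue_family :: "real^'d^'d \<Rightarrow> ('d \<Rightarrow> real) \<Rightarrow> bool" where
  "eigenvalue_family A l \<longleftrightarrow> (\<forall>z. det (mat z - A) = (\<Prod>i\<in>UNIV. z - l i))"

definition stored_energy :: "(real \<Rightarrow> real) \<Rightarrow> real^'d^'d \<Rightarrow> real" where
  "stored_energy h F =
     (let l = (SOME l. eigenvalue_family (matrix_sqrt (F ** transpose F)) l)
      in (\<Sum>i\<in>UNIV. (l i)\<^sup>2) / 2 + h (\<Prod>i\<in>UNIV. l i))"

text \<open>
  The inner product on \<open>real^'d^'d\<close> is the Frobenius product \<open>A : B\<close>, so the gradient is
  the matrix \<open>\<partial>W/\<partial>F\<close>.  It is meaningful for \<open>det F > 0\<close>.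
\<close>
definition stress :: "(real \<Rightarrow> real) \<Rightarrow> real^'d^'d \<Rightarrow> real^'d^'d" where
  "stress h F = (THE S. GDERIV (stored_energy h) F :> S)"

section \<open>Test functions and the weak form\<close>

text \<open>
  \<open>Ck k f\<close>: all iterated directional derivatives of \<open>f\<close> up to order \<open>k\<close> exist as Frechet
  derivatives and are continuous.
\<close>
primrec Ck :: "nat \<Rightarrow> ('a::real_normed_vector \<Rightarrow> 'b::real_normed_vector) \<Rightarrow> bool" where
  "Ck 0 f \<longleftrightarrow> continuous_on UNIV f"
| "Ck (Suc k) f \<longleftrightarrow>
     (\<forall>x. f differentiable (at x)) \<and> (\<forall>v. Ck k (\<lambda>x. frechet_derivative f (at x) v))"

definition compactly_supported ::
    "('a::topological_space \<Rightarrow> 'b::zero) \<Rightarrow> bool" where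
  "compactly_supported f \<longleftrightarrow> compact (closure {z. f z \<noteq> 0})"

definition grad_x :: "(real^'d \<Rightarrow> real \<Rightarrow> real^'d) \<Rightarrow> real^'d \<Rightarrow> real \<Rightarrow> real^'d^'d" where
  "grad_x f x t = jacobian (\<lambda>x'. f x' t) (at x)"

definition d_tt :: "(real^'d \<Rightarrow> real \<Rightarrow> real^'d) \<Rightarrow> real^'d \<Rightarrow> real \<Rightarrow> real^'d" where
  "d_tt f x t =
     vector_derivative (\<lambda>s. vector_derivative (\<lambda>s'. f x s') (at s)) (at t)"

definition weak_integrand ::
    "(real \<Rightarrow> real) \<Rightarrow> (real^'d \<Rightarrow> real \<Rightarrow> real^'d) \<Rightarrow> ((real^'d) \<times> real \<Rightarrow> real^'d) \<Rightarrow>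
     real^'d \<Rightarrow> real \<Rightarrow> real" where
  "weak_integrand h y \<psi> x t =
     y x t \<bullet> d_tt (curry \<psi>) x t + stress h (grad_x y x t) \<bullet> grad_x (curry \<psi>) x t"

text \<open>
  The Bochner integral of a non-integrable function is 0, so statements about
  \<open>weak_integral\<close> have to come with \<open>weak_integrable\<close>.
\<close>
definition weak_integrable ::
    "(real \<Rightarrow> real) \<Rightarrow> (real^'d \<Rightarrow> real \<Rightarrow> real^'d) \<Rightarrow> ((real^'d) \<times> real \<Rightarrow> real^'d) \<Rightarrow> bool" where
  "weak_integrable h y \<psi> \<longleftrightarrow> integrable lebesgue (\<lambda>(x, t). weak_integrand h y \<psi> x t)"

definition weak_integral ::
    "(real \<Rightarrow> real) \<Rightarrow> (real^'d \<Rightarrow> real \<Rightarrow> real^'d) \<Rightarrow> ((real^'d) \<times> real \<Rightarrow> real^'d) \<Rightarrow> real" where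
  "weak_integral h y \<psi> = (LINT t|lebesgue. LINT x|lebesgue. weak_integrand h y \<psi> x t)"

definition weak_solution :: "(real \<Rightarrow> real) \<Rightarrow> (real^'d \<Rightarrow> real \<Rightarrow> real^'d) \<Rightarrow> bool" where
  "weak_solution h y \<longleftrightarrow>
     (\<forall>\<psi>. (\<forall>k. Ck k \<psi>) \<and> compactly_supported \<psi> \<longrightarrow>
        weak_integrable h y \<psi> \<and> weak_integral h y \<psi> = 0)"

section \<open>The cavitating solution\<close>

definition prof_v :: "nat \<Rightarrow> (real \<Rightarrow> real) \<Rightarrow> real \<Rightarrow> real" where
  "prof_v d r s = deriv r s * (r s / s) ^ (d - 1)"

definition prof_P1 :: "nat \<Rightarrow> (real \<Rightarrow> real) \<Rightarrow> (real \<Rightarrow> real) \<Rightarrow> real \<Rightarrow> real" where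
  "prof_P1 d h r s = deriv r s + (r s / s) ^ (d - 1) * deriv h (prof_v d r s)"

definition prof_P2 :: "nat \<Rightarrow> (real \<Rightarrow> real) \<Rightarrow> (real \<Rightarrow> real) \<Rightarrow> real \<Rightarrow> real" where
  "prof_P2 d h r s = r s / s + deriv r s * (r s / s) ^ (d - 2) * deriv h (prof_v d r s)"

text \<open>
  \<open>\<rho>\<close> and \<open>p\<close> are the one-sided limits of \<open>r'\<close> and \<open>P\<^sub>1\<close> at the shock \<open>\<sigma>\<close>; the
  existence of \<open>\<rho>\<close> also says that \<open>r\<close> is continuously differentiable up to \<open>\<sigma>\<close> from the left.
\<close>
definition cavitating_profile ::
    "nat \<Rightarrow> (real \<Rightarrow> real) \<Rightarrow> real \<Rightarrow> real \<Rightarrow> real \<Rightarrow> (real \<Rightarrow> real) \<Rightarrow> bool" where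
  "cavitating_profile d h H lam \<sigma> r \<longleftrightarrow>
     \<sigma> > 0 \<and>
     (\<forall>s\<ge>0. r s > 0) \<and> continuous_on {0..} r \<and>
     (\<forall>s\<ge>\<sigma>. r s = lam * s) \<and>
     (\<forall>s\<in>{0<..<\<sigma>}. r field_differentiable at s \<and> deriv r field_differentiable at s) \<and>
     continuous_on {0<..<\<sigma>} (deriv (deriv r)) \<and>
     (\<forall>s\<in>{0<..<\<sigma>}.
        s\<^sup>2 * deriv (deriv r) s =
          deriv (prof_P1 d h r) s + (real d - 1) / s * (prof_P1 d h r s - prof_P2 d h r s)) \<and>
     (\<exists>\<rho> p. (deriv r \<longlongrightarrow> \<rho>) (at_left \<sigma>) \<and> (prof_P1 d h r \<longlongrightarrow> p) (at_left \<sigma>) \<and>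
        \<sigma>\<^sup>2 * (lam - \<rho>) = lam + lam ^ (d - 1) * deriv h (lam ^ d) - p) \<and>
     (prof_v d r \<longlongrightarrow> H) (at_right 0)"

text \<open>
  Properties established by Pericak-Spector and Spector for their solution.  Strict
  monotonicity of \<open>r'\<close> on \<open>{0<..<\<sigma>}\<close> extends to \<open>\<sigma>\<close> with the value \<open>r'(\<sigma>-)\<close> there.
\<close>
definition cavitating_profile_properties ::
    "nat \<Rightarrow> real \<Rightarrow> real \<Rightarrow> real \<Rightarrow> (real \<Rightarrow> real) \<Rightarrow> bool" where
  "cavitating_profile_properties d H lam \<sigma> r \<longleftrightarrow>
     (\<forall>s\<in>{0<..<\<sigma>}. H \<le> prof_v d r s \<and> prof_v d r s \<le> lam ^ d) \<and>
     (\<forall>s\<in>{0<..<\<sigma>}. deriv r s \<ge> 0) \<and>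
     strict_mono_on {0<..<\<sigma>} (deriv r) \<and>
     (\<exists>\<rho><lam. (deriv r \<longlongrightarrow> \<rho>) (at_left \<sigma>)) \<and>
     strict_mono_on {0<..<\<sigma>} (prof_v d r) \<and>
     (\<forall>s\<in>{0<..<\<sigma>}. r s > lam * s \<and> lam * s > s * deriv r s)"

text \<open>At \<open>x = 0\<close>, where \<open>x/|x|\<close> is undefined, the value is 0.\<close>
definition radial_map :: "(real \<Rightarrow> real \<Rightarrow> real) \<Rightarrow> real^'d \<Rightarrow> real \<Rightarrow> real^'d" where
  "radial_map w x t = w (norm x) t *\<^sub>R (x /\<^sub>R norm x)"

definition cavitating_map :: "real \<Rightarrow> (real \<Rightarrow> real) \<Rightarrow> real^'d \<Rightarrow> real \<Rightarrow> real^'d" where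
  "cavitating_map lam r x t =
     (if t > 0 then radial_map (\<lambda>R t. t * r (R / t)) x t else lam *\<^sub>R x)"

section \<open>Averaging and slic-solutions\<close>

definition admissible_mollifier :: "(real \<Rightarrow> real) \<Rightarrow> bool" where
  "admissible_mollifier \<phi> \<longleftrightarrow>
     (\<forall>k. Ck k \<phi>) \<and> (\<forall>x. \<phi> x \<ge> 0) \<and> (\<forall>x. \<phi> (- x) = \<phi> x) \<and>
     (LINT x|lebesgue. \<phi> x) = 1 \<and> closure {x. \<phi> x \<noteq> 0} \<subseteq> {-1..1} \<and> \<phi> 0 > 0"

definition scaled :: "(real \<Rightarrow> real) \<Rightarrow> nat \<Rightarrow> real \<Rightarrow> real" where
  "scaled \<phi> n R = real n * \<phi> (real n * R)"

definition averaged ::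
    "(real \<Rightarrow> real) \<Rightarrow> nat \<Rightarrow> (real \<Rightarrow> real \<Rightarrow> real) \<Rightarrow> real \<Rightarrow> real \<Rightarrow> real" where
  "averaged \<phi> n w R t =
     (LINT R':{0..}|lebesgue. (scaled \<phi> n (R - R') - scaled \<phi> n (R + R')) * w R' t)"

definition Linf_loc_L1_loc :: "(real^'d \<Rightarrow> real \<Rightarrow> real^'d) \<Rightarrow> bool" where
  "Linf_loc_L1_loc y \<longleftrightarrow>
     (\<lambda>(x, t). y x t) \<in> borel_measurable lebesgue \<and>
     (\<forall>I K. compact I \<and> compact K \<longrightarrow>
        (\<exists>C. AE t in lebesgue_on I.
           integrable (lebesgue_on K) (\<lambda>x. y x t) \<and>
           (LINT x|lebesgue_on K. norm (y x t)) \<le> C))"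

text \<open>
  The index \<open>n\<close> starts at 1, since \<open>scaled \<phi> 0 = 0\<close>.  The profile \<open>w(R,t)\<close> is determined by
  \<open>y\<close> for \<open>R > 0\<close>, and \<open>averaged\<close> depends on these values only.
\<close>
definition slic_solution ::
    "(real \<Rightarrow> real) \<Rightarrow> real \<Rightarrow> (real^'d \<Rightarrow> real \<Rightarrow> real^'d) \<Rightarrow> bool" where
  "slic_solution h lam y \<longleftrightarrow>
     Linf_loc_L1_loc y \<and>
     (\<forall>x. \<forall>t\<le>0. y x t = lam *\<^sub>R x) \<and>
     (\<exists>rbar>0. \<forall>t>0. \<forall>x. norm x > rbar * t \<longrightarrow> y x t = lam *\<^sub>R x) \<and>
     (\<exists>w. (\<forall>x t. x \<noteq> 0 \<longrightarrow> y x t = radial_map w x t) \<and>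
        (\<forall>t. mono_on {0..} (\<lambda>R. w R t)) \<and>
        (\<forall>\<phi>. admissible_mollifier \<phi> \<longrightarrow>
           (\<forall>n\<ge>1. \<exists>\<epsilon>>0. \<forall>x t.
              det (grad_x (radial_map (averaged \<phi> n w) :: real^'d \<Rightarrow> real \<Rightarrow> real^'d) x t) \<ge> \<epsilon>) \<and>
           (\<forall>\<psi> :: (real^'d) \<times> real \<Rightarrow> real^'d. Ck 2 \<psi> \<and> compactly_supported \<psi> \<longrightarrow>
              (\<forall>n\<ge>1. weak_integrable h (radial_map (averaged \<phi> n w)) \<psi>) \<and>
              (\<lambda>n. weak_integral h (radial_map (averaged \<phi> n w)) \<psi>) \<longlonglongrightarrow> 0)))"

end

theory Submission
  imports Defs "HOL-Computational_Algebra.Polynomial"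
begin

text \<open>
  A radial gradient with stretches \<open>a\<close> (radial) and \<open>b\<close> (tangential) has determinant
  \<open>a b\<^sup>d\<^sup>-\<^sup>1\<close>, and its stress has the principal values \<open>a + b\<^sup>d\<^sup>-\<^sup>1 h'\<close> and \<open>b + a b\<^sup>d\<^sup>-\<^sup>2 h'\<close>, with
  \<open>h'\<close> evaluated at the determinant.  Since \<open>w\<close> is homogeneous of degree one,
  \<open>\<nabla>y\<^sup>n(x, t) = \<nabla>y\<^sup>1(n x, n t)\<close>, so all estimates are made for \<open>n = 1\<close>.

  Where \<open>n |x| \<ge> 3\<close>, the determinant stays between two positive constants because
  \<open>v = w' (w/R)\<^sup>d\<^sup>-\<^sup>1\<close> lies in \<open>[H, \<lambda>\<^sup>d]\<close> and \<open>w/R\<close> decreases.  The stress is then dominated by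
  \<open>|x|\<^sup>1\<^sup>-\<^sup>d\<close>, and this part of the weak form tends to that of \<open>y\<close>, which vanishes, also for
  test functions that are only twice differentiable, by mollifying them.  Where
  \<open>n |x| < 3\<close>, the stretches are at most of order \<open>n\<close>, and they are of this order close to the
  origin, where the odd extension of \<open>w\<close> jumps.  This region has volume of order \<open>n\<^sup>-\<^sup>d\<close>, so
  it contributes about \<open>n\<^sup>-\<^sup>d n\<^sup>d\<^sup>-\<^sup>1 h'(n\<^sup>d) = h'(n\<^sup>d)/n\<close>.
\<close>

section \<open>Symmetric matrices and the stored energy\<close>

text \<open>Because time is scaled together with space, the bounds for n = 1 have to be uniform in
  time. The delicate one is the lower bound for the determinant. A little away from the origin the
  averaging window may see only the slope of w, which decays like T0^(1-d) when the cavity radius T0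
  grows, so the radial stretch alone has no positive lower bound. The jump at the origin still keeps
  the tangential stretch above a multiple of T0, and its power d - 1 compensates. Since h' is
  increasing, this gives a lower bound for h' along all averages, and negative stresses near the
  origin contribute only O(1/n). For the negative result it then suffices to bound the integrand
  from below by order n^d on a small cylinder around the origin, with a test function whose gradient
  has nonnegative coefficients there; how large h' becomes on the rest of the inner region does not
  matter. The eigenvalues in the definition of the energy are removed once and for all: W = |F|^2/2
  + h(|det F|), with gradient F + h'(det F) cof F where det F > 0.\<close>

lemma matrix_diff_ldistrib: "A ** (B - C) = A ** B - A ** (C :: real^'k^'m)"
  by (simp add: matrix_matrix_mult_def vec_eq_iff algebra_simps sum_subtractf)

lemma matrix_diff_rdistrib: "(A - B) ** C = A ** C - B ** (C :: real^'k^'m)"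
  by (simp add: matrix_matrix_mult_def vec_eq_iff algebra_simps sum_subtractf)

text \<open>For small t the linear term dominates. This is the first-order condition for the
  Rayleigh quotient below.\<close>

lemma quadratic_nonneg_imp_zero:
  fixes k m :: real
  assumes "\<And>t. 0 \<le> k * t + m * t\<^sup>2"
  shows "k = 0"
proof (rule ccontr)
  assume "k \<noteq> 0"
  define M where "M = \<bar>m\<bar> + 1"
  \<comment> \<open>This minimises k t + M t^2, where M = |m| + 1 is positive even if m is not; the
    minimum is - M t^2.\<close>
  define t where "t = - k / (2 * M)"
  have M: "M > 0" "m \<le> M" by (auto simp: M_def)
  have "m * t\<^sup>2 \<le> M * t\<^sup>2" by (intro mult_right_mono M) auto
  moreover have "k * t = - 2 * M * t\<^sup>2"
    using M by (simp add: t_def power2_eq_square field_simps)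
  ultimately have "k * t + m * t\<^sup>2 \<le> - M * t\<^sup>2" by linarith
  moreover have "M * t\<^sup>2 > 0" using M \<open>k \<noteq> 0\<close> by (simp add: t_def)
  ultimately show False using assms[of t] by auto
qed

lemma symmetric_matrix_inner:
  fixes A :: "real^'n^'n"
  assumes "transpose A = A"
  shows "x \<bullet> (A *v y) = (A *v x) \<bullet> y"
  by (metis dot_lmul_matrix assms transpose_matrix_vector)

text \<open>A maximiser v of x . A x on the unit sphere of S is an eigenvector: the residual A v - c
  v lies in S by invariance, and varying v in its direction shows that it vanishes.\<close>

lemma symmetric_eigenvector_in_subspace:
  fixes A :: "real^'n^'n"
  assumes sym: "transpose A = A" and S: "subspace S" and inv: "\<And>x. x \<in> S \<Longrightarrow> A *v x \<in> S"
    and "S \<noteq> {0}"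
  obtains v c where "v \<in> S" "norm v = 1" "A *v v = c *\<^sub>R v"
proof -
  note symi = symmetric_matrix_inner[OF sym]
  obtain s where s: "s \<in> S" "s \<noteq> 0" using assms subspace_0 by blast
  let ?K = "S \<inter> sphere 0 1"
  have "s /\<^sub>R norm s \<in> ?K" using s S by (simp add: subspace_scale)
  then have ne: "?K \<noteq> {}" by blast
  have cK: "compact ?K" using S closed_subspace compact_sphere closed_Int_compact by blast
  have cont: "continuous_on ?K (\<lambda>x. x \<bullet> (A *v x))"
    by (intro continuous_intros linear_continuous_on_compose[OF continuous_on_id]) auto
  obtain v where v: "v \<in> ?K" and max: "\<And>x. x \<in> ?K \<Longrightarrow> x \<bullet> (A *v x) \<le> v \<bullet> (A *v v)"
    using continuous_attains_sup[OF cK ne cont] by blast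
  define c where "c = v \<bullet> (A *v v)"
  have vS: "v \<in> S" and nv: "norm v = 1" using v by auto
  have le: "x \<bullet> (A *v x) \<le> c * (x \<bullet> x)" if "x \<in> S" for x
  proof (cases "x = 0")
    case False
    have "x /\<^sub>R norm x \<in> ?K" using that S False by (simp add: subspace_scale)
    from max[OF this] have "(x \<bullet> (A *v x)) / (norm x)\<^sup>2 \<le> c"
      by (simp add: c_def linear_scale[OF matrix_vector_mul_linear] power2_eq_square field_simps)
    then show ?thesis using False by (simp add: field_simps power2_norm_eq_inner)
  qed simp
  have "A *v v - c *\<^sub>R v = 0"
  proof -
    let ?u = "A *v v - c *\<^sub>R v"
    have uS: "?u \<in> S" using inv vS S by (simp add: subspace_diff subspace_scale)
    let ?q = "\<lambda>x. c * (x \<bullet> x) - x \<bullet> (A *v x)"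
    \<comment> \<open>The form c |x|^2 - x . A x is nonnegative on S and zero at v; along v + t u
      the coefficient of t is -2 |u|^2.\<close>
    have "0 \<le> (-2 * (?u \<bullet> ?u)) * t + ?q ?u * t\<^sup>2" for t
    proof -
      have "0 \<le> ?q (v + t *\<^sub>R ?u)"
        using le[of "v + t *\<^sub>R ?u"] vS uS S by (simp add: subspace_add subspace_scale)
      also have "?q (v + t *\<^sub>R ?u) = ?q v + (-2 * (?u \<bullet> ?u)) * t + ?q ?u * t\<^sup>2"
      proof -
        have "?q (v + t *\<^sub>R u) = ?q v + 2 * (c * (u \<bullet> v) - u \<bullet> (A *v v)) * t + ?q u * t\<^sup>2" for u
        proof -
          have 1: "A *v (v + t *\<^sub>R u) = A *v v + t *\<^sub>R (A *v u)"
            by (simp add: linear_scale[OF matrix_vector_mul_linear] matrix_vector_right_distrib)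
          have 2: "v \<bullet> (A *v u) = u \<bullet> (A *v v)" by (metis symi inner_commute)
          show ?thesis unfolding 1
            by (simp add: inner_add_left inner_add_right power2_eq_square 2
                inner_commute[of v u] algebra_simps)
        qed
        moreover have "?u \<bullet> ?u = ?u \<bullet> (A *v v) - c * (?u \<bullet> v)"
          by (simp add: inner_diff_right)
        ultimately show ?thesis by simp
      qed
      also have "?q v = 0" using nv by (simp add: c_def norm_eq_1)
      finally show ?thesis by simp
    qed
    from quadratic_nonneg_imp_zero[OF this] show ?thesis by simp
  qed
  then show ?thesis using that[of v c] vS nv by simp
qed

text \<open>Induction on the dimension: the orthogonal complement of an eigenvector inside S is
  again invariant. Invariant subspaces appear in the statement so that the induction hypothesis
  applies to this complement.\<close>

lemma symmetric_eigenbasis_subspace: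
  fixes A :: "real^'n^'n"
  assumes sym: "transpose A = A"
  shows "subspace S \<Longrightarrow> (\<And>x. x \<in> S \<Longrightarrow> A *v x \<in> S) \<Longrightarrow> dim S = k \<Longrightarrow>
    \<exists>B. B \<subseteq> S \<and> pairwise orthogonal B \<and> (\<forall>b\<in>B. norm b = 1 \<and> (\<exists>c. A *v b = c *\<^sub>R b)) \<and>
       finite B \<and> card B = k"
proof (induction k arbitrary: S)
  case 0
  then show ?case by (intro exI[of _ "{}"]) auto
next
  case (Suc k)
  note symi = symmetric_matrix_inner[OF sym]
  have "S \<noteq> {0}" using Suc.prems(3) by auto
  then obtain v c where v: "v \<in> S" "norm v = 1" "A *v v = c *\<^sub>R v"
    using symmetric_eigenvector_in_subspace[OF sym Suc.prems(1,2)] by blast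
  let ?T = "{y \<in> S. orthogonal v y}"
  have sT: "subspace ?T"
    using Suc.prems(1) by (auto simp: subspace_def orthogonal_def inner_add_right)
  have inv: "A *v x \<in> ?T" if "x \<in> ?T" for x
    using that Suc.prems(2) v(3) by (auto simp: orthogonal_def symi)
  have "dim ?T + dim {v} = dim S"
  proof -
    have "dim {y \<in> S. \<forall>x \<in> span {v}. orthogonal x y} + dim (span {v}) = dim S"
      by (rule dim_subspace_orthogonal_to_vectors) (use Suc.prems(1) v in \<open>auto simp: span_minimal\<close>)
    moreover have "(\<forall>x \<in> span {v}. orthogonal x y) \<longleftrightarrow> orthogonal v y" for y
      by (auto simp: span_singleton orthogonal_def)
    ultimately show ?thesis by simp
  qed
  moreover have "v \<noteq> 0" using v by auto
  ultimately have "dim ?T = k" using Suc.prems(3) by (simp add: dim_insert)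
  from Suc.IH[OF sT inv this] obtain B where B: "B \<subseteq> ?T" "pairwise orthogonal B"
    "\<forall>b\<in>B. norm b = 1 \<and> (\<exists>c. A *v b = c *\<^sub>R b)" "finite B" "card B = k" by blast
  have "v \<notin> B" using B(1) v(2) by (auto simp: orthogonal_def norm_eq_1)
  then show ?case
    by (intro exI[of _ "insert v B"])
      (use B v in \<open>auto simp: pairwise_insert orthogonal_commute\<close>)
qed

definition diag_matrix :: "('n \<Rightarrow> real) \<Rightarrow> real^'n^'n" where
  "diag_matrix l = (\<chi> i j. if i = j then l i else 0)"

lemma transpose_diag_matrix [simp]: "transpose (diag_matrix l) = diag_matrix l"
  by (simp add: diag_matrix_def transpose_def vec_eq_iff)

lemma diag_matrix_mult: "diag_matrix l ** diag_matrix m = diag_matrix (\<lambda>i. l i * m i)"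
  by (simp add: diag_matrix_def matrix_matrix_mult_def vec_eq_iff if_distrib[of "\<lambda>x. x * _"]
      if_distrib[of "\<lambda>x. _ * x"] cong: if_cong)

lemma det_diag_matrix: "det (diag_matrix l) = (\<Prod>i\<in>UNIV. l i)"
  by (subst det_diagonal) (auto simp: diag_matrix_def)

lemma trace_diag_matrix: "trace (diag_matrix l) = (\<Sum>i\<in>UNIV. l i)"
  by (simp add: trace_def diag_matrix_def)

lemma diag_matrix_vector: "diag_matrix l *v x = (\<chi> i. l i * x $ i)"
  by (simp add: diag_matrix_def matrix_vector_mult_def vec_eq_iff if_distrib[of "\<lambda>x. x * _"] cong: if_cong)

theorem symmetric_matrix_diagonalizable:
  fixes A :: "real^'n^'n"
  assumes sym: "transpose A = A"
  obtains Q l where "orthogonal_matrix Q" "A = Q ** diag_matrix l ** transpose Q"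
proof -
  obtain B where B: "pairwise orthogonal B" 
    "\<forall>b\<in>B. norm b = 1 \<and> (\<exists>c. A *v b = c *\<^sub>R b)" "finite B" "card B = CARD('n)"
    using symmetric_eigenbasis_subspace[OF sym, of UNIV "CARD('n)"] by auto
  obtain f where f: "bij_betw f (UNIV::'n set) B"
    by (metis B(3,4) finite_class.finite_UNIV finite_same_card_bij)
  have fB: "f i \<in> B" for i using f bij_betwE by blast
  have "\<forall>i. \<exists>c. A *v f i = c *\<^sub>R f i" using B(2) fB by blast
  from choice[OF this] obtain l where l: "\<And>i. A *v f i = l i *\<^sub>R f i" by blast
  define Q where "Q = (\<chi> i j. f j $ i)"
  have col: "column j Q = f j" for j by (simp add: Q_def column_def)
  have orth: "orthogonal_matrix Q"
    unfolding orthogonal_matrix_orthonormal_columns col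
  proof (intro conjI allI impI)
    show "norm (f i) = 1" for i using B(2) fB by blast
    fix i j :: 'n assume "i \<noteq> j"
    then have "f i \<noteq> f j" using f by (auto simp: bij_betw_def dest: injD)
    then show "orthogonal (f i) (f j)" using B(1) fB by (simp add: pairwise_def)
  qed
  have "A ** Q = Q ** diag_matrix l"
  proof -
    have "(A ** Q) $ i $ j = (Q ** diag_matrix l) $ i $ j" for i j
    proof -
      have "(A ** Q) $ i $ j = (A *v f j) $ i"
        by (simp add: Q_def matrix_matrix_mult_def matrix_vector_mult_def)
      also have "\<dots> = l j * f j $ i" by (simp add: l)
      also have "\<dots> = (Q ** diag_matrix l) $ i $ j"
        by (simp add: Q_def matrix_matrix_mult_def diag_matrix_def if_distrib[of "\<lambda>x. _ * x"] mult.commute cong: if_cong)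
      finally show ?thesis .
    qed
    then show ?thesis by (simp add: vec_eq_iff)
  qed
  then have "A ** (Q ** transpose Q) = Q ** diag_matrix l ** transpose Q"
    by (simp add: matrix_mul_assoc)
  then show ?thesis using that[OF orth] orth by (simp add: orthogonal_matrix_def)
qed

text \<open>The columns of Q are eigenvectors, so positivity tested on them makes the diagonal
  entries nonnegative and their square roots available.\<close>

lemma psd_sqrt_exists:
  fixes A :: "real^'n^'n"
  assumes sym: "transpose A = A" and psd: "\<And>x. 0 \<le> x \<bullet> (A *v x)"
  obtains Q m where "orthogonal_matrix Q" "\<And>i. m i \<ge> 0"
    "(Q ** diag_matrix m ** transpose Q) ** (Q ** diag_matrix m ** transpose Q) = A"
proof -
  obtain Q l where Q: "orthogonal_matrix Q" and A: "A = Q ** diag_matrix l ** transpose Q"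
    using symmetric_matrix_diagonalizable[OF sym] by blast
  have QQ: "transpose Q ** Q = mat 1" using Q orthogonal_matrix by blast
  have l: "l i \<ge> 0" for i
  proof -
    let ?x = "Q *v axis i 1"
    have "transpose Q *v ?x = axis i 1" by (simp add: matrix_vector_mul_assoc QQ)
    then have "A *v ?x = Q *v (diag_matrix l *v axis i 1)"
      by (simp add: A matrix_vector_mul_assoc[symmetric])
    then have "?x \<bullet> (A *v ?x) = axis i 1 \<bullet> (diag_matrix l *v axis i 1)"
      by (metis dot_lmul_matrix QQ matrix_vector_mul_assoc matrix_vector_mul_lid transpose_matrix_vector)
    also have "\<dots> = l i" by (simp add: diag_matrix_vector inner_axis')
    finally show ?thesis using psd by metis
  qed
  define m where "m i = sqrt (l i)" for i
  have "(Q ** diag_matrix m ** transpose Q) ** (Q ** diag_matrix m ** transpose Q)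
     = Q ** (diag_matrix m ** (transpose Q ** Q) ** diag_matrix m) ** transpose Q"
    by (simp only: matrix_mul_assoc)
  also have "\<dots> = A" using l by (simp add: QQ diag_matrix_mult m_def A)
  finally show ?thesis using that[OF Q, of m] l by (simp add: m_def)
qed

lemma orthogonal_conj_diag_psd:
  fixes Q :: "real^'n^'n"
  assumes "orthogonal_matrix Q" "\<And>i. m i \<ge> 0"
  shows "0 \<le> x \<bullet> ((Q ** diag_matrix m ** transpose Q) *v x)"
proof -
  have "x \<bullet> ((Q ** diag_matrix m ** transpose Q) *v x) = 
     (transpose Q *v x) \<bullet> (diag_matrix m *v (transpose Q *v x))"
    by (metis dot_lmul_matrix matrix_vector_mul_assoc transpose_matrix_vector)
  also have "\<dots> = (\<Sum>i\<in>UNIV. m i * ((transpose Q *v x) $ i)\<^sup>2)"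
    by (simp add: diag_matrix_vector inner_vec_def power2_eq_square mult_ac)
  also have "\<dots> \<ge> 0" using assms(2) by (intro sum_nonneg) simp
  finally show ?thesis .
qed

text \<open>For \<open>D = U - V\<close> one has \<open>UD + DV = U\<^sup>2 - V\<^sup>2 = 0\<close>; testing this with an eigenvector of \<open>D\<close>
  shows that its eigenvalue vanishes.\<close>
lemma psd_sqrt_unique:
  fixes U V :: "real^'n^'n"
  assumes U: "transpose U = U" "\<And>x. 0 \<le> x \<bullet> (U *v x)"
    and V: "transpose V = V" "\<And>x. 0 \<le> x \<bullet> (V *v x)"
    and eq: "U ** U = V ** V"
  shows "U = V"
proof -
  let ?D = "U - V"
  have symD: "transpose ?D = ?D" using U V by (simp add: transpose_def vec_eq_iff)
  obtain Q l where Q: "orthogonal_matrix Q" and D: "?D = Q ** diag_matrix l ** transpose Q"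
    using symmetric_matrix_diagonalizable[OF symD] by blast
  have QQ: "transpose Q ** Q = mat 1" using Q orthogonal_matrix by blast
  have "l i = 0" for i
  proof (rule ccontr)
    assume li: "l i \<noteq> 0"
    define x where "x = Q *v axis i 1"
    have "transpose Q *v x = axis i 1" by (simp add: x_def matrix_vector_mul_assoc QQ)
    then have "?D *v x = Q *v (diag_matrix l *v axis i 1)"
      by (simp add: D matrix_vector_mul_assoc[symmetric])
    also have "diag_matrix l *v axis i 1 = l i *\<^sub>R axis i 1"
      by (simp add: diag_matrix_vector vec_eq_iff axis_def)
    finally have Dx: "?D *v x = l i *\<^sub>R x"
      by (simp add: x_def linear_scale[OF matrix_vector_mul_linear])
    have x0: "x \<noteq> 0"
      by (metis QQ axis_eq_0_iff matrix_vector_mul_assoc matrix_vector_mul_lid matrix_vector_mult_0_right x_def zero_neq_one)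
    have "x \<bullet> ((U ** ?D + ?D ** V) *v x) = 0"
    proof -
      have "U ** ?D + ?D ** V = U ** U - V ** V"
        by (simp add: matrix_diff_ldistrib matrix_diff_rdistrib)
      then show ?thesis by (simp add: eq)
    qed
    moreover have "x \<bullet> ((U ** ?D + ?D ** V) *v x) = l i * (x \<bullet> (U *v x)) + l i * (x \<bullet> (V *v x))"
    proof -
      have 1: "(U ** ?D) *v x = l i *\<^sub>R (U *v x)"
        by (metis Dx linear_scale[OF matrix_vector_mul_linear] matrix_vector_mul_assoc)
      have "x \<bullet> ((?D ** V) *v x) = (?D *v x) \<bullet> (V *v x)"
        by (metis dot_lmul_matrix matrix_vector_mul_assoc symD transpose_matrix_vector)
      then show ?thesis
        by (simp only: matrix_vector_mult_add_rdistrib inner_add_right 1 Dx inner_scaleR_left inner_scaleR_right)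
    qed
    ultimately have "x \<bullet> (U *v x) + x \<bullet> (V *v x) = 0"
      using li by (metis distrib_left mult_eq_0_iff)
    then have z: "x \<bullet> (U *v x) = 0" "x \<bullet> (V *v x) = 0"
      using U(2)[of x] V(2)[of x] by linarith+
    have "x \<bullet> (?D *v x) = 0" using z by (simp add: matrix_vector_mult_diff_rdistrib inner_diff_right)
    then show False using Dx li x0 by simp
  qed
  then have "diag_matrix l = 0" by (simp add: diag_matrix_def vec_eq_iff)
  then have "?D = 0" by (simp add: D)
  then show ?thesis by simp
qed

text \<open>Existence and uniqueness of the positive semidefinite root make the \<open>THE\<close>
  in \<open>matrix_sqrt\<close> meaningful for every F, and the diagonal form exhibits the
  eigenvalues of the root.\<close>

lemma matrix_sqrt_eq:
  fixes F :: "real^'n^'n"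
  obtains Q m where "orthogonal_matrix Q" "\<And>i. m i \<ge> 0"
    "matrix_sqrt (F ** transpose F) = Q ** diag_matrix m ** transpose Q"
    "(Q ** diag_matrix m ** transpose Q) ** (Q ** diag_matrix m ** transpose Q) = F ** transpose F"
proof -
  let ?A = "F ** transpose F"
  have "x \<bullet> (?A *v x) = (transpose F *v x) \<bullet> (transpose F *v x)" for x
    by (metis dot_lmul_matrix matrix_vector_mul_assoc transpose_matrix_vector)
  then have "0 \<le> x \<bullet> (?A *v x)" for x by simp
  moreover have "transpose ?A = ?A" by (simp add: matrix_transpose_mul)
  ultimately obtain Q m where Q: "orthogonal_matrix Q" and m: "\<And>i. m i \<ge> 0" and
    QQ: "(Q ** diag_matrix m ** transpose Q) ** (Q ** diag_matrix m ** transpose Q) = ?A"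
    using psd_sqrt_exists by blast
  let ?U = "Q ** diag_matrix m ** transpose Q"
  have tU: "transpose ?U = ?U" by (simp add: matrix_transpose_mul matrix_mul_assoc)
  have "matrix_sqrt ?A = ?U"
    unfolding matrix_sqrt_def
  proof (rule the_equality)
    show U: "transpose ?U = ?U \<and> (\<forall>x. 0 \<le> x \<bullet> (?U *v x)) \<and> ?U ** ?U = ?A"
      using tU orthogonal_conj_diag_psd[of Q m] Q m QQ by blast
    show "U = ?U" if "transpose U = U \<and> (\<forall>x. 0 \<le> x \<bullet> (U *v x)) \<and> U ** U = ?A" for U
      by (rule psd_sqrt_unique) (use that U in auto)
  qed
  then show ?thesis using that[OF Q m] QQ by simp
qed

text \<open>\<open>stored_energy\<close> picks some eigenvalue family, so two families with the same
  characteristic polynomial have to give the same energy. Comparing the orders of the roots shows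
  that both take each value equally often.\<close>

lemma prod_linear_factors_unique:
  fixes l m :: "'n::finite \<Rightarrow> real"
  assumes "\<And>z. (\<Prod>i\<in>UNIV. z - l i) = (\<Prod>i\<in>UNIV. z - m i)"
  shows "(\<Sum>i\<in>UNIV. g (l i)) = (\<Sum>i\<in>UNIV. (g (m i) :: real))"
    and "(\<Prod>i\<in>UNIV. l i) = (\<Prod>i\<in>UNIV. m i)"
proof -
  let ?p = "\<lambda>l. \<Prod>i\<in>(UNIV::'n set). [:- l i, 1:]"
  have "poly (?p l) = poly (?p m)"
    using assms by (intro ext) (simp add: poly_prod)
  then have pe: "?p l = ?p m" by (rule poly_eqI2[OF _] | simp add: poly_eq_poly_eq_iff)
  have ord: "order z (?p l) = card {i. l i = z}" for z and l :: "'n \<Rightarrow> real"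
  proof -
    have "order z (\<Prod>i\<in>S. [:- l i, 1:]) = card {i\<in>S. l i = z}" if "finite S" for S
      using that
    proof (induction S rule: finite_induct)
      case (insert x S)
      have nz: "[:- l x, 1:] * (\<Prod>i\<in>S. [:- l i, 1:]) \<noteq> 0"
        using insert(1) by (intro no_zero_divisors) auto
      have "{i \<in> insert x S. l i = z} = (if l x = z then insert x {i\<in>S. l i = z} else {i\<in>S. l i = z})"
        by auto
      moreover have "order z [:- l x, 1:] = (if l x = z then 1 else 0)"
        using order_power_n_n[of "z" 1] by (auto intro: order_0I)
      moreover have "order z (\<Prod>i\<in>insert x S. [:- l i, 1:]) =
          order z [:- l x, 1:] + order z (\<Prod>i\<in>S. [:- l i, 1:])"
        by (simp only: prod.insert[OF insert(1,2)] order_mult[OF nz])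
      ultimately show ?case using insert by simp
    qed simp
    from this[of UNIV] show ?thesis by simp
  qed
  have cnt: "card {i. l i = z} = card {i. m i = z}" for z using pe ord by metis
  have sum: "(\<Sum>i\<in>UNIV. g (l i)) = (\<Sum>z\<in>range l \<union> range m. real (card {i. l i = z}) * g z)" for g :: "real \<Rightarrow> real" and l m :: "'n \<Rightarrow> real"
  proof -
    have "(\<Sum>i\<in>UNIV. g (l i)) = (\<Sum>z\<in>range l. \<Sum>i\<in>{i\<in>UNIV. l i = z}. g (l i))"
      by (rule sum.image_gen) simp
    also have "\<dots> = (\<Sum>z\<in>range l. real (card {i. l i = z}) * g z)" by simp
    also have "\<dots> = (\<Sum>z\<in>range l \<union> range m. real (card {i. l i = z}) * g z)"
      by (rule sum.mono_neutral_left) (auto intro!: arg_cong[of _ "{}" card])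
    finally show ?thesis .
  qed
  show "(\<Sum>i\<in>UNIV. g (l i)) = (\<Sum>i\<in>UNIV. (g (m i) :: real))"
    using sum[of g l m] sum[of g m l] by (simp add: cnt Un_commute)
  \<comment> \<open>The characteristic polynomials at z = 0; both products carry the same
    sign.\<close>
  have "(\<Prod>i\<in>UNIV. - l i) = (\<Prod>i\<in>UNIV. - m i)" using assms[of 0] by simp
  then show "(\<Prod>i\<in>UNIV. l i) = (\<Prod>i\<in>UNIV. m i)" by (simp add: prod_uminus)
qed

text \<open>The sum of the squared eigenvalues is the trace of F F^T, and the square of their
  product is its determinant. The modulus appears because the eigenvalues of the root are
  nonnegative while det F may have either sign.\<close>

theorem stored_energy_eq:
  fixes F :: "real^'n^'n"
  shows "stored_energy h F = (F \<bullet> F) / 2 + h \<bar>det F\<bar>"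
proof -
  obtain Q m where Q: "orthogonal_matrix Q" and m: "\<And>i. m i \<ge> 0" and
    S: "matrix_sqrt (F ** transpose F) = Q ** diag_matrix m ** transpose Q" and
    SS: "(Q ** diag_matrix m ** transpose Q) ** (Q ** diag_matrix m ** transpose Q) = F ** transpose F"
    using matrix_sqrt_eq by blast
  have QQ: "transpose Q ** Q = mat 1" "Q ** transpose Q = mat 1" 
    using Q orthogonal_matrix_def by blast+
  have dQ: "det Q * det Q = 1" by (metis QQ(1) det_I det_mul det_transpose)
  have char: "det (mat z - Q ** diag_matrix m ** transpose Q) = (\<Prod>i\<in>UNIV. z - m i)" for z
  proof -
    have "mat z - Q ** diag_matrix m ** transpose Q = Q ** (mat z - diag_matrix m) ** transpose Q"
    proof -
      have "Q ** mat z ** transpose Q = mat z"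
      proof -
        have mz: "mat z = z *\<^sub>R (mat 1 :: real^'n^'n)" by (simp add: mat_def vec_eq_iff)
        show ?thesis unfolding mz
          by (simp add: scalar_matrix_assoc[symmetric] matrix_scalar_ac QQ)
      qed
      then show ?thesis by (simp add: matrix_diff_ldistrib matrix_diff_rdistrib)
    qed
    also have "det \<dots> = det (mat z - diag_matrix m)" using dQ by (simp add: det_mul mult_ac)
    also have "mat z - diag_matrix m = diag_matrix (\<lambda>i. z - m i)"
      by (auto simp: mat_def diag_matrix_def vec_eq_iff)
    finally show ?thesis by (simp add: det_diag_matrix)
  qed
  define l where "l = (SOME l. eigenvalue_family (matrix_sqrt (F ** transpose F)) l)"
  have "eigenvalue_family (matrix_sqrt (F ** transpose F)) m"
    by (simp add: eigenvalue_family_def S char)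
  then have "eigenvalue_family (matrix_sqrt (F ** transpose F)) l"
    unfolding l_def using someI[of "eigenvalue_family (matrix_sqrt (F ** transpose F))" m] by simp
  then have lm: "(\<Prod>i\<in>UNIV. z - l i) = (\<Prod>i\<in>UNIV. z - m i)" for z
    by (simp add: eigenvalue_family_def S char)
  have "Q ** diag_matrix (\<lambda>i. m i * m i) ** transpose Q = 
     Q ** (diag_matrix m ** (transpose Q ** Q) ** diag_matrix m) ** transpose Q"
    by (simp add: QQ diag_matrix_mult)
  also have "\<dots> = F ** transpose F" using SS by (simp only: matrix_mul_assoc)
  finally have FF: "Q ** diag_matrix (\<lambda>i. m i * m i) ** transpose Q = F ** transpose F" .
  have "trace (F ** transpose F) = trace (transpose Q ** (Q ** diag_matrix (\<lambda>i. m i * m i)))"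
    unfolding FF[symmetric] by (rule trace_mul_sym)
  also have "\<dots> = (\<Sum>i\<in>UNIV. (m i)\<^sup>2)"
    by (simp add: matrix_mul_assoc QQ trace_diag_matrix power2_eq_square)
  finally have 1: "(\<Sum>i\<in>UNIV. (m i)\<^sup>2) = F \<bullet> F"
    by (simp add: trace_def matrix_matrix_mult_def transpose_def inner_vec_def)
  have "(det F)\<^sup>2 = det (F ** transpose F)" by (simp add: det_mul power2_eq_square)
  also have "\<dots> = (\<Prod>i\<in>UNIV. m i)\<^sup>2"
    unfolding FF[symmetric] using dQ
    by (simp add: det_mul det_diag_matrix mult_ac prod.distrib power2_eq_square)
  \<comment> \<open>Both sides are nonnegative, so equality of the squares suffices.\<close>
  finally have 2: "(\<Prod>i\<in>UNIV. m i) = \<bar>det F\<bar>"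
    using m by (metis abs_of_nonneg power2_eq_iff_nonneg power2_abs prod_nonneg abs_ge_zero)
  show ?thesis
    unfolding stored_energy_def l_def[symmetric] Let_def
    using prod_linear_factors_unique(1)[OF lm, of "\<lambda>x. x\<^sup>2"] prod_linear_factors_unique(2)[OF lm] 1 2
    by simp
qed

section \<open>The stress of radial maps\<close>

text \<open>In the Leibniz formula a permutation other than the identity moves at least two indices.
  After one factor has been differentiated, an off-diagonal entry of the identity matrix remains,
  and the term vanishes.\<close>

lemma has_derivative_det_one:
  "(det has_derivative trace) (at (mat 1 :: real^'n^'n))"
proof -
  have proj: "((\<lambda>A. A $ i $ j) has_derivative (\<lambda>A. A $ i $ j)) F" for i j :: 'n and F :: "(real^'n^'n) filter"
    by (intro bounded_linear_imp_has_derivative bounded_linear_compose[OF bounded_linear_vec_nth bounded_linear_vec_nth])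
  let ?D = "\<lambda>X :: real^'n^'n. \<Sum>p | p permutes (UNIV::'n set). of_int (sign p) *
     (\<Sum>i\<in>UNIV. X $ i $ p i * (\<Prod>j\<in>UNIV - {i}. (mat 1 :: real^'n^'n) $ j $ p j))"
  have D: "(det has_derivative ?D) (at (mat 1 :: real^'n^'n))"
    unfolding det_def by (intro has_derivative_sum has_derivative_mult_right has_derivative_prod proj)
  have "?D X = trace X" for X
  proof -
    have z: "(\<Prod>j\<in>UNIV - {i}. (mat 1 :: real^'n^'n) $ j $ p j) = 0"
      if p: "p permutes UNIV" "p \<noteq> id" for p and i :: 'n
    proof -
      have "\<exists>j. j \<noteq> i \<and> p j \<noteq> j"
      proof (rule ccontr)
        assume "\<not> ?thesis"
        then have fx: "p j = j" if "j \<noteq> i" for j using that by blast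
        have "p i = i" by (metis fx p(1) permutes_def)
        with fx have "p = id" by (metis eq_id_iff)
        then show False using p by simp
      qed
      then obtain j where "j \<noteq> i" "p j \<noteq> j" by blast
      then show ?thesis by (intro prod_zero) (auto simp: mat_def intro!: bexI[of _ j])
    qed
    have "?D X = (\<Sum>p\<in>{id}. of_int (sign p) *
     (\<Sum>i\<in>UNIV. X $ i $ p i * (\<Prod>j\<in>UNIV - {i}. (mat 1 :: real^'n^'n) $ j $ p j)))"
    proof (rule sum.mono_neutral_right)
      show "\<forall>p\<in>{p. p permutes (UNIV::'n set)} - {id}. of_int (sign p) *
         (\<Sum>i\<in>UNIV. X $ i $ p i * (\<Prod>j\<in>UNIV - {i}. (mat 1 :: real^'n^'n) $ j $ p j)) = 0"
      proof
        fix p assume "p \<in> {p. p permutes (UNIV::'n set)} - {id}"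
        then have "p permutes UNIV" "p \<noteq> id" by auto
        note z[OF this]
        then show "of_int (sign p) *
           (\<Sum>i\<in>UNIV. X $ i $ p i * (\<Prod>j\<in>UNIV - {i}. (mat 1 :: real^'n^'n) $ j $ p j)) = 0"
          by (simp only: mult_zero_right sum.neutral_const)
      qed
    qed (simp_all add: finite_permutations permutes_id)
    also have "\<dots> = trace X" by (simp add: trace_def mat_def)
    finally show ?thesis .
  qed
  then show ?thesis using D by (simp add: fun_eq_iff[symmetric] ext[of ?D trace])
qed

text \<open>With B F = 1 one has det X = det F * det (B X), which reduces the derivative at F to the
  one at the identity. The gradient is the cofactor matrix of F.\<close>

lemma has_derivative_det:
  fixes F B :: "real^'n^'n"
  assumes "B ** F = mat 1"
  shows "(det has_derivative (\<lambda>X. X \<bullet> (det F *\<^sub>R transpose B))) (at F)"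
proof -
  have lin: "bounded_linear ((**) B :: real^'n^'n \<Rightarrow> _)"
    by (rule linear_conv_bounded_linear[THEN iffD1]) (auto intro!: linearI simp: matrix_add_ldistrib matrix_scalar_ac scalar_matrix_assoc)
  have "((\<lambda>X. det (B ** X)) has_derivative (\<lambda>X. trace (B ** X))) (at F)"
    by (rule has_derivative_compose[OF bounded_linear_imp_has_derivative[OF lin]])
      (simp add: assms has_derivative_det_one)
  then have "((\<lambda>X. det F * det (B ** X)) has_derivative (\<lambda>X. det F * trace (B ** X))) (at F)"
    by (rule has_derivative_mult_right)
  moreover have "det F * det (B ** X) = det X" for X
    by (metis assms det_I det_mul mult.assoc mult.commute mult_1)
  moreover have "trace (B ** X) = X \<bullet> transpose B" for X
  proof -
    have "trace (B ** X) = (\<Sum>i\<in>UNIV. \<Sum>k\<in>UNIV. B $ i $ k * X $ k $ i)"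
      by (simp add: trace_def matrix_matrix_mult_def)
    also have "\<dots> = (\<Sum>k\<in>UNIV. \<Sum>i\<in>UNIV. B $ i $ k * X $ k $ i)" by (rule sum.swap)
    finally show ?thesis by (simp add: inner_vec_def transpose_def mult.commute)
  qed
  ultimately show ?thesis by simp
qed

lemma stress_eqI:
  assumes "GDERIV (stored_energy h) F :> S"
  shows "stress h F = S"
  unfolding stress_def
proof (rule the_equality)
  show "GDERIV (stored_energy h) F :> S" by fact
next
  fix S' assume "GDERIV (stored_energy h) F :> S'"
  then have "(\<lambda>X. X \<bullet> S') = (\<lambda>X. X \<bullet> S)"
    using assms has_derivative_unique unfolding gderiv_def by blast
  then show "S' = S" by (metis vector_eq_ldot)
qed

text \<open>Near F the determinant is positive, so the modulus in \<open>stored_energy_eq\<close>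
  disappears and the energy is differentiable there.\<close>

lemma stress_eq:
  fixes F B :: "real^'n^'n"
  assumes B: "B ** F = mat 1" and pos: "det F > 0" and h: "h differentiable at (det F)"
  shows "stress h F = F + (deriv h (det F) * det F) *\<^sub>R transpose B"
proof (rule stress_eqI)
  have hd: "(h has_real_derivative deriv h (det F)) (at (det F))"
    using h by (simp add: DERIV_deriv_iff_real_differentiable)
  have "((\<lambda>X. h (det X)) has_derivative (\<lambda>X. deriv h (det F) * (X \<bullet> (det F *\<^sub>R transpose B)))) (at F)"
    using has_derivative_compose[OF has_derivative_det[OF B] hd[unfolded has_field_derivative_def]] .
  then have 1: "((\<lambda>X. X \<bullet> X / 2 + h (det X)) has_derivative
     (\<lambda>X. (X \<bullet> F + F \<bullet> X) / 2 + deriv h (det F) * (X \<bullet> (det F *\<^sub>R transpose B)))) (at F)"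
    by (auto intro!: derivative_eq_intros)
  have "continuous (at F) det" using has_derivative_det[OF B] by (rule has_derivative_continuous)
  then have "\<forall>\<^sub>F X in at F. det X > 0"
    using pos by (auto simp: continuous_at intro: order_tendstoD)
  then have ev: "\<forall>\<^sub>F X in at F. X \<bullet> X / 2 + h (det X) = stored_energy h X"
    by eventually_elim (simp add: stored_energy_eq)
  have "(stored_energy h has_derivative
     (\<lambda>X. (X \<bullet> F + F \<bullet> X) / 2 + deriv h (det F) * (X \<bullet> (det F *\<^sub>R transpose B)))) (at F)"
    by (rule has_derivative_transform_eventually[OF 1 ev]) (use pos in \<open>simp_all add: stored_energy_eq\<close>)
  then show "GDERIV (stored_energy h) F :> F + (deriv h (det F) * det F) *\<^sub>R transpose B"
    unfolding gderiv_def by (simp add: inner_add_right inner_commute[of F] algebra_simps)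
qed

text \<open>The matrix \<open>a u u\<^sup>T + b (1 - u u\<^sup>T)\<close>.\<close>
definition radial_matrix :: "real \<Rightarrow> real \<Rightarrow> real^'n \<Rightarrow> real^'n^'n" where
  "radial_matrix a b u = (\<chi> i j. (a - b) * u $ i * u $ j + (if i = j then b else 0))"

text \<open>Q and k are the same for all a and b: radial matrices with a common u are diagonal in
  one basis, where determinants and products can be read off.\<close>

lemma radial_matrix_diag:
  fixes u :: "real^'n"
  assumes "norm u = 1"
  obtains Q k where "orthogonal_matrix Q"
    "\<And>a b. radial_matrix a b u = Q ** diag_matrix (\<lambda>i. if i = k then a else b) ** transpose Q"
proof -
  fix k :: 'n
  obtain Q where Q: "orthogonal_matrix Q" and u: "Q *v axis k 1 = u"
    using orthogonal_matrix_exists_basis[OF assms] by metis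
  have QQ: "Q ** transpose Q = mat 1" using Q orthogonal_matrix_def by blast
  have Qk: "Q $ i $ k = u $ i" for i
    using u by (auto simp: matrix_vector_mul_component inner_axis vec_eq_iff)
  have "radial_matrix a b u = Q ** diag_matrix (\<lambda>i. if i = k then a else b) ** transpose Q" for a b
  proof -
    have "(Q ** diag_matrix (\<lambda>i. if i = k then a else b) ** transpose Q) $ i $ j = radial_matrix a b u $ i $ j" for i j
    proof -
      have "(Q ** diag_matrix (\<lambda>i. if i = k then a else b) ** transpose Q) $ i $ j =
         (\<Sum>m\<in>UNIV. Q $ i $ m * (if m = k then a else b) * Q $ j $ m)"
        by (simp add: matrix_matrix_mult_def diag_matrix_def transpose_def if_distrib[of "\<lambda>x. _ * x"] cong: if_cong)
      also have "\<dots> = (\<Sum>m\<in>UNIV. (if m = k then (a - b) * Q $ i $ m * Q $ j $ m else 0) + b * (Q $ i $ m * Q $ j $ m))"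
        by (intro sum.cong) (auto simp: algebra_simps)
      also have "\<dots> = (a - b) * u $ i * u $ j + b * (Q ** transpose Q) $ i $ j"
        by (simp add: sum.distrib sum_distrib_left Qk matrix_matrix_mult_def transpose_def)
      finally show ?thesis by (simp add: QQ radial_matrix_def mat_def)
    qed
    then show ?thesis by (simp add: vec_eq_iff)
  qed
  with Q that show ?thesis by blast
qed

lemma det_radial_matrix:
  fixes u :: "real^'n"
  assumes "norm u = 1"
  shows "det (radial_matrix a b u) = a * b ^ (CARD('n) - 1)"
proof -
  obtain Q :: "real^'n^'n" and k where Q: "orthogonal_matrix Q"
    and eq: "\<And>a b. radial_matrix a b u = Q ** diag_matrix (\<lambda>i. if i = k then a else b) ** transpose Q"
    using radial_matrix_diag[OF assms] by blast
  have "det Q * det Q = 1" by (metis Q orthogonal_matrix det_I det_mul det_transpose)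
  then have "det (radial_matrix a b u) = (\<Prod>i\<in>UNIV. if i = k then a else b)"
    by (simp add: eq det_mul det_diag_matrix mult_ac)
  also have "\<dots> = a * (\<Prod>i\<in>UNIV - {k}. b)"
    by (subst prod.remove[of _ k]) (auto intro!: prod.cong)
  finally show ?thesis by simp
qed

lemma radial_matrix_mult:
  fixes u :: "real^'n"
  assumes "norm u = 1"
  shows "radial_matrix a b u ** radial_matrix a' b' u = radial_matrix (a * a') (b * b') u"
proof -
  obtain Q :: "real^'n^'n" and k where Q: "orthogonal_matrix Q"
    and eq: "\<And>a b. radial_matrix a b u = Q ** diag_matrix (\<lambda>i. if i = k then a else b) ** transpose Q"
    using radial_matrix_diag[OF assms] by blast
  let ?d = "\<lambda>a b. diag_matrix (\<lambda>i. if i = k then a else b)"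
  have "radial_matrix a b u ** radial_matrix a' b' u = Q ** (?d a b ** (transpose Q ** Q) ** ?d a' b') ** transpose Q"
    by (simp only: eq matrix_mul_assoc)
  also have "transpose Q ** Q = mat 1" using Q orthogonal_matrix by blast
  also have "?d a b ** mat 1 ** ?d a' b' = ?d (a * a') (b * b')"
    by (simp add: diag_matrix_mult if_distrib cong: if_cong)
  finally show ?thesis by (simp add: eq)
qed

lemma radial_matrix_one: "radial_matrix 1 1 u = mat 1"
  by (simp add: radial_matrix_def mat_def vec_eq_iff)

lemma transpose_radial_matrix: "transpose (radial_matrix a b u) = radial_matrix a b u"
  by (simp add: radial_matrix_def transpose_def vec_eq_iff mult_ac)

lemma radial_matrix_vector: "radial_matrix a b u *v x = ((a - b) * (u \<bullet> x)) *\<^sub>R u + b *\<^sub>R x"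
  by (simp add: radial_matrix_def matrix_vector_mult_def vec_eq_iff inner_vec_def algebra_simps
      sum.distrib sum_distrib_left sum_subtractf if_distrib[of "\<lambda>x. _ * x"] if_distrib[of "\<lambda>x. x * _"] cong: if_cong)

lemma inner_radial_matrix:
  "radial_matrix a b u \<bullet> G = (a - b) * (u \<bullet> (G *v u)) + b * trace G"
  by (simp add: radial_matrix_def inner_vec_def matrix_vector_mult_def trace_def algebra_simps
      sum.distrib sum_distrib_left sum_subtractf if_distrib[of "\<lambda>x. _ * x"] if_distrib[of "\<lambda>x. x * _"] cong: if_cong)

definition stress1 :: "nat \<Rightarrow> (real \<Rightarrow> real) \<Rightarrow> real \<Rightarrow> real \<Rightarrow> real" where
  "stress1 d h a b = a + b ^ (d - 1) * deriv h (a * b ^ (d - 1))"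

definition stress2 :: "nat \<Rightarrow> (real \<Rightarrow> real) \<Rightarrow> real \<Rightarrow> real \<Rightarrow> real" where
  "stress2 d h a b = b + a * b ^ (d - 2) * deriv h (a * b ^ (d - 1))"

text \<open>The inverse of a radial matrix is radial with reciprocal stretches, so the cofactor term
  of the stress is radial too.\<close>

lemma stress_radial_matrix:
  fixes u :: "real^'n"
  assumes u: "norm u = 1" and a: "a > 0" and b: "b > 0" and d: "CARD('n) \<ge> 2"
    and h: "\<And>v. v > 0 \<Longrightarrow> h differentiable at v"
  shows "stress h (radial_matrix a b u) =
     radial_matrix (stress1 CARD('n) h a b) (stress2 CARD('n) h a b) u"
proof -
  let ?F = "radial_matrix a b u" and ?B = "radial_matrix (1 / a) (1 / b) u"
  have det: "det ?F = a * b ^ (CARD('n) - 1)" by (rule det_radial_matrix[OF u])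
  have B: "?B ** ?F = mat 1" using a b by (simp add: radial_matrix_mult[OF u] radial_matrix_one)
  have pos: "det ?F > 0" unfolding det using a b by simp
  have pw: "b ^ (CARD('n) - 1) = b * b ^ (CARD('n) - 2)"
    using d by (metis Suc_1 Suc_diff_Suc Suc_le_lessD power_Suc)
  have "stress h ?F = ?F + (deriv h (det ?F) * det ?F) *\<^sub>R transpose ?B"
    by (rule stress_eq[OF B pos h[OF pos]])
  also have "\<dots> = radial_matrix (a + deriv h (det ?F) * det ?F / a) (b + deriv h (det ?F) * det ?F / b) u"
    unfolding transpose_radial_matrix
    by (simp add: radial_matrix_def vec_eq_iff algebra_simps)
  also have "a + deriv h (det ?F) * det ?F / a = stress1 CARD('n) h a b"
    using a by (simp add: stress1_def det)
  also have "b + deriv h (det ?F) * det ?F / b = stress2 CARD('n) h a b"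
    unfolding stress2_def det pw using b by (simp add: field_simps)
  finally show ?thesis .
qed

section \<open>Gradients of radial maps\<close>

lemma grad_x_eqI:
  assumes "((\<lambda>x'. f x' t) has_derivative (\<lambda>v. A *v v)) (at x)"
  shows "grad_x f x t = A"
  by (simp add: grad_x_def jacobian_def frechet_derivative_at[OF assms, symmetric])

lemma has_derivative_radial_map:
  fixes x :: "real^'n"
  assumes x: "x \<noteq> 0" and w: "((\<lambda>R. w R t) has_real_derivative a) (at (norm x))"
  shows "((\<lambda>x'. radial_map w x' t) has_derivative
     (\<lambda>v. radial_matrix a (w (norm x) t / norm x) (x /\<^sub>R norm x) *v v)) (at x)"
proof -
  have n: "(norm has_derivative (\<lambda>v. v \<bullet> sgn x)) (at x)" using has_derivative_norm[OF x] .
  have w1: "((\<lambda>x'. w (norm x') t) has_derivative (\<lambda>v. a * (v \<bullet> sgn x))) (at x)"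
    by (rule has_derivative_compose[OF n w[unfolded has_field_derivative_def]])
  have n1: "((\<lambda>x'. inverse (norm x')) has_derivative (\<lambda>v. - (inverse (norm x) * (v \<bullet> sgn x) * inverse (norm x)))) (at x)"
    using Deriv.has_derivative_inverse[OF _ n] x by simp
  have "((\<lambda>x'. radial_map w x' t) has_derivative 
     (\<lambda>v. w (norm x) t *\<^sub>R (inverse (norm x) *\<^sub>R v +
          (- (inverse (norm x) * (v \<bullet> sgn x) * inverse (norm x))) *\<^sub>R x) +
          (a * (v \<bullet> sgn x)) *\<^sub>R (x /\<^sub>R norm x))) (at x)"
    unfolding radial_map_def
    by (rule has_derivative_scaleR[OF w1 has_derivative_scaleR[OF n1 has_derivative_ident]])
  moreover have "w (norm x) t *\<^sub>R (inverse (norm x) *\<^sub>R v +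
          (- (inverse (norm x) * (v \<bullet> sgn x) * inverse (norm x))) *\<^sub>R x) +
          (a * (v \<bullet> sgn x)) *\<^sub>R (x /\<^sub>R norm x) =
       radial_matrix a (w (norm x) t / norm x) (x /\<^sub>R norm x) *v v" for v
    by (simp add: radial_matrix_vector sgn_div_norm inner_commute[of v] algebra_simps divide_inverse)
  ultimately show ?thesis by simp
qed

text \<open>\<open>radial_map\<close> vanishes at the origin, so the remainder of the linear
  approximation, divided by |x|, has norm exactly |w(R,t)/R - a| with R = |x|.\<close>

lemma has_derivative_radial_map_0:
  assumes w: "((\<lambda>R. w R t / R) \<longlongrightarrow> a) (at_right 0)"
  shows "((\<lambda>x'::real^'n. radial_map w x' t) has_derivative (\<lambda>v. mat a *v v)) (at 0)"
proof -
  have mat: "mat a *v v = a *\<^sub>R v" for v :: "real^'n"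
    by (simp add: mat_def matrix_vector_mult_def vec_eq_iff if_distrib[of "\<lambda>x. x * _"] cong: if_cong)
  have "filterlim norm (at_right 0) (at (0::real^'n))"
    unfolding filterlim_at by (auto simp: eventually_at_filter intro!: tendsto_eq_intros)
  from filterlim_compose[OF w this]
  have lim: "((\<lambda>x::real^'n. \<bar>w (norm x) t / norm x - a\<bar>) \<longlongrightarrow> 0) (at 0)"
    by (intro tendsto_rabs_zero LIM_zero)
  have "(radial_map w (0 + v) t - radial_map w 0 t - a *\<^sub>R v) /\<^sub>R norm v = 
      (w (norm v) t / norm v - a) *\<^sub>R (v /\<^sub>R norm v)" if "v \<noteq> 0" for v :: "real^'n"
    using that by (simp add: radial_map_def algebra_simps divide_inverse)
  then have eq: "norm ((radial_map w (0 + v) t - radial_map w 0 t - a *\<^sub>R v) /\<^sub>R norm v) = 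
      \<bar>w (norm v) t / norm v - a\<bar>" if "v \<noteq> 0" for v :: "real^'n" using that by (simp add: abs_mult)
  have "((\<lambda>v::real^'n. (radial_map w (0 + v) t - radial_map w 0 t - a *\<^sub>R v) /\<^sub>R norm v) \<longlongrightarrow> 0) (at 0)"
    by (rule tendsto_norm_zero_cancel, rule Lim_transform_eventually[OF lim])
      (use eq in \<open>auto simp: eventually_at_filter\<close>)
  from tendsto_norm_zero[OF this] show ?thesis unfolding has_derivative_at mat
    by (simp add: bounded_linear_scaleR_right divide_inverse mult.commute)
qed

lemma grad_x_radial_map:
  fixes x :: "real^'n"
  assumes "x \<noteq> 0" "((\<lambda>R. w R t) has_real_derivative a) (at (norm x))"
  shows "grad_x (radial_map w) x t = radial_matrix a (w (norm x) t / norm x) (x /\<^sub>R norm x)"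
  by (rule grad_x_eqI) (use has_derivative_radial_map[of x w t a] assms in blast)

lemma grad_x_radial_map_0:
  assumes "((\<lambda>R. w R t / R) \<longlongrightarrow> a) (at_right 0)"
  shows "grad_x (radial_map w) (0::real^'n) t = mat a"
  by (rule grad_x_eqI) (use has_derivative_radial_map_0[of w t a] assms in blast)

section \<open>Smooth functions\<close>

lemma Ck_SucI:
  assumes "\<And>x. (f has_derivative D x) (at x)" "\<And>v. Ck k (\<lambda>x. D x v)"
  shows "Ck (Suc k) f"
  using assms frechet_derivative_at[OF assms(1)] by (auto simp: differentiable_def)

lemma Ck_continuous: "Ck k f \<Longrightarrow> continuous_on UNIV f"
  by (cases k) (auto intro!: continuous_at_imp_continuous_on differentiable_imp_continuous_within)

lemma Ck_Suc_imp: "Ck (Suc k) f \<Longrightarrow> Ck k f"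
  by (induction k arbitrary: f) 
    (auto intro!: continuous_at_imp_continuous_on differentiable_imp_continuous_within)

lemma Ck_has_derivative: "Ck (Suc k) f \<Longrightarrow> (f has_derivative frechet_derivative f (at x)) (at x)"
  using frechet_derivative_works by auto

lemma Ck_const: "Ck k (\<lambda>_. c)"
  by (induction k arbitrary: c) (auto simp: continuous_on_const)

lemma Ck_bounded_linear: "bounded_linear f \<Longrightarrow> Ck k f"
  by (cases k) (auto intro: linear_continuous_on Ck_SucI[OF bounded_linear_imp_has_derivative] Ck_const
    simp del: Ck.simps(2))

lemma Ck_add: "Ck k f \<Longrightarrow> Ck k g \<Longrightarrow> Ck k (\<lambda>x. f x + g x)"
proof (induction k arbitrary: f g)
  case (Suc k)
  show ?case
    by (rule Ck_SucI[OF has_derivative_add[OF Ck_has_derivative[OF Suc.prems(1)] Ck_has_derivative[OF Suc.prems(2)]]])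
      (rule Suc.IH; use Suc.prems in simp)
qed (simp add: continuous_on_add)

lemma Ck_bilinear:
  assumes "bounded_bilinear B"
  shows "Ck k f \<Longrightarrow> Ck k g \<Longrightarrow> Ck k (\<lambda>x. B (f x) (g x))"
proof (induction k arbitrary: f g)
  case 0
  then show ?case by (simp add: bounded_bilinear.continuous_on[OF assms])
next
  case (Suc k)
  note fg = Ck_has_derivative[OF Suc.prems(1)] Ck_has_derivative[OF Suc.prems(2)]
  show ?case
  proof (rule Ck_SucI[OF bounded_bilinear.FDERIV[OF assms fg]], rule Ck_add)
    show "Ck k (\<lambda>x. B (f x) (frechet_derivative g (at x) v))" for v
      by (rule Suc.IH) (use Suc.prems Ck_Suc_imp in auto)
    show "Ck k (\<lambda>x. B (frechet_derivative f (at x) v) (g x))" for v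
      by (rule Suc.IH) (use Suc.prems Ck_Suc_imp in auto)
  qed
qed

lemmas Ck_mult = Ck_bilinear[OF bounded_bilinear_mult]
lemmas Ck_scaleR = Ck_bilinear[OF bounded_bilinear_scaleR]
lemmas Ck_inner = Ck_bilinear[OF bounded_bilinear_inner]

lemma Ck_minus: "Ck k f \<Longrightarrow> Ck k (\<lambda>x. - f x)"
  using Ck_scaleR[OF Ck_const[of k "-1"], of f] by simp

lemma Ck_diff: "Ck k f \<Longrightarrow> Ck k g \<Longrightarrow> Ck k (\<lambda>x. f x - g x)"
  using Ck_add[OF _ Ck_minus] by fastforce

lemma Ck_power: "Ck k f \<Longrightarrow> Ck k (\<lambda>x. f x ^ n :: real)"
  by (induction n) (auto intro: Ck_const Ck_mult)

text \<open>Closed under differentiation: \<open>e\<^sub>m' = e\<^sub>m\<^sub>+\<^sub>2 - m e\<^sub>m\<^sub>+\<^sub>1\<close>.\<close>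
definition flat_exp :: "nat \<Rightarrow> real \<Rightarrow> real" where
  "flat_exp m s = (if s > 0 then inverse s ^ m * exp (- inverse s) else 0)"

lemma flat_exp_tendsto_0: "(flat_exp m \<longlongrightarrow> 0) (at 0)"
proof -
  have "((\<lambda>x::real. x ^ m / exp x) \<longlongrightarrow> 0) at_top" by (rule tendsto_power_div_exp_0)
  then have "((\<lambda>s. inverse s ^ m / exp (inverse s)) \<longlongrightarrow> 0) (at_right (0::real))"
    by (rule filterlim_compose[OF _ filterlim_inverse_at_top_right])
  then have "(flat_exp m \<longlongrightarrow> 0) (at_right 0)"
    by (rule Lim_transform_eventually)
      (auto simp: flat_exp_def eventually_at_filter exp_minus divide_inverse)
  moreover have "(flat_exp m \<longlongrightarrow> 0) (at_left 0)"
    by (rule tendsto_eventually) (auto simp: flat_exp_def eventually_at_filter)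
  ultimately show ?thesis by (simp add: filterlim_at_split)
qed

lemma flat_exp_deriv:
  "(flat_exp m has_real_derivative flat_exp (m + 2) s - real m * flat_exp (m + 1) s) (at s)"
proof -
  consider "s > 0" | "s < 0" | "s = 0" by linarith
  then show ?thesis
  proof cases
    case 1
    have "((\<lambda>s. inverse s ^ m * exp (- inverse s)) has_real_derivative
       flat_exp (m + 2) s - real m * flat_exp (m + 1) s) (at s)"
    proof (cases m)
      case 0
      with 1 show ?thesis
        by (auto intro!: derivative_eq_intros simp: flat_exp_def power2_eq_square)
    next
      case (Suc k)
      have e: "((\<lambda>s. exp (- inverse s)) has_real_derivative exp (- inverse s) * (inverse s)\<^sup>2) (at s)"
        using 1 by (auto intro!: derivative_eq_intros simp: power2_eq_square)
      have p: "((\<lambda>s. inverse s ^ Suc k) has_real_derivative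
         (1 + real k) * (- (inverse s ^ Suc (Suc 0)) * inverse s ^ k)) (at s)"
        using DERIV_power_Suc[OF DERIV_inverse[of s UNIV], of k] 1 by simp
      show ?thesis using DERIV_mult[OF p e] 1 unfolding Suc
        by (auto simp: flat_exp_def power2_eq_square algebra_simps)
    qed
    then show ?thesis
      by (rule has_field_derivative_transform_within_open[of _ _ _ "{0<..}"])
        (use 1 in \<open>auto simp: flat_exp_def\<close>)
  next
    case 2
    have "((\<lambda>s. 0) has_real_derivative flat_exp (m + 2) s - real m * flat_exp (m + 1) s) (at s)"
      using 2 by (auto simp: flat_exp_def)
    then show ?thesis
      by (rule has_field_derivative_transform_within_open[of _ _ _ "{..<0}"])
        (use 2 in \<open>auto simp: flat_exp_def\<close>)
  next
    case 3
    \<comment> \<open>At 0 the difference quotient of \<open>flat_exp m\<close> is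
      \<open>flat_exp (m + 1)\<close> itself, and this tends to 0.\<close>
    have "((\<lambda>h. (flat_exp m (0 + h) - flat_exp m 0) / h) \<longlongrightarrow> 0) (at 0)"
      by (rule Lim_transform_eventually[OF flat_exp_tendsto_0[of "m + 1"]])
        (auto simp: flat_exp_def eventually_at_filter divide_inverse mult_ac)
    then show ?thesis using 3 by (simp add: DERIV_def flat_exp_def)
  qed
qed

lemma flat_exp_nonneg: "flat_exp m s \<ge> 0" by (simp add: flat_exp_def)
lemma flat_exp_pos: "s > 0 \<Longrightarrow> flat_exp m s > 0" by (simp add: flat_exp_def)
lemma flat_exp_eq_0: "s \<le> 0 \<Longrightarrow> flat_exp m s = 0" by (simp add: flat_exp_def)

lemma flat_exp_0_mono: "a \<le> b \<Longrightarrow> flat_exp 0 a \<le> flat_exp 0 b"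
  by (auto simp: flat_exp_def le_imp_inverse_le)

lemma has_derivative_flat_exp_compose:
  assumes "(q has_derivative q') (at x)"
  shows "((\<lambda>x. flat_exp m (q x)) has_derivative
     (\<lambda>v. (flat_exp (m + 2) (q x) - real m * flat_exp (m + 1) (q x)) * q' v)) (at x)"
  using has_derivative_compose[OF assms flat_exp_deriv[unfolded has_field_derivative_def]] .

text \<open>The induction has to run over all m at once because differentiation raises m.\<close>

lemma Ck_flat_exp: "(\<And>k. Ck k q) \<Longrightarrow> Ck k (\<lambda>x. flat_exp m (q x))"
proof (induction k arbitrary: m)
  case 0
  have "continuous_on UNIV (flat_exp m)"
    by (rule DERIV_continuous_on, rule has_field_derivative_at_within, rule flat_exp_deriv)
  moreover have "continuous_on UNIV q" using 0[of 0] by simp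
  ultimately show ?case
    using continuous_on_compose2[of UNIV "flat_exp m" UNIV q] by simp
next
  case (Suc k)
  have q: "Ck k (\<lambda>x. frechet_derivative q (at x) v)" for v using Suc.prems[of "Suc k"] by simp
  show ?case
    by (rule Ck_SucI[OF has_derivative_flat_exp_compose[OF Ck_has_derivative[OF Suc.prems]]])
      (intro Ck_mult Ck_diff Ck_const Suc q)
qed

section \<open>Directional derivatives, convolution and mollification\<close>

definition dd :: "('a::real_normed_vector \<Rightarrow> 'b::real_normed_vector) \<Rightarrow> 'a \<Rightarrow> 'a \<Rightarrow> 'b" where
  "dd f v = (\<lambda>x. frechet_derivative f (at x) v)"

lemma Ck_dd: "Ck (Suc k) f \<Longrightarrow> Ck k (dd f v)"
  by (simp add: dd_def)

lemma dd_eqI: "(f has_derivative D) (at x) \<Longrightarrow> dd f v x = D v"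
  by (metis dd_def frechet_derivative_at)

lemma Ck_dd_has_derivative: "Ck (Suc k) f \<Longrightarrow> (f has_derivative (\<lambda>v. dd f v x)) (at x)"
  unfolding dd_def by (rule Ck_has_derivative)

lemma dd_eq_0_outside:
  assumes "\<And>z. norm z > R \<Longrightarrow> f z = 0" "norm z > R"
  shows "dd f v z = 0"
proof -
  have "((\<lambda>z. 0) has_derivative (\<lambda>v. 0)) (at z)" by simp
  then have "(f has_derivative (\<lambda>v. 0)) (at z)"
    by (rule has_derivative_transform_within_open[of _ _ _ _ "{z. norm z > R}"])
      (use assms in \<open>auto intro!: open_Collect_less continuous_intros\<close>)
  then show ?thesis by (rule dd_eqI)
qed

lemma continuous_zero_outside_bounded:
  fixes g :: "'a::euclidean_space \<Rightarrow> 'b::real_normed_vector"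
  assumes "continuous_on UNIV g" "\<And>z. norm z > R \<Longrightarrow> g z = 0"
  shows "\<exists>C>0. \<forall>z. norm (g z) \<le> C"
proof -
  have "compact (g ` cball 0 R)"
    by (intro compact_continuous_image continuous_on_subset[OF assms(1)]) auto
  from compact_imp_bounded[OF this] obtain C where C: "C > 0" "\<forall>x\<in>g ` cball 0 R. norm x \<le> C" 
    unfolding bounded_pos by blast
  have "norm (g z) \<le> C" for z 
  proof (cases "norm z \<le> R")
    case True
    then have "g z \<in> g ` cball 0 R" by simp
    then show ?thesis using C by blast
  next
    case False
    then show ?thesis using assms(2)[of z] C by simp
  qed
  then show ?thesis using C by blast
qed

lemma compactly_supportedI:
  fixes f :: "'a::euclidean_space \<Rightarrow> 'b::zero"
  assumes "\<And>z. norm z > R \<Longrightarrow> f z = 0"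
  shows "compactly_supported f"
proof -
  have "{z. f z \<noteq> 0} \<subseteq> cball 0 R" using assms by (force simp: not_le)
  then have "closure {z. f z \<noteq> 0} \<subseteq> cball 0 R" by (rule closure_minimal) simp
  then show ?thesis unfolding compactly_supported_def
    using compact_Int_closed[of "cball 0 R" "closure {z. f z \<noteq> 0}"] by (simp add: Int_absorb1)
qed

lemma compactly_supportedD:
  fixes f :: "'a::real_normed_vector \<Rightarrow> 'b::zero"
  assumes "compactly_supported f"
  obtains R where "R > 0" "\<And>z. norm z > R \<Longrightarrow> f z = 0"
proof -
  have "bounded {z. f z \<noteq> 0}"
    using assms unfolding compactly_supported_def by (meson bounded_subset closure_subset compact_imp_bounded)
  then obtain R where R: "R > 0" "\<forall>z\<in>{z. f z \<noteq> 0}. norm z \<le> R" unfolding bounded_pos by blast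
  have "f z = 0" if "norm z > R" for z
    by (rule ccontr) (use R(2) that in force)
  with R(1) show ?thesis by (rule that)
qed

text \<open>B is an arbitrary bounded bilinear map so that the derivative can fall on a scalar
  kernel or on a vector-valued function, whichever is to be differentiated. The fixed box of
  integration makes Leibniz's rule applicable.\<close>

lemma has_derivative_convolution:
  fixes \<Phi> :: "'a::euclidean_space \<Rightarrow> 'c::real_normed_vector" and s :: "'a \<Rightarrow> 'd::real_normed_vector"
    and B :: "'c \<Rightarrow> 'd \<Rightarrow> 'b::banach"
  assumes B: "bounded_bilinear B" and s: "continuous_on UNIV s" and \<Phi>: "Ck (Suc k) \<Phi>"
  shows "((\<lambda>z. integral (cbox a b) (\<lambda>u. B (\<Phi> (z - u)) (s u))) has_derivative
     (\<lambda>v. integral (cbox a b) (\<lambda>u. B (dd \<Phi> v (z - u)) (s u)))) (at z)"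
proof -
  interpret B: bounded_bilinear B by fact
  note d = Ck_dd_has_derivative[OF \<Phi>]
  \<comment> \<open>The derivative as an operator-valued function of (z, u); its continuity is
    checked one direction at a time.\<close>
  define D where "D z u = Blinfun (\<lambda>v. B (dd \<Phi> v (z - u)) (s u))" for z u
  have bl: "bounded_linear (\<lambda>v. B (dd \<Phi> v (z - u)) (s u))" for z u
    using bounded_linear_compose[OF B.bounded_linear_left has_derivative_bounded_linear[OF d]] .
  have Dap: "blinfun_apply (D z u) v = B (dd \<Phi> v (z - u)) (s u)" for z u v
    unfolding D_def by (subst bounded_linear_Blinfun_apply[OF bl]) simp
  have c3: "continuous_on S (\<lambda>x. s (f x))" if "continuous_on S f" for S and f :: "'x::topological_space \<Rightarrow> 'a"
    using continuous_on_compose2[OF s that] by auto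
  have contD: "continuous_on UNIV (\<lambda>(z, u). D z u)"
  proof -
    have "continuous_on UNIV (\<lambda>x. blinfun_apply (case x of (z, u) \<Rightarrow> D z u) v)" for v
    proof -
      have c: "continuous_on UNIV (dd \<Phi> v)" using Ck_continuous[OF Ck_dd[OF \<Phi>]] .
      have c2: "continuous_on S (\<lambda>x. dd \<Phi> v (f x))" if "continuous_on S f" for S and f :: "'a \<times> 'a \<Rightarrow> 'a"
        using continuous_on_compose2[OF c that] by auto
      show ?thesis by (simp add: case_prod_beta Dap) (intro continuous_intros c2 c3 B.continuous_on)
    qed
    then show ?thesis by (intro continuous_on_blinfun_componentwise) auto
  qed
  have integrable: "(\<lambda>u. B (\<Phi> (z - u)) (s u)) integrable_on cbox a b" for z
  proof (rule integrable_continuous)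
    have c: "continuous_on UNIV \<Phi>" using Ck_continuous[OF \<Phi>] .
    show "continuous_on (cbox a b) (\<lambda>u. B (\<Phi> (z - u)) (s u))"
      by (intro continuous_intros continuous_on_compose2[OF c] continuous_on_subset[OF s] B.continuous_on) auto
  qed
  have der: "((\<lambda>z. integral (cbox a b) (\<lambda>u. B (\<Phi> (z - u)) (s u))) has_derivative
      blinfun_apply (integral (cbox a b) (D z))) (at z)"
  proof (rule leibniz_rule[where U=UNIV, simplified])
    show "((\<lambda>x. B (\<Phi> (x - t)) (s t)) has_derivative blinfun_apply (D x t)) (at x)" for x t
    proof -
      have s: "((\<lambda>x. x - t) has_derivative (\<lambda>v. v)) (at x)" by (auto intro!: derivative_eq_intros)
      have "((\<lambda>x. \<Phi> (x - t)) has_derivative (\<lambda>v. dd \<Phi> v (x - t))) (at x)"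
        by (rule has_derivative_compose[OF s d])
      from bounded_linear.has_derivative[OF B.bounded_linear_left this]
      have "((\<lambda>x. B (\<Phi> (x - t)) (s t)) has_derivative (\<lambda>v. B (dd \<Phi> v (x - t)) (s t))) (at x)" .
      moreover have "blinfun_apply (D x t) = (\<lambda>v. B (dd \<Phi> v (x - t)) (s t))" using Dap by blast
      ultimately show ?thesis by simp
    qed
    show "continuous_on (UNIV \<times> cbox a b) (\<lambda>(z, u). D z u)"
      by (rule continuous_on_subset[OF contD]) simp
  qed (use integrable in auto)
  have "blinfun_apply (integral (cbox a b) (D z)) v = integral (cbox a b) (\<lambda>u. B (dd \<Phi> v (z - u)) (s u))" for v
  proof -
    have "D z integrable_on cbox a b"
      by (rule integrable_continuous)
        (use continuous_on_compose2[OF contD continuous_on_Pair[OF continuous_on_const continuous_on_id], of z "cbox a b"] in auto)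
    then have "blinfun_apply (integral (cbox a b) (D z)) v = integral (cbox a b) (\<lambda>u. blinfun_apply (D z u) v)"
      using blinfun_apply_integral by blast
    then show ?thesis by (simp add: Dap)
  qed
  then have "blinfun_apply (integral (cbox a b) (D z)) = (\<lambda>v. integral (cbox a b) (\<lambda>u. B (dd \<Phi> v (z - u)) (s u)))"
    by blast
  with der show ?thesis by simp
qed

lemma Ck_convolution:
  fixes \<Phi> :: "'a::euclidean_space \<Rightarrow> 'c::real_normed_vector" and s :: "'a \<Rightarrow> 'd::real_normed_vector"
    and B :: "'c \<Rightarrow> 'd \<Rightarrow> 'b::banach"
  assumes B: "bounded_bilinear B" and s: "continuous_on UNIV s"
  shows "Ck k \<Phi> \<Longrightarrow> Ck k (\<lambda>z. integral (cbox a b) (\<lambda>u. B (\<Phi> (z - u)) (s u)))"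
proof (induction k arbitrary: \<Phi>)
  case 0
  interpret B: bounded_bilinear B by fact
  have c: "continuous_on UNIV \<Phi>" using 0 by simp
  have c2: "continuous_on S (\<lambda>x. \<Phi> (f x))" if "continuous_on S f" for S and f :: "'a \<times> 'a \<Rightarrow> 'a"
    using continuous_on_compose2[OF c that] by auto
  have c3: "continuous_on S (\<lambda>x. s (f x))" if "continuous_on S f" for S and f :: "'a \<times> 'a \<Rightarrow> 'a"
    using continuous_on_compose2[OF s that] by auto
  show ?case
    by (simp, rule integral_continuous_on_param, simp add: case_prod_beta)
      (intro continuous_intros c2 c3 B.continuous_on)
next
  case (Suc k)
  show ?case
    by (rule Ck_SucI[OF has_derivative_convolution[OF B s Suc.prems]]) (rule Suc.IH[OF Ck_dd[OF Suc.prems]])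
qed

text \<open>The usual bump exp(-1/(1 - |z|^2/\<delta>^2)), normalised. Its mass is positive because
  the bump is positive on an open ball, which is not negligible.\<close>

lemma mollifier_exists:
  fixes \<delta> :: real
  assumes "\<delta> > 0"
  obtains \<eta> :: "'a::euclidean_space \<Rightarrow> real" where "\<And>k. Ck k \<eta>" "\<And>z. \<eta> z \<ge> 0" 
    "\<And>z. norm z \<ge> \<delta> \<Longrightarrow> \<eta> z = 0" "\<And>z. norm z < \<delta> \<Longrightarrow> \<eta> z > 0" "\<And>z. \<eta> (- z) = \<eta> z"
    "integrable lborel \<eta>" "(LINT z|lborel. \<eta> z) = 1"
proof -
  define q where "q z = 1 - (z \<bullet> z) / \<delta>\<^sup>2" for z :: 'a
  define f where "f z = flat_exp 0 (q z)" for z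
  have Cq: "Ck k q" for k
    unfolding q_def divide_inverse
    by (intro Ck_diff Ck_const Ck_mult Ck_inner Ck_bounded_linear bounded_linear_ident)
  have Cf: "Ck k f" for k unfolding f_def by (rule Ck_flat_exp) (rule Cq)
  have q_pos: "q z > 0 \<longleftrightarrow> norm z < \<delta>" for z
    using assms by (simp add: q_def power2_norm_eq_inner[symmetric] field_simps)
      (metis abs_le_square_iff abs_norm_cancel abs_of_pos not_le)
  have f0: "f z = 0" if "norm z \<ge> \<delta>" for z
    using q_pos[of z] that unfolding f_def by (intro flat_exp_eq_0) linarith
  have fpos: "f z > 0" if "norm z < \<delta>" for z
    using q_pos[of z] that unfolding f_def by (intro flat_exp_pos) simp
  have cont: "continuous_on A f" for A using Ck_continuous[OF Cf] continuous_on_subset by blast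
  have int: "integrable lborel f"
  proof -
    have "integrable lborel (\<lambda>z. indicator (cball 0 \<delta>) z *\<^sub>R f z)"
      by (rule borel_integrable_compact[OF compact_cball cont])
    also have "(\<lambda>z. indicator (cball 0 \<delta>) z *\<^sub>R f z) = f"
      using f0 by (auto simp: indicator_def fun_eq_iff)
    finally show ?thesis .
  qed
  have nn: "f z \<ge> 0" for z by (simp add: f_def flat_exp_nonneg)
  define I where "I = (LINT z|lborel. f z)"
  have "I > 0"
  proof -
    have "I \<noteq> 0"
    proof
      assume "I = 0"
      then have "AE z in lborel. f z = 0"
        using integral_nonneg_eq_0_iff_AE[OF int] nn by (simp add: I_def)
      then have "AE z in lborel. z \<notin> ball (0::'a) \<delta>" by eventually_elim (use fpos in force)
      then have "emeasure lborel (ball (0::'a) \<delta>) = 0" 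
        by (subst (asm) AE_iff_measurable[OF _ refl]) (auto simp: ball_def)
      then have "negligible (ball (0::'a) \<delta>)"
        unfolding negligible_iff_null_sets by (intro null_sets_completionI null_setsI) auto
      then show False using assms open_not_negligible[of "ball (0::'a) \<delta>"] by simp
    qed
    moreover have "I \<ge> 0" unfolding I_def by (rule Bochner_Integration.integral_nonneg) (simp add: f_def flat_exp_nonneg)
    ultimately show ?thesis by simp
  qed
  show ?thesis
  proof (rule that[of "\<lambda>z. inverse I * f z"])
    show "Ck k (\<lambda>z. inverse I * f z)" for k by (intro Ck_mult Ck_const Cf)
    show "(LINT z|lborel. inverse I * f z) = 1" using \<open>I > 0\<close> by (simp add: I_def)
    have "f (- z) = f z" for z by (simp add: f_def q_def)
    then show "inverse I * f (- z) = inverse I * f z" for z by simp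
  qed (use \<open>I > 0\<close> f0 fpos int nn in auto)
qed

lemma lborel_reflect: "distr lborel borel (\<lambda>u. z - u :: 'a::euclidean_space) = lborel"
  using lborel_affine[of "-1" z] by (simp add: density_1)

lemma lborel_integral_reflect:
  fixes f :: "'a::euclidean_space \<Rightarrow> 'b::euclidean_space"
  assumes "f \<in> borel_measurable borel"
  shows "(LINT u|lborel. f (z - u)) = (LINT u|lborel. f u)"
proof -
  have "(LINT u|lborel. f u) = (LINT u|distr lborel borel (\<lambda>u. z - u). f u)" by (simp add: lborel_reflect)
  also have "\<dots> = (LINT u|lborel. f (z - u))"
    by (rule integral_distr) (use assms in auto)
  finally show ?thesis ..
qed

lemma lborel_integral_cbox:
  fixes f :: "'a::euclidean_space \<Rightarrow> 'b::euclidean_space"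
  assumes "continuous_on UNIV f" "\<And>u. u \<notin> cbox a b \<Longrightarrow> f u = 0"
  shows "integrable lborel f" "(LINT u|lborel. f u) = integral (cbox a b) f"
proof -
  have "set_integrable lborel (cbox a b) f"
    unfolding set_integrable_def
    by (rule borel_integrable_compact[OF compact_cbox continuous_on_subset[OF assms(1)]]) auto
  moreover have eq: "(\<lambda>u. indicator (cbox a b) u *\<^sub>R f u) = f" using assms(2) by (auto simp: indicator_def fun_eq_iff)
  ultimately show "integrable lborel f" by (simp add: set_integrable_def)
  have "(LINT u:cbox a b|lborel. f u) = integral (cbox a b) f"
    by (rule set_borel_integral_eq_integral) fact
  then show "(LINT u|lborel. f u) = integral (cbox a b) f" by (simp add: set_lebesgue_integral_def eq)
qed

text \<open>One estimate for two purposes: c = g(w) gives convergence of the mollifications at w,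
  and c = 0 a bound that does not depend on the kernel. The bound on g - c is asked for only where
  the kernel does not vanish.\<close>

lemma mollify_bounded:
  fixes g :: "'a::euclidean_space \<Rightarrow> 'b::euclidean_space"
  assumes g: "continuous_on UNIV g" and C: "\<And>z. norm (g z - c) \<le> C \<or> \<eta> (w - z) = 0"
    and \<eta>: "integrable lborel \<eta>" "(LINT z|lborel. \<eta> z) = 1" "\<And>z. \<eta> z \<ge> 0" 
    and i: "integrable lborel (\<lambda>u. \<eta> u *\<^sub>R g (w - u))"
  shows "norm ((LINT u|lborel. \<eta> u *\<^sub>R g (w - u)) - c) \<le> C"
proof -
  have i2: "integrable lborel (\<lambda>u. \<eta> u *\<^sub>R c)" using \<eta>(1) by simp
  have "(LINT u|lborel. \<eta> u *\<^sub>R g (w - u)) - c = (LINT u|lborel. \<eta> u *\<^sub>R g (w - u)) - (LINT u|lborel. \<eta> u *\<^sub>R c)"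
    using \<eta> by simp
  also have "\<dots> = (LINT u|lborel. \<eta> u *\<^sub>R g (w - u) - \<eta> u *\<^sub>R c)"
    using i i2 by simp
  also have "norm \<dots> \<le> (LINT u|lborel. norm (\<eta> u *\<^sub>R g (w - u) - \<eta> u *\<^sub>R c))"
    by (rule integral_norm_bound)
  also have "\<dots> \<le> (LINT u|lborel. \<eta> u * C)"
  proof (rule integral_mono)
    fix u show "norm (\<eta> u *\<^sub>R g (w - u) - \<eta> u *\<^sub>R c) \<le> \<eta> u * C"
      unfolding scaleR_diff_right[symmetric] using C[of "w - u"] \<eta>(3)[of u] 
      by (cases "\<eta> u = 0") (auto intro!: mult_left_mono)
  qed (use i i2 \<eta> in auto)
  also have "\<dots> = C" using \<eta> by simp
  finally show ?thesis .
qed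

text \<open>Derivatives of the convolution may be put on \<psi>, which gives bounds and pointwise
  limits up to second order, or on the kernel, which gives smoothness of every order. Second
  derivatives are recorded for equal directions only, since the weak form contains just the second
  time derivative.\<close>

lemma C2_mollification:
  fixes \<psi> :: "'a::euclidean_space \<Rightarrow> 'b::euclidean_space"
  assumes \<psi>: "Ck 2 \<psi>" and supp: "compactly_supported \<psi>"
  obtains \<Psi> R where "\<And>j k. Ck k (\<Psi> j)" "\<And>j z. norm z > R \<Longrightarrow> \<Psi> j z = 0" "\<And>z. norm z > R \<Longrightarrow> \<psi> z = 0"
    "\<And>v. \<exists>C. \<forall>j z. norm (dd (\<Psi> j) v z) \<le> C"
    "\<And>v. \<exists>C. \<forall>j z. norm (dd (dd (\<Psi> j) v) v z) \<le> C"
    "\<And>v z. (\<lambda>j. dd (\<Psi> j) v z) \<longlonglongrightarrow> dd \<psi> v z"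
    "\<And>v z. (\<lambda>j. dd (dd (\<Psi> j) v) v z) \<longlonglongrightarrow> dd (dd \<psi> v) v z"
proof -
  have S2: "Ck (Suc 1) \<psi>" using \<psi> by (simp add: numeral_2_eq_2)
  have contdd: "continuous_on UNIV \<psi>" "continuous_on UNIV (dd \<psi> v)" "continuous_on UNIV (dd (dd \<psi> v) v)" for v
    using Ck_continuous[OF \<psi>] Ck_continuous[OF Ck_dd[OF S2]]
      Ck_continuous[OF Ck_dd[OF Ck_dd[OF S2[unfolded One_nat_def]]]] by auto
  obtain R0 where "R0 > 0" and z0: "\<And>z. norm z > R0 \<Longrightarrow> \<psi> z = 0"
    using compactly_supportedD[OF supp] by blast
  have R0: "R0 \<ge> 0" using \<open>R0 > 0\<close> by simp
  have z1: "dd \<psi> v z = 0" if "norm z > R0" for v z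
    by (rule dd_eq_0_outside[of R0]) (use z0 that in auto)
  have z2: "dd (dd \<psi> v) v' z = 0" if "norm z > R0" for v v' z
    by (rule dd_eq_0_outside[of R0]) (use z1 that in auto)
  have "\<forall>j. \<exists>\<eta>::'a \<Rightarrow> real. (\<forall>k. Ck k \<eta>) \<and> (\<forall>z::'a. \<eta> z \<ge> 0) \<and> (\<forall>z. norm z \<ge> 1 / real (Suc j) \<longrightarrow> \<eta> z = 0) \<and>
     integrable lborel \<eta> \<and> (LINT z|lborel. \<eta> z) = 1"
  proof
    fix j
    obtain \<eta> :: "'a \<Rightarrow> real" where "\<And>k. Ck k \<eta>" "\<And>z. \<eta> z \<ge> 0" "\<And>z. norm z \<ge> 1 / real (Suc j) \<Longrightarrow> \<eta> z = 0" 
      "\<And>z. norm z < 1 / real (Suc j) \<Longrightarrow> \<eta> z > 0" "\<And>z. \<eta> (- z) = \<eta> z"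
    "integrable lborel \<eta>" "(LINT z|lborel. \<eta> z) = 1"
      by (rule mollifier_exists[of "1 / real (Suc j)"]) auto
    then show "\<exists>\<eta>::'a \<Rightarrow> real. (\<forall>k. Ck k \<eta>) \<and> (\<forall>z::'a. \<eta> z \<ge> 0) \<and> (\<forall>z. norm z \<ge> 1 / real (Suc j) \<longrightarrow> \<eta> z = 0) \<and>
     integrable lborel \<eta> \<and> (LINT z|lborel. \<eta> z) = 1" by (intro exI[of _ \<eta>] conjI allI impI)
  qed
  from choice[OF this] obtain \<eta> :: "nat \<Rightarrow> 'a \<Rightarrow> real" where \<eta>: "\<And>j k. Ck k (\<eta> j)" "\<And>j z::'a. \<eta> j z \<ge> 0" 
    "\<And>j z. norm z \<ge> 1 / real (Suc j) \<Longrightarrow> \<eta> j z = 0"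
    "\<And>j. integrable lborel (\<eta> j)" "\<And>j. (LINT z|lborel. \<eta> j z) = 1" by blast
  define M where "M j g z = (LINT u|lborel. \<eta> j u *\<^sub>R g (z - u))" for j z and g :: "'a \<Rightarrow> 'b"
  have \<eta>c: "continuous_on UNIV (\<eta> j)" for j by (rule Ck_continuous[OF \<eta>(1)])
  \<comment> \<open>One box for both forms of the convolution: it contains the kernels, which live
    in the unit ball, and the support of \<psi>.\<close>
  obtain p :: 'a where p: "cball 0 (R0 + 1) \<subseteq> cbox (- p) p"
    using bounded_subset_cbox_symmetric bounded_cball by metis
  have out: "\<eta> j u = 0" if "u \<notin> cbox (- p) p" for u j
  proof (rule \<eta>(3))
    have "norm u > R0 + 1" using p that by force
    moreover have "1 / real (Suc j) \<le> 1" by simp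
    ultimately show "norm u \<ge> 1 / real (Suc j)" using R0 by linarith
  qed
  have cont: "continuous_on UNIV (\<lambda>u. \<eta> j u *\<^sub>R g (z - u))" if "continuous_on UNIV g" for g :: "'a \<Rightarrow> 'b" and j z
    by (intro continuous_intros \<eta>c continuous_on_compose2[OF that]) auto
  have Mint: "integrable lborel (\<lambda>u. \<eta> j u *\<^sub>R g (z - u))" 
    and Mbox: "M j g z = integral (cbox (- p) p) (\<lambda>u. \<eta> j u *\<^sub>R g (z - u))"
    if "continuous_on UNIV g" for g j z
    using lborel_integral_cbox[OF cont[OF that, of j z], of "-p" p] out by (auto simp: M_def)
  have MD: "(M j g has_derivative (\<lambda>v. M j (dd g v) z)) (at z)" if "Ck (Suc k) g" for g j z k
  proof -
    have "((\<lambda>z. integral (cbox (- p) p) (\<lambda>u. \<eta> j u *\<^sub>R g (z - u))) has_derivative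
     (\<lambda>v. integral (cbox (- p) p) (\<lambda>u. \<eta> j u *\<^sub>R (dd g v (z - u))))) (at z)"
      using has_derivative_convolution[OF bounded_bilinear.flip[OF bounded_bilinear_scaleR] \<eta>c that] .
    moreover have "M j g = (\<lambda>z. integral (cbox (- p) p) (\<lambda>u. \<eta> j u *\<^sub>R g (z - u)))"
      using Mbox[OF Ck_continuous[OF that]] by blast
    moreover have "M j (dd g v) z = integral (cbox (- p) p) (\<lambda>u. \<eta> j u *\<^sub>R (dd g v (z - u)))" for v
      using Mbox[OF Ck_continuous[OF Ck_dd[OF that]]] .
    ultimately show ?thesis by simp
  qed
  have Mlim: "(\<lambda>j. M j g z) \<longlonglongrightarrow> g z" if g: "continuous_on UNIV g" for g z
  proof (rule metric_LIMSEQ_I)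
    fix e :: real assume "e > 0"
    have "isCont g z" using g by (simp add: continuous_on_eq_continuous_at)
    then have "\<exists>d>0. \<forall>y. dist y z < d \<longrightarrow> dist (g y) (g z) < e / 2"
      using \<open>e > 0\<close> unfolding continuous_at_eps_delta by (auto dest!: spec[of _ "e / 2"])
    then obtain d where d: "d > 0" "\<And>y. dist y z < d \<Longrightarrow> dist (g y) (g z) < e / 2" by blast
    obtain N where N: "1 / real (Suc N) < d" using d(1) by (rule nat_approx_posE)
    show "\<exists>N. \<forall>n\<ge>N. dist (M n g z) (g z) < e"
    proof (intro exI allI impI)
      fix j assume "j \<ge> N"
      then have "1 / real (Suc j) \<le> 1 / real (Suc N)" by (simp add: field_simps)
      then have jd: "1 / real (Suc j) < d" using N by linarith
      have "norm (M j g z - g z) \<le> e / 2" unfolding M_def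
      proof (rule mollify_bounded[OF g _ \<eta>(4,5,2) Mint[OF g]])
        fix y show "norm (g y - g z) \<le> e / 2 \<or> \<eta> j (z - y) = 0"
        proof (cases "dist y z < d")
          case True
          then show ?thesis using d(2) by (force simp: dist_norm)
        next
          case False
          then show ?thesis using \<eta>(3)[of j "z - y"] jd by (simp add: dist_norm norm_minus_commute)
        qed
      qed
      then show "dist (M j g z) (g z) < e" using \<open>e > 0\<close> by (simp add: dist_norm)
    qed
  qed
  have Mbd: "\<exists>C. \<forall>j z. norm (M j g z) \<le> C" if g: "continuous_on UNIV g" and g0: "\<And>z. norm z > R0 \<Longrightarrow> g z = 0" for g
  proof -
    obtain C where gC: "\<And>z. norm (g z) \<le> C"
      using continuous_zero_outside_bounded[OF g g0] by blast
    have "norm (M j g z) \<le> C" for j z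
    proof -
      have "norm ((LINT u|lborel. \<eta> j u *\<^sub>R g (z - u)) - 0) \<le> C"
        by (rule mollify_bounded[OF g _ \<eta>(4,5,2) Mint[OF g]]) (use gC in simp)
      then show ?thesis by (simp add: M_def)
    qed
    then show ?thesis by (intro exI allI)
  qed
  have Msm: "Ck k (M j \<psi>)" for k j
  proof -
    have "M j \<psi> z = integral (cbox (- p) p) (\<lambda>u. \<eta> j (z - u) *\<^sub>R \<psi> u)" for z
    proof -
      have "M j \<psi> z = (LINT u|lborel. \<eta> j (z - u) *\<^sub>R \<psi> (z - (z - u)))"
        unfolding M_def
        by (rule lborel_integral_reflect[symmetric]) (use cont[OF contdd(1)] borel_measurable_continuous_onI in blast)
      also have "\<dots> = integral (cbox (- p) p) (\<lambda>u. \<eta> j (z - u) *\<^sub>R \<psi> u)"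
        unfolding diff_diff_eq2 add_diff_cancel_left'
      proof (rule lborel_integral_cbox)
        show "continuous_on UNIV (\<lambda>u. \<eta> j (z - u) *\<^sub>R \<psi> u)"
          by (intro continuous_intros contdd continuous_on_compose2[OF \<eta>c]) auto
        fix u assume "u \<notin> cbox (- p) p"
        then have "norm u > R0 + 1" using p by force
        then show "\<eta> j (z - u) *\<^sub>R \<psi> u = 0" using z0[of u] by simp
      qed
      finally show ?thesis .
    qed
    then have "M j \<psi> = (\<lambda>z. integral (cbox (- p) p) (\<lambda>u. \<eta> j (z - u) *\<^sub>R \<psi> u))" by blast
    with Ck_convolution[OF bounded_bilinear_scaleR contdd(1) \<eta>(1), of k "-p" p j] show ?thesis by simp
  qed
  have d1: "dd (M j \<psi>) v = M j (dd \<psi> v)" for j v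
    using dd_eqI[OF MD[OF S2]] by blast
  have d2: "dd (M j (dd \<psi> v)) v = M j (dd (dd \<psi> v) v)" for j v
    using dd_eqI[OF MD[of 0 "dd \<psi> v"]] Ck_dd[OF S2] by auto
  show ?thesis
  proof (rule that[of "\<lambda>j. M j \<psi>" "R0 + 1"])
    show "M j \<psi> z = 0" if "norm z > R0 + 1" for j z
    proof -
      have "\<eta> j u *\<^sub>R \<psi> (z - u) = 0" for u
      proof (cases "norm u < 1")
        case True
        have "norm z \<le> norm (z - u) + norm u" by (metis diff_add_cancel norm_triangle_ineq)
        then show ?thesis using z0[of "z - u"] True that by simp
      next
        case False
        have "1 / real (Suc j) \<le> 1" by simp
        then have "norm u \<ge> 1 / real (Suc j)" using False by linarith
        then show ?thesis using \<eta>(3)[of j u] by simp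
      qed
      then have "(\<lambda>u. \<eta> j u *\<^sub>R \<psi> (z - u)) = (\<lambda>u. 0)" by blast
      then show ?thesis by (simp add: M_def)
    qed
    show "\<psi> z = 0" if "norm z > R0 + 1" for z using z0[of z] that by simp
    show "Ck k (M j \<psi>)" for j k by (rule Msm)
  qed (auto simp: d1 d2 intro!: Mlim Mbd contdd z1 z2)
qed

section \<open>The cavitating profile\<close>

text \<open>The profile r is continuous but has a kink at the shock; c stands for this single
  exceptional point. Splitting the interval there leaves two applications of the mean value
  theorem.\<close>

lemma increment_upper_except_point:
  fixes f :: "real \<Rightarrow> real"
  assumes ab: "a \<le> b" and cont: "continuous_on {a..b} f"
    and D: "\<And>x. a < x \<Longrightarrow> x < b \<Longrightarrow> x \<noteq> c \<Longrightarrow> (f has_real_derivative D x) (at x)"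
    and m: "\<And>x. a < x \<Longrightarrow> x < b \<Longrightarrow> x \<noteq> c \<Longrightarrow> D x \<le> M"
  shows "f b - f a \<le> M * (b - a)"
proof -
  have base: "f b' - f a' \<le> M * (b' - a')"
    if "a \<le> a'" "a' \<le> b'" "b' \<le> b" "\<not> (a' < c \<and> c < b')" for a' b'
  proof (cases "a' < b'")
    case True
    have ca: "continuous_on {a'..b'} f" by (rule continuous_on_subset[OF cont]) (use that in auto)
    have da: "(f has_real_derivative D x) (at x)" if "a' < x" "x < b'" for x
      using D[of x] that \<open>a \<le> a'\<close> \<open>b' \<le> b\<close> \<open>\<not> (a' < c \<and> c < b')\<close> by auto
    obtain l z where z: "a' < z" "z < b'" "(f has_real_derivative l) (at z)" "f b' - f a' = (b' - a') * l"
      using MVT[OF True ca] da by (meson real_differentiable_def)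
    have zc: "z \<noteq> c" "a < z" "z < b" using z that by auto
    have "l = D z" using z(3) D[OF zc(2,3,1)] DERIV_unique by blast
    then have "l * (b' - a') \<le> M * (b' - a')" using m[OF zc(2,3,1)] True by (intro mult_right_mono) auto
    then show ?thesis using z(4) by (simp add: mult.commute)
  qed (use that in auto)
  show ?thesis
  proof (cases "a < c \<and> c < b")
    case True
    then have "f c - f a \<le> M * (c - a)" "f b - f c \<le> M * (b - c)"
      using base[of a c] base[of c b] by auto
    then show ?thesis by (simp add: algebra_simps)
  next
    case False
    then show ?thesis using base[of a b] ab by auto
  qed
qed

lemma increment_lower_except_point:
  fixes f :: "real \<Rightarrow> real"
  assumes ab: "a \<le> b" and cont: "continuous_on {a..b} f"
    and D: "\<And>x. a < x \<Longrightarrow> x < b \<Longrightarrow> x \<noteq> c \<Longrightarrow> (f has_real_derivative D x) (at x)"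
    and m: "\<And>x. a < x \<Longrightarrow> x < b \<Longrightarrow> x \<noteq> c \<Longrightarrow> m \<le> D x"
  shows "m * (b - a) \<le> f b - f a"
proof -
  have "(- f b) - (- f a) \<le> (- m) * (b - a)"
    by (rule increment_upper_except_point[OF ab, of "\<lambda>x. - f x" c "\<lambda>x. - D x"])
      (use cont D m in \<open>auto intro!: continuous_intros DERIV_minus\<close>)
  then show ?thesis by simp
qed

locale cavitation =
  fixes d :: nat and h r :: "real \<Rightarrow> real" and H lam \<sigma> :: real
  assumes d3: "d \<ge> 3" and energy: "energy_function h" and H: "H > 0"
    and lam: "lam > 0"
    and profile: "cavitating_profile d h H lam \<sigma> r"
    and props: "cavitating_profile_properties d H lam \<sigma> r"
begin

lemma \<sigma>: "\<sigma> > 0" and r_pos: "s \<ge> 0 \<Longrightarrow> r s > 0" and r_cont: "continuous_on {0..} r"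
  and r_outer: "s \<ge> \<sigma> \<Longrightarrow> r s = lam * s"
  and r_diff: "s \<in> {0<..<\<sigma>} \<Longrightarrow> r field_differentiable at s"
  and dr_diff: "s \<in> {0<..<\<sigma>} \<Longrightarrow> deriv r field_differentiable at s"
  using profile unfolding cavitating_profile_def by auto

definition c0 :: real where "c0 = r 0"

lemma c0: "c0 > 0" unfolding c0_def by (rule r_pos) simp

text \<open>At the shock this is the right-hand derivative, so that the bounds below hold for every
  s > 0 without exception.\<close>

definition dr :: "real \<Rightarrow> real" where "dr s = (if s < \<sigma> then deriv r s else lam)"

lemma r_deriv: "s > 0 \<Longrightarrow> s \<noteq> \<sigma> \<Longrightarrow> (r has_real_derivative dr s) (at s)"
proof (cases "s < \<sigma>")
  case True
  assume "s > 0"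
  then show ?thesis using r_diff[of s] True by (simp add: dr_def field_differentiable_derivI)
next
  case False
  assume "s \<noteq> \<sigma>"
  have "((\<lambda>s. lam * s) has_real_derivative lam) (at s)" by (auto intro!: derivative_eq_intros)
  then have "(r has_real_derivative lam) (at s)"
    by (rule has_field_derivative_transform_within_open[of _ _ _ "{\<sigma><..}"])
      (use False \<open>s \<noteq> \<sigma>\<close> r_outer in auto)
  then show ?thesis using False by (simp add: dr_def)
qed

lemma v_bounds: "s \<in> {0<..<\<sigma>} \<Longrightarrow> H \<le> deriv r s * (r s / s) ^ (d - 1) \<and> deriv r s * (r s / s) ^ (d - 1) \<le> lam ^ d"
  using props unfolding cavitating_profile_properties_def prof_v_def by blast

lemma H_le: "H \<le> lam ^ d"
  using v_bounds[of "\<sigma> / 2"] \<sigma> by simp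

lemma dr_bounds: "s > 0 \<Longrightarrow> 0 \<le> dr s \<and> dr s \<le> lam"
proof (cases "s < \<sigma>")
  case True
  assume "s > 0"
  then have "deriv r s \<ge> 0" "s * deriv r s < s * lam"
    using props True unfolding cavitating_profile_properties_def by (auto simp: mult.commute)
  then show ?thesis using \<open>s > 0\<close> True by (simp add: dr_def)
qed (use lam in \<open>simp add: dr_def\<close>)

lemma r_lower: "s > 0 \<Longrightarrow> r s \<ge> lam * s \<and> lam * s \<ge> s * dr s"
  using props r_outer[of s] unfolding cavitating_profile_properties_def
  by (cases "s < \<sigma>") (auto simp: dr_def intro: less_imp_le mult.commute)

text \<open>The bounds H <= v <= lam^d solved for r'. From the shock on, r = lam s and v is equal to
  lam^d.\<close>

lemma dr_eq: 
  assumes "s > 0"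
  shows "H * (s / r s) ^ (d - 1) \<le> dr s \<and> dr s \<le> lam ^ d * (s / r s) ^ (d - 1)"
proof -
  have rs: "r s > 0" using r_pos assms by simp
  let ?v = "dr s * (r s / s) ^ (d - 1)"
  have e: "?v * (s / r s) ^ (d - 1) = dr s"
    using assms rs by (simp add: power_divide)
  have "H \<le> ?v \<and> ?v \<le> lam ^ d"
  proof (cases "s < \<sigma>")
    case False
    then have "?v = lam * lam ^ (d - 1)" using r_outer[of s] assms by (simp add: dr_def)
    also have "\<dots> = lam ^ d" using d3 by (simp add: power_eq_if[of lam d])
    finally show ?thesis using H_le by simp
  qed (use v_bounds[of s] assms in \<open>simp add: dr_def\<close>)
  then have "H * (s / r s) ^ (d - 1) \<le> ?v * (s / r s) ^ (d - 1) \<and> ?v * (s / r s) ^ (d - 1) \<le> lam ^ d * (s / r s) ^ (d - 1)"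
    using assms rs by (intro conjI mult_right_mono) auto
  then show ?thesis unfolding e .
qed

lemma r_cont_on: "0 \<le> a \<Longrightarrow> continuous_on {a..b} r"
  by (rule continuous_on_subset[OF r_cont]) auto

lemma lam_power: "lam * lam ^ (d - 1) = lam ^ d"
  using d3 by (simp add: power_eq_if[of lam d])

lemma r_increment:
  assumes "0 \<le> a" "a \<le> b"
  shows "0 \<le> r b - r a" "r b - r a \<le> lam * (b - a)"
proof -
  have "0 * (b - a) \<le> r b - r a"
    by (rule increment_lower_except_point[OF assms(2) r_cont_on[OF assms(1)], of \<sigma> dr])
      (use r_deriv dr_bounds assms in auto)
  then show "0 \<le> r b - r a" by simp
  show "r b - r a \<le> lam * (b - a)"
    by (rule increment_upper_except_point[OF assms(2) r_cont_on[OF assms(1)], of \<sigma> dr])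
      (use r_deriv dr_bounds assms in auto)
qed

lemma r_bounds: "s \<ge> 0 \<Longrightarrow> c0 \<le> r s \<and> r s \<le> c0 + lam * s \<and> lam * s \<le> r s"
  using r_increment[of 0 s] r_lower[of s] c0 by (cases "s = 0") (auto simp: c0_def)

lemma r_ratio_antimono:
  \<comment> \<open>The derivative of r/s has the sign of s r' - r, which is nonpositive because r
    >= lam s >= s r'.\<close>
  assumes "0 < a" "a \<le> b"
  shows "r b / b \<le> r a / a"
proof -
  have "r b / b - r a / a \<le> 0 * (b - a)"
  proof (rule increment_upper_except_point[OF assms(2), of "\<lambda>s. r s / s" \<sigma> "\<lambda>s. (dr s * s - r s) / s\<^sup>2"])
    show "continuous_on {a..b} (\<lambda>s. r s / s)"
      using assms by (intro continuous_intros r_cont_on) auto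
    fix x assume x: "a < x" "x < b" "x \<noteq> \<sigma>"
    show "((\<lambda>s. r s / s) has_real_derivative (dr x * x - r x) / x\<^sup>2) (at x)"
      using r_deriv[of x] x assms by (auto intro!: derivative_eq_intros simp: power2_eq_square)
    have "x > 0" using x assms by simp
    have "x * dr x \<le> r x" using r_lower[OF \<open>x > 0\<close>] by linarith
    then show "(dr x * x - r x) / x\<^sup>2 \<le> 0"
      by (intro divide_nonpos_nonneg) (auto simp: mult.commute)
  qed
  then show ?thesis by simp
qed

lemma inv_ratio_mono:
  assumes "0 < a" "a \<le> b"
  shows "a / r a \<le> b / r b"
  using r_ratio_antimono[OF assms] r_pos[of a] r_pos[of b] assms by (simp add: field_simps)

text \<open>\<open>dr_eq\<close> on an interval: s/r(s) increases, so its values at the end points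
  bound the slope. Increments, unlike derivatives, make sense across the shock and pass directly to
  averages.\<close>

lemma r_increment2:
  assumes "0 < a" "a \<le> b"
  shows "H * (a / r a) ^ (d - 1) * (b - a) \<le> r b - r a"
    "r b - r a \<le> lam ^ d * (b / r b) ^ (d - 1) * (b - a)"
proof -
  have a0: "0 \<le> a" using assms by simp
  show "H * (a / r a) ^ (d - 1) * (b - a) \<le> r b - r a"
  proof (rule increment_lower_except_point[OF assms(2) r_cont_on[OF a0], of \<sigma> dr])
    fix x assume x: "a < x" "x < b" "x \<noteq> \<sigma>"
    then show "(r has_real_derivative dr x) (at x)" using r_deriv assms by simp
    have "H * (a / r a) ^ (d - 1) \<le> H * (x / r x) ^ (d - 1)"
      using inv_ratio_mono[of a x] x assms H r_pos[of a] by (intro mult_left_mono power_mono) auto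
    also have "\<dots> \<le> dr x" using dr_eq[of x] x assms by simp
    finally show "H * (a / r a) ^ (d - 1) \<le> dr x" .
  qed
  show "r b - r a \<le> lam ^ d * (b / r b) ^ (d - 1) * (b - a)"
  proof (rule increment_upper_except_point[OF assms(2) r_cont_on[OF a0], of \<sigma> dr])
    fix x assume x: "a < x" "x < b" "x \<noteq> \<sigma>"
    then show "(r has_real_derivative dr x) (at x)" using r_deriv assms by simp
    have "dr x \<le> lam ^ d * (x / r x) ^ (d - 1)" using dr_eq[of x] x assms by simp
    also have "\<dots> \<le> lam ^ d * (b / r b) ^ (d - 1)"
      using inv_ratio_mono[of x b] x assms lam r_pos[of x] by (intro mult_left_mono power_mono) auto
    finally show "dr x \<le> lam ^ d * (b / r b) ^ (d - 1)" .
  qed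
qed

section \<open>The self-similar profile w(R, t)\<close>

definition w :: "real \<Rightarrow> real \<Rightarrow> real" where
  "w R t = (if t > 0 then t * r (R / t) else lam * R)"

definition dw :: "real \<Rightarrow> real \<Rightarrow> real" where
  "dw R t = (if t > 0 then dr (R / t) else lam)"

text \<open>The radius of the cavity at time \<open>t\<close>.\<close>
definition T0 :: "real \<Rightarrow> real" where "T0 t = max t 0 * c0"

lemma T0_nonneg: "T0 t \<ge> 0" using c0 by (simp add: T0_def)

lemma w_bounds:
  assumes "R \<ge> 0"
  shows "T0 t \<le> w R t" "w R t \<le> T0 t + lam * R" "lam * R \<le> w R t"
proof -
  have *: "t * c0 \<le> t * r (R / t)" "t * r (R / t) \<le> t * (c0 + lam * (R / t))" "t * (lam * (R / t)) \<le> t * r (R / t)"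
    if "t > 0" by (rule mult_left_mono; use r_bounds[of "R / t"] assms that in simp)+
  then show "T0 t \<le> w R t" "w R t \<le> T0 t + lam * R" "lam * R \<le> w R t"
    using assms lam by (auto simp: w_def T0_def algebra_simps max_def)
qed

lemma w_pos: "R > 0 \<Longrightarrow> w R t > 0"
  using w_bounds(3)[of R t] lam by (smt (verit) mult_pos_pos)

lemma w_increment:
  assumes "0 \<le> a" "a \<le> b"
  shows "0 \<le> w b t - w a t" "w b t - w a t \<le> lam * (b - a)"
proof -
  have t: "0 \<le> t * (r (b / t) - r (a / t))" "t * (r (b / t) - r (a / t)) \<le> t * (lam * (b / t - a / t))" if "t > 0"
    using r_increment[of "a / t" "b / t"] divide_right_mono[OF assms(2), of t] assms that
    by (auto intro!: mult_left_mono mult_nonneg_nonneg)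
  then show "0 \<le> w b t - w a t" "w b t - w a t \<le> lam * (b - a)"
    using assms lam by (auto simp: w_def algebra_simps)
qed

lemma w_ratio_antimono:
  assumes "0 < a" "a \<le> b"
  shows "w b t / b \<le> w a t / a"
proof (cases "t > 0")
  case True
  then show ?thesis
    using r_ratio_antimono[of "a / t" "b / t"] assms by (simp add: w_def divide_right_mono mult.commute)
qed (use assms in \<open>simp add: w_def\<close>)

text \<open>For t > 0 this is \<open>r_increment2\<close> rescaled. For t <= 0 the map is linear
  with w/R = lam; the lower bound then reduces to H <= lam^d and the upper one to an
  identity.\<close>

lemma w_increment2:
  assumes "0 < a" "a \<le> b"
  shows "H * (a / w a t) ^ (d - 1) * (b - a) \<le> w b t - w a t"
    "w b t - w a t \<le> lam ^ d * (b / w b t) ^ (d - 1) * (b - a)"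
proof -
  note e = lam_power
  have l: "lam ^ d * (1 / lam) ^ (d - 1) = lam" 
    using lam by (simp add: e[symmetric] power_divide)
  have l2: "H * (1 / lam) ^ (d - 1) \<le> lam"
    using mult_right_mono[OF H_le, of "(1 / lam) ^ (d - 1)"] lam unfolding l by simp
  show "H * (a / w a t) ^ (d - 1) * (b - a) \<le> w b t - w a t"
  proof (cases "t > 0")
    case True
    have "t * (H * (a / t / r (a / t)) ^ (d - 1) * (b / t - a / t)) \<le> t * (r (b / t) - r (a / t))"
      using r_increment2(1)[of "a / t" "b / t"] divide_right_mono[OF assms(2), of t] assms True
      by (intro mult_left_mono) auto
    also have "a / t / r (a / t) = a / w a t" using True by (simp add: w_def)
    also have "t * (H * (a / w a t) ^ (d - 1) * (b / t - a / t)) = H * (a / w a t) ^ (d - 1) * (b - a)"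
      using True by (simp add: diff_divide_distrib[symmetric])
    finally show ?thesis using True by (simp add: w_def algebra_simps)
  next
    case False
    have "H * (1 / lam) ^ (d - 1) * (b - a) \<le> lam * (b - a)" using l2 assms by (intro mult_right_mono) auto
    then show ?thesis using False assms by (simp add: w_def algebra_simps)
  qed
  show "w b t - w a t \<le> lam ^ d * (b / w b t) ^ (d - 1) * (b - a)"
  proof (cases "t > 0")
    case True
    have "t * (r (b / t) - r (a / t)) \<le> t * (lam ^ d * (b / t / r (b / t)) ^ (d - 1) * (b / t - a / t))"
      using r_increment2(2)[of "a / t" "b / t"] divide_right_mono[OF assms(2), of t] assms True
      by (intro mult_left_mono) auto
    also have "b / t / r (b / t) = b / w b t" using True by (simp add: w_def)
    also have "t * (lam ^ d * (b / w b t) ^ (d - 1) * (b / t - a / t)) = lam ^ d * (b / w b t) ^ (d - 1) * (b - a)"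
      using True by (simp add: diff_divide_distrib[symmetric])
    finally show ?thesis using True by (simp add: w_def algebra_simps)
  next
    case False
    then show ?thesis using l assms by (simp add: w_def right_diff_distrib)
  qed
qed

lemma w_scale: "n > 0 \<Longrightarrow> w (n * R) (n * t) = n * w R t"
  by (simp add: w_def zero_less_mult_iff)

lemma w_deriv:
  assumes "R > 0" "R \<noteq> \<sigma> * t"
  shows "((\<lambda>R. w R t) has_real_derivative dw R t) (at R)"
proof (cases "t > 0")
  case True
  have "R / t \<noteq> \<sigma>" using assms True by auto
  then have A: "(r has_real_derivative dr (R / t)) (at (R / t))" using r_deriv assms True by simp
  have B: "((\<lambda>R. R / t) has_real_derivative 1 / t) (at R)"
    using True by (auto intro!: derivative_eq_intros)
  have "((\<lambda>R. r (R / t)) has_real_derivative dr (R / t) * (1 / t)) (at R)"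
    by (rule DERIV_chain2[where g="\<lambda>R. R / t" and x=R, OF A B])
  then have "((\<lambda>R. t * r (R / t)) has_real_derivative t * (dr (R / t) * (1 / t))) (at R)"
    by (rule DERIV_cmult)
  then show ?thesis using True by (simp add: w_def dw_def)
next
  case False
  then show ?thesis by (auto simp: w_def dw_def intro!: derivative_eq_intros)
qed

lemma dw_bounds: "R > 0 \<Longrightarrow> 0 \<le> dw R t \<and> dw R t \<le> lam"
  using dr_bounds[of "R / t"] lam by (simp add: dw_def)

lemma isCont_dr:
  assumes "s > 0" "s \<noteq> \<sigma>" shows "isCont dr s"
proof (cases "s < \<sigma>")
  case True
  have "isCont (deriv r) s" using dr_diff[of s] True assms by (auto intro: field_differentiable_imp_continuous_at)
  moreover have "\<forall>\<^sub>F x in nhds s. dr x = deriv r x"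
    using eventually_nhds_in_open[of "{..<\<sigma>}" s] True by (auto simp: dr_def elim: eventually_mono)
  ultimately show ?thesis by (simp add: isCont_cong)
next
  case False
  have "isCont (\<lambda>s. lam) s" by simp
  moreover have "\<forall>\<^sub>F x in nhds s. dr x = lam"
    using eventually_nhds_in_open[of "{\<sigma><..}" s] False assms by (auto simp: dr_def elim: eventually_mono)
  ultimately show ?thesis by (simp add: isCont_cong)
qed

lemma isCont_dw:
  assumes "R > 0" "R \<noteq> \<sigma> * t"
  shows "isCont (\<lambda>R. dw R t) R"
proof (cases "t > 0")
  case True
  have "R / t \<noteq> \<sigma>" "R / t > 0" using assms True by auto
  then have "isCont (\<lambda>R. dr (R / t)) R"
    using True by (intro isCont_o2[where f="\<lambda>R. R / t" and g=dr] isCont_dr continuous_intros) auto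
  then show ?thesis using True by (simp add: dw_def)
qed (simp add: dw_def)

text \<open>The form in which differentiability of w survives averaging: both end points of the
  increment may vary near R.\<close>

lemma w_increment_local:
  assumes "R > 0" "R \<noteq> \<sigma> * t" "e > 0"
  obtains \<delta> where "\<delta> > 0" "\<delta> < R"
    "\<And>a b. R - \<delta> < a \<Longrightarrow> a \<le> b \<Longrightarrow> b < R + \<delta> \<Longrightarrow>
      (dw R t - e) * (b - a) \<le> w b t - w a t \<and> w b t - w a t \<le> (dw R t + e) * (b - a)"
proof -
  obtain \<delta>1 where d1: "\<delta>1 > 0" "\<And>x. \<bar>x - R\<bar> < \<delta>1 \<Longrightarrow> \<bar>dw x t - dw R t\<bar> < e"
    using isCont_dw[OF assms(1,2)] \<open>e > 0\<close> by (auto simp: continuous_at_eps_delta dist_real_def)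
  \<comment> \<open>The interval stays in the range of continuity, away from R = 0 and away from the
    shock.\<close>
  define \<delta> where "\<delta> = min \<delta>1 (min (R / 2) \<bar>R - \<sigma> * t\<bar>)"
  have \<delta>: "\<delta> > 0" "\<delta> \<le> \<delta>1" "\<delta> < R" "\<delta> \<le> \<bar>R - \<sigma> * t\<bar>" using d1 assms by (auto simp: \<delta>_def)
  show ?thesis
  proof (rule that[OF \<delta>(1,3)])
    fix a b assume ab: "R - \<delta> < a" "a \<le> b" "b < R + \<delta>"
    have x: "x > 0 \<and> x \<noteq> \<sigma> * t \<and> \<bar>x - R\<bar> < \<delta>1" if "a \<le> x" "x \<le> b" for x
      using that ab \<delta> by (auto simp: abs_if split: if_splits)
    have c: "continuous_on {a..b} (\<lambda>R. w R t)"
      by (intro continuous_at_imp_continuous_on ballI DERIV_isCont[OF w_deriv]) (use x in auto)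
    show "(dw R t - e) * (b - a) \<le> w b t - w a t \<and> w b t - w a t \<le> (dw R t + e) * (b - a)"
    proof
      show "(dw R t - e) * (b - a) \<le> w b t - w a t"
      \<comment> \<open>The exceptional point is placed at 0, to the left of the interval.\<close>
      proof (rule increment_lower_except_point[OF ab(2) c, of 0 "\<lambda>x. dw x t"])
        fix y assume y: "a < y" "y < b"
        show "((\<lambda>R. w R t) has_real_derivative dw y t) (at y)" using w_deriv[of y t] x[of y] y by simp
        show "dw R t - e \<le> dw y t" using d1(2)[of y] x[of y] y by linarith
      qed
      show "w b t - w a t \<le> (dw R t + e) * (b - a)"
      proof (rule increment_upper_except_point[OF ab(2) c, of 0 "\<lambda>x. dw x t"])
        fix y assume y: "a < y" "y < b"
        show "((\<lambda>R. w R t) has_real_derivative dw y t) (at y)" using w_deriv[of y t] x[of y] y by simp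
        show "dw y t \<le> dw R t + e" using d1(2)[of y] x[of y] y by linarith
      qed
    qed
  qed
qed

lemma w_cont: "continuous_on {0..} (\<lambda>R. w R t)"
proof -
  have "continuous_on {0..} (\<lambda>R. t * r (R / t))" if "t > 0"
    by (intro continuous_intros continuous_on_compose2[OF r_cont]) (use that in auto)
  then show ?thesis by (cases "t > 0") (auto simp: w_def intro!: continuous_intros)
qed

text \<open>The modulus confines r to the half line on which it is continuous.\<close>

lemma w_abs_borel: "(\<lambda>p. w \<bar>fst p\<bar> (snd p)) \<in> borel_measurable (borel \<Otimes>\<^sub>M borel)"
proof -
  have "continuous_on UNIV (\<lambda>s. r \<bar>s\<bar>)"
    by (rule continuous_on_compose2[OF r_cont]) (auto intro: continuous_intros)
  then have [measurable]: "(\<lambda>s. r \<bar>s\<bar>) \<in> borel_measurable borel" by (rule borel_measurable_continuous_onI)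
  have "w \<bar>x\<bar> t = (if t > 0 then t * r \<bar>x / t\<bar> else lam * \<bar>x\<bar>)" for x t by (simp add: w_def)
  then show ?thesis by simp
qed

end

section \<open>The averaged profile\<close>

locale averaging = cavitation +
  fixes \<phi> :: "real \<Rightarrow> real"
  assumes \<phi>: "admissible_mollifier \<phi>"
begin

lemma \<phi>_Ck: "Ck k \<phi>" and \<phi>_nonneg: "\<phi> x \<ge> 0" and \<phi>_even: "\<phi> (- x) = \<phi> x" and \<phi>_0: "\<phi> 0 > 0"
  using \<phi> unfolding admissible_mollifier_def by auto

lemma \<phi>_zero: "\<bar>x\<bar> > 1 \<Longrightarrow> \<phi> x = 0"
proof (rule ccontr)
  assume "\<bar>x\<bar> > 1" "\<phi> x \<noteq> 0"
  have "closure {x. \<phi> x \<noteq> 0} \<subseteq> {-1..1}" using \<phi> by (simp add: admissible_mollifier_def)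
  moreover have "x \<in> closure {x. \<phi> x \<noteq> 0}"
    by (rule subsetD[OF closure_subset]) (use \<open>\<phi> x \<noteq> 0\<close> in simp)
  ultimately have "x \<in> {-1..1}" by (rule subsetD)
  with \<open>\<bar>x\<bar> > 1\<close> show False by auto
qed

lemma \<phi>_cont: "continuous_on A \<phi>"
  by (rule continuous_on_subset[OF Ck_continuous[OF \<phi>_Ck[of 0]]]) simp

lemma \<phi>_borel [measurable]: "\<phi> \<in> borel_measurable borel"
  by (rule borel_measurable_continuous_onI[OF \<phi>_cont])

definition \<phi>' :: "real \<Rightarrow> real" where "\<phi>' = dd \<phi> 1"

lemma \<phi>_deriv: "(\<phi> has_real_derivative \<phi>' x) (at x)"
proof -
  have d: "(\<phi> has_derivative (\<lambda>v. dd \<phi> v x)) (at x)" by (rule Ck_dd_has_derivative[OF \<phi>_Ck[of "Suc 0"]])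
  have "dd \<phi> v x = dd \<phi> 1 x * v" for v
  proof -
    have "dd \<phi> (v *\<^sub>R 1) x = v *\<^sub>R dd \<phi> 1 x"
      using linear_scale[OF has_derivative_linear[OF d]] .
    then show ?thesis by (simp only: real_scaleR_def mult_1_right mult.commute[of v])
  qed
  then have "(\<lambda>v. dd \<phi> v x) = (*) (\<phi>' x)" unfolding \<phi>'_def by blast
  then show ?thesis using d by (simp only: has_field_derivative_def)
qed

lemma \<phi>'_cont: "continuous_on A \<phi>'"
  unfolding \<phi>'_def by (rule continuous_on_subset[OF Ck_continuous[OF Ck_dd[OF \<phi>_Ck[of "Suc 0"]]]]) simp

lemma \<phi>'_bounded: obtains C where "C > 0" "\<And>x. \<bar>\<phi>' x\<bar> \<le> C"
proof -
  have "\<phi>' x = 0" if "norm x > 1" for x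
    unfolding \<phi>'_def by (rule dd_eq_0_outside[of 1]) (use \<phi>_zero that in auto)
  from continuous_zero_outside_bounded[OF \<phi>'_cont this] obtain C where "C > 0" "\<forall>x. norm (\<phi>' x) \<le> C"
    by blast
  with that show ?thesis by auto
qed

lemma \<phi>_integrable: "integrable lborel \<phi>" and \<phi>_integral: "(LINT x|lborel. \<phi> x) = 1"
proof -
  show "integrable lborel \<phi>"
    by (rule lborel_integral_cbox(1)[OF \<phi>_cont, of "-1" 1]) (use \<phi>_zero in auto)
  have "(LINT x|lebesgue. \<phi> x) = 1" using \<phi> by (simp add: admissible_mollifier_def)
  then show "(LINT x|lborel. \<phi> x) = 1" by (simp add: integral_completion)
qed

text \<open>The quantitative form of \<phi>(0) > 0: this core of the mollifier is what feels the
  jump at the origin.\<close>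

lemma \<phi>_core: obtains c \<delta> where "c > 0" "0 < \<delta>" "\<delta> \<le> 1" "\<And>z. \<bar>z\<bar> \<le> \<delta> \<Longrightarrow> c \<le> \<phi> z"
proof -
  have "isCont \<phi> 0" using \<phi>_cont[of UNIV] by (simp add: continuous_on_eq_continuous_at)
  have "\<exists>d>0. \<forall>y. dist y 0 < d \<longrightarrow> dist (\<phi> y) (\<phi> 0) < \<phi> 0 / 2"
    using \<phi>_0 spec[OF \<open>isCont \<phi> 0\<close>[unfolded continuous_at_eps_delta], of "\<phi> 0 / 2"] by simp
  then obtain e where e: "e > 0" "\<And>y. \<bar>y\<bar> < e \<Longrightarrow> \<bar>\<phi> y - \<phi> 0\<bar> < \<phi> 0 / 2"
    by (auto simp: dist_real_def)
  show ?thesis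
  proof (rule that[of "\<phi> 0 / 2" "min (e / 2) 1"])
    fix z assume "\<bar>z\<bar> \<le> min (e / 2) 1"
    then have "\<bar>z\<bar> < e" using e(1) by auto
    from e(2)[OF this] show "\<phi> 0 / 2 \<le> \<phi> z" by linarith
  qed (use \<phi>_0 e in auto)
qed

text \<open>The odd extension of \<open>w\<close>, which jumps by \<open>2 T0 t\<close> at the origin; averaging is its convolution
  with the mollifier.\<close>
definition G :: "real \<Rightarrow> real \<Rightarrow> real" where "G z t = sgn z * w \<bar>z\<bar> t"

lemma G_pos: "z > 0 \<Longrightarrow> G z t = w z t" and G_odd: "G (- z) t = - G z t" and G_0: "G 0 t = 0"
  by (auto simp: G_def)

lemma G_ge: "z > 0 \<Longrightarrow> G z t \<ge> T0 t" using w_bounds[of z t] by (simp add: G_pos)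

lemma G_abs: "\<bar>G z t\<bar> \<le> T0 t + lam * \<bar>z\<bar>"
  using w_bounds[of "\<bar>z\<bar>" t] T0_nonneg[of t] by (auto simp: G_def abs_mult sgn_if)

text \<open>G is increasing on the half line, nonnegative there and odd, so monotonicity also holds
  through the jump at the origin.\<close>

lemma G_mono: "a \<le> b \<Longrightarrow> G a t \<le> G b t"
proof -
  assume ab: "a \<le> b"
  have pos: "0 \<le> G x t" if "x \<ge> 0" for x using that G_ge[of x t] T0_nonneg[of t] by (cases "x = 0") (auto simp: G_0)
  have inc: "G x t \<le> G y t" if "0 \<le> x" "x \<le> y" for x y
    using w_increment(1)[of x y t] pos[of y] that by (cases "x = 0") (auto simp: G_0 G_pos)
  consider "0 \<le> a" | "a \<le> 0" "0 \<le> b" | "b \<le> 0" by linarith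
  then show ?thesis
  proof cases
    case 2
    then have "0 \<le> G (- a) t" "0 \<le> G b t" using pos by auto
    then show ?thesis by (simp add: G_odd)
  next
    case 3
    then have "G (- b) t \<le> G (- a) t" using inc[of "-b" "-a"] ab by simp
    then show ?thesis by (simp add: G_odd)
  qed (use inc ab in auto)
qed

lemma G_borel_prod [measurable]: "(\<lambda>p. G (fst p) (snd p)) \<in> borel_measurable (borel \<Otimes>\<^sub>M borel)"
  unfolding G_def using w_abs_borel by measurable

lemma G_borel [measurable]: "(\<lambda>z. G z t) \<in> borel_measurable borel"
  using measurable_compose[OF _ G_borel_prod, of "\<lambda>z. (z, t)" borel] by simp

text \<open>The averaged profile for n = 1; \<open>averaged_eq\<close> obtains every other n by
  scaling.\<close>

definition M :: "real \<Rightarrow> real \<Rightarrow> real" where "M R t = (LINT z|lborel. \<phi> z * G (R - z) t)"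

lemma M_integrable: "integrable lborel (\<lambda>z. \<phi> z * G (R - z) t)"
proof (rule Bochner_Integration.integrable_bound)
  show "integrable lborel (\<lambda>z. \<phi> z * (T0 t + lam * (\<bar>R\<bar> + 1)))" using \<phi>_integrable by simp
  have "norm (\<phi> z * G (R - z) t) \<le> norm (\<phi> z * (T0 t + lam * (\<bar>R\<bar> + 1)))" for z
  proof (cases "\<bar>z\<bar> \<le> 1")
    case True
    have "\<bar>G (R - z) t\<bar> \<le> T0 t + lam * \<bar>R - z\<bar>" by (rule G_abs)
    also have "\<dots> \<le> T0 t + lam * (\<bar>R\<bar> + 1)" using True lam by (intro add_left_mono mult_left_mono) auto
    finally have "\<bar>G (R - z) t\<bar> \<le> \<bar>T0 t + lam * (\<bar>R\<bar> + 1)\<bar>" by linarith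
    then show ?thesis unfolding norm_mult by (intro mult_left_mono) auto
  qed (use \<phi>_zero in auto)
  then show "AE z in lborel. norm (\<phi> z * G (R - z) t) \<le> norm (\<phi> z * (T0 t + lam * (\<bar>R\<bar> + 1)))" by simp
qed measurable

lemma M_ge:
  assumes "\<And>z. \<bar>z\<bar> \<le> 1 \<Longrightarrow> m \<le> G (R - z) t"
  shows "m \<le> M R t"
proof -
  have "m = (LINT z|lborel. \<phi> z * m)" using \<phi>_integral by simp
  also have "\<dots> \<le> M R t" unfolding M_def
  proof (rule integral_mono)
    show "\<phi> z * m \<le> \<phi> z * G (R - z) t" for z
      using assms[of z] \<phi>_nonneg[of z] \<phi>_zero[of z] by (cases "\<bar>z\<bar> \<le> 1") (auto intro: mult_left_mono)
  qed (use M_integrable \<phi>_integrable in auto)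
  finally show ?thesis .
qed

lemma M_le:
  assumes "\<And>z. \<bar>z\<bar> \<le> 1 \<Longrightarrow> G (R - z) t \<le> m"
  shows "M R t \<le> m"
proof -
  have "M R t \<le> (LINT z|lborel. \<phi> z * m)" unfolding M_def
  proof (rule integral_mono)
    show "\<phi> z * G (R - z) t \<le> \<phi> z * m" for z
      using assms[of z] \<phi>_nonneg[of z] \<phi>_zero[of z] by (cases "\<bar>z\<bar> \<le> 1") (auto intro: mult_left_mono)
  qed (use M_integrable \<phi>_integrable in auto)
  also have "\<dots> = m" using \<phi>_integral by simp
  finally show ?thesis .
qed

lemma M_diff: "M (R + k) t - M R t = (LINT z|lborel. \<phi> z * (G (R + k - z) t - G (R - z) t))"
  unfolding M_def right_diff_distrib
  by (rule Bochner_Integration.integral_diff[symmetric]) (rule M_integrable)+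

lemma M_diff_integrable: "integrable lborel (\<lambda>z. \<phi> z * (G (R + k - z) t - G (R - z) t))"
  unfolding right_diff_distrib by (intro Bochner_Integration.integrable_diff M_integrable)

lemma M_diff_ge:
  assumes "\<And>z. \<bar>z\<bar> \<le> 1 \<Longrightarrow> m \<le> G (R + k - z) t - G (R - z) t"
  shows "m \<le> M (R + k) t - M R t"
proof -
  have "m = (LINT z|lborel. \<phi> z * m)" using \<phi>_integral by simp
  also have "\<dots> \<le> M (R + k) t - M R t" unfolding M_diff
  proof (rule integral_mono)
    show "\<phi> z * m \<le> \<phi> z * (G (R + k - z) t - G (R - z) t)" for z
      using assms[of z] \<phi>_nonneg[of z] \<phi>_zero[of z] by (cases "\<bar>z\<bar> \<le> 1") (auto intro: mult_left_mono)
  qed (use M_diff_integrable \<phi>_integrable in auto)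
  finally show ?thesis .
qed

lemma M_diff_le:
  assumes "\<And>z. \<bar>z\<bar> \<le> 1 \<Longrightarrow> G (R + k - z) t - G (R - z) t \<le> m"
  shows "M (R + k) t - M R t \<le> m"
proof -
  have "M (R + k) t - M R t \<le> (LINT z|lborel. \<phi> z * m)" unfolding M_diff
  proof (rule integral_mono)
    show "\<phi> z * (G (R + k - z) t - G (R - z) t) \<le> \<phi> z * m" for z
      using assms[of z] \<phi>_nonneg[of z] \<phi>_zero[of z] by (cases "\<bar>z\<bar> \<le> 1") (auto intro: mult_left_mono)
  qed (use M_diff_integrable \<phi>_integrable in auto)
  also have "\<dots> = m" using \<phi>_integral by simp
  finally show ?thesis .
qed

text \<open>G is increasing, so discarding all z outside [p, q] only lowers the integral. The
  interval may depend on k; to see the jump it is taken of length k.\<close>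

lemma M_diff_ge_partial:
  assumes "k \<ge> 0" "p \<le> q" "m \<ge> 0" "c \<ge> 0"
    and c: "\<And>z. p \<le> z \<Longrightarrow> z \<le> q \<Longrightarrow> c \<le> \<phi> z"
    and m: "\<And>z. p \<le> z \<Longrightarrow> z \<le> q \<Longrightarrow> m \<le> G (R + k - z) t - G (R - z) t"
  shows "c * m * (q - p) \<le> M (R + k) t - M R t"
proof -
  have "c * m * (q - p) = (LINT z|lborel. indicator {p..q} z * (c * m))" using assms by simp
  also have "\<dots> \<le> M (R + k) t - M R t" unfolding M_diff
  proof (rule integral_mono)
    show "indicator {p..q} z * (c * m) \<le> \<phi> z * (G (R + k - z) t - G (R - z) t)" for z
    proof (cases "z \<in> {p..q}")
      case True
      then have "c * m \<le> \<phi> z * (G (R + k - z) t - G (R - z) t)"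
        using c[of z] m[of z] \<phi>_nonneg assms by (intro mult_mono) auto
      then show ?thesis using True by simp
    next
      case False
      have "0 \<le> \<phi> z * (G (R + k - z) t - G (R - z) t)"
        using \<phi>_nonneg[of z] G_mono[of "R - z" "R + k - z" t] \<open>k \<ge> 0\<close> by auto
      then show ?thesis using False by simp
    qed
    show "integrable lborel (\<lambda>z. indicator {p..q} z * (c * m))" using assms by simp
  qed (rule M_diff_integrable)
  finally show ?thesis .
qed

definition ker :: "real \<Rightarrow> real \<Rightarrow> real \<Rightarrow> real" where
  "ker R t u = (if u > 0 then (\<phi> (R - u) - \<phi> (R + u)) * w u t else 0)"

text \<open>The part of the convolution over u < 0 is reflected, and oddness of G turns it into the
  term with - \<phi>(R + u).\<close>

lemma M_eq_ker: "M R t = (LINT u|lborel. ker R t u)"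
proof -
  have b: "(\<lambda>z. \<phi> z * G (R - z) t) \<in> borel_measurable borel" by measurable
  have "M R t = (LINT u|lborel. \<phi> (R - u) * G (R - (R - u)) t)"
    unfolding M_def by (rule lborel_integral_reflect[OF b, symmetric])
  then have M: "M R t = (LINT u|lborel. \<phi> (R - u) * G u t)" by simp
  have i: "integrable lborel (\<lambda>u. \<phi> (R - u) * G u t)"
  proof -
    have "integrable (distr lborel borel (\<lambda>u. R - u)) (\<lambda>z. \<phi> z * G (R - z) t)"
      using M_integrable by (simp add: lborel_reflect)
    then have "integrable lborel (\<lambda>u. \<phi> (R - u) * G (R - (R - u)) t)"
      by (subst (asm) integrable_distr_eq) auto
    then show ?thesis by simp
  qed
  let ?p = "\<lambda>u. indicator {0<..} u * (\<phi> (R - u) * G u t)" and ?n = "\<lambda>u. indicator {..<0} u * (\<phi> (R - u) * G u t)"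
  have ip: "integrable lborel ?p" "integrable lborel ?n"
    using integrable_mult_indicator[OF _ i, of "{0<..}"] integrable_mult_indicator[OF _ i, of "{..<0}"] by auto
  have "(\<lambda>u. \<phi> (R - u) * G u t) = (\<lambda>u. ?p u + ?n u)"
    by (auto simp: indicator_def fun_eq_iff G_0)
  then have "M R t = (LINT u|lborel. ?p u) + (LINT u|lborel. ?n u)"
    unfolding M using ip by simp
  also have "(LINT u|lborel. ?n u) = (LINT u|lborel. ?n (0 - u))"
    by (rule lborel_integral_reflect[symmetric]) measurable
  also have "(LINT u|lborel. ?p u) + \<dots> = (LINT u|lborel. ?p u + ?n (0 - u))"
  proof (rule Bochner_Integration.integral_add[symmetric])
    have "integrable (distr lborel borel (\<lambda>u. 0 - u)) ?n"
      using ip by (simp only: lborel_reflect)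
    then show "integrable lborel (\<lambda>u. ?n (0 - u))"
      by (subst (asm) integrable_distr_eq) auto
  qed (rule ip)
  also have "(\<lambda>u. ?p u + ?n (0 - u)) = ker R t"
    by (auto simp: ker_def fun_eq_iff indicator_def G_odd G_pos algebra_simps)
  finally show ?thesis .
qed

lemma M_0: "M 0 t = 0"
proof -
  have "ker 0 t = (\<lambda>u. 0)" by (auto simp: ker_def fun_eq_iff \<phi>_even)
  then show ?thesis by (simp add: M_eq_ker)
qed

lemma w_borel: "(\<lambda>u. w \<bar>u\<bar> t) \<in> borel_measurable borel"
  using measurable_compose[OF _ w_abs_borel, of "\<lambda>z. (z, t)" borel] by simp

lemma ker_borel [measurable]: "ker R t \<in> borel_measurable borel"
proof -
  note [measurable] = w_borel[of t]
  have "ker R t = (\<lambda>u. if u > 0 then (\<phi> (R - u) - \<phi> (R + u)) * w \<bar>u\<bar> t else 0)"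
    by (auto simp: ker_def fun_eq_iff)
  then show ?thesis by simp
qed

text \<open>At the left end point of the range of integration the kernel vanishes, so the value of the
  profile there does not matter.\<close>
lemma averaged_eq:
  assumes w': "\<And>R'. R' > 0 \<Longrightarrow> w' R' t = w R' t" and n: "n \<ge> 1"
  shows "averaged \<phi> n w' R t = M (real n * R) (real n * t) / real n"
proof -
  have n0: "real n > 0" using n by simp
  have "indicat_real {0..} x *\<^sub>R ((scaled \<phi> n (R - x) - scaled \<phi> n (R + x)) * w' x t) =
       ker (real n * R) (real n * t) (real n * x)" for x
  proof (cases "x > 0")
    case True
    then show ?thesis using n0 w'[of x] w_scale[OF n0, of x t]
      by (simp add: ker_def scaled_def algebra_simps)
  next
    case False
    then show ?thesis using n0 by (cases "x = 0") (auto simp: ker_def scaled_def zero_less_mult_iff)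
  qed
  then have "averaged \<phi> n w' R t = (LINT x|lebesgue. ker (real n * R) (real n * t) (real n * x))"
    unfolding averaged_def set_lebesgue_integral_def by presburger
  also have "\<dots> = (LINT x|lborel. ker (real n * R) (real n * t) (real n * x))"
    by (rule integral_completion) measurable
  also have "\<dots> = (LINT x|lborel. ker (real n * R) (real n * t) x) / real n"
    using lborel_integral_real_affine[of "real n" "ker (real n * R) (real n * t)" 0] n0 by simp
  finally show ?thesis by (simp add: M_eq_ker)
qed

text \<open>The radial stretch of the averaged map for n = 1; the tangential stretch is
  \<open>B\<close>.\<close>

definition A :: "real \<Rightarrow> real \<Rightarrow> real" where "A R t = deriv (\<lambda>R. M R t) R"

text \<open>The derivative is put on \<phi>, since w has a kink at the shock. For |R| < K the kernel
  vanishes for u > K + 1, so one box of integration serves a whole neighbourhood of R.\<close>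

lemma M_deriv_explicit:
  assumes K: "\<bar>R\<bar> < K"
  shows "((\<lambda>R. M R t) has_real_derivative
     integral (cbox 0 (K + 1)) (\<lambda>u. (\<phi>' (R - u) - \<phi>' (R + u)) * w u t)) (at R)"
proof -
  have wc: "continuous_on (cbox 0 (K + 1)) (\<lambda>u. w u t)"
    by (rule continuous_on_subset[OF w_cont]) (auto simp: cbox_interval)
  have eq: "M x t = integral (cbox 0 (K + 1)) (\<lambda>u. (\<phi> (x - u) - \<phi> (x + u)) * w u t)" if x: "x \<in> {-K<..<K}" for x
  proof -
    let ?f = "\<lambda>u. (\<phi> (x - u) - \<phi> (x + u)) * w u t"
    have c: "continuous_on (cbox 0 (K + 1)) ?f"
      by (intro continuous_intros wc continuous_on_compose2[OF \<phi>_cont[of UNIV]]) auto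
    have "ker x t u = indicator (cbox 0 (K + 1)) u *\<^sub>R ?f u" for u
    proof (cases "u > 0 \<and> u > K + 1")
      case True
      then show ?thesis using x \<phi>_zero[of "x - u"] \<phi>_zero[of "x + u"]
        by (auto simp: ker_def indicator_def cbox_interval)
    next
      case False
      then show ?thesis by (cases "u = 0") (auto simp: ker_def indicator_def cbox_interval)
    qed
    then have "M x t = (LINT u:cbox 0 (K + 1)|lborel. ?f u)"
      unfolding M_eq_ker set_lebesgue_integral_def by presburger
    also have "\<dots> = integral (cbox 0 (K + 1)) ?f"
      by (rule set_borel_integral_eq_integral)
        (unfold set_integrable_def, rule borel_integrable_compact[OF compact_cbox c])
    finally show ?thesis .
  qed
  have "((\<lambda>x. integral (cbox 0 (K + 1)) (\<lambda>u. (\<phi> (x - u) - \<phi> (x + u)) * w u t)) has_field_derivative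
     integral (cbox 0 (K + 1)) (\<lambda>u. (\<phi>' (R - u) - \<phi>' (R + u)) * w u t)) (at R within UNIV)"
  proof (rule leibniz_rule_field_derivative)
    fix x u :: real
    have 1: "((\<lambda>x. \<phi> (x - u)) has_real_derivative \<phi>' (x - u)) (at x)"
      by (rule DERIV_chain2[where g="\<lambda>x. x - u" and Db=1, OF \<phi>_deriv, simplified])
        (auto intro!: derivative_eq_intros)
    have 2: "((\<lambda>x. \<phi> (x + u)) has_real_derivative \<phi>' (x + u)) (at x)"
      by (rule DERIV_chain2[where g="\<lambda>x. x + u" and Db=1, OF \<phi>_deriv, simplified])
        (auto intro!: derivative_eq_intros)
    show "((\<lambda>x. (\<phi> (x - u) - \<phi> (x + u)) * w u t) has_field_derivative (\<phi>' (x - u) - \<phi>' (x + u)) * w u t)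
          (at x within UNIV)"
      using DERIV_cmult_right[OF DERIV_diff[OF 1 2], of "w u t"] by simp
  next
    fix x :: real
    show "(\<lambda>u. (\<phi> (x - u) - \<phi> (x + u)) * w u t) integrable_on cbox 0 (K + 1)"
      by (rule integrable_continuous)
        (intro continuous_intros wc continuous_on_compose2[OF \<phi>_cont[of UNIV]]; auto)
  next
    show "continuous_on (UNIV \<times> cbox 0 (K + 1)) (\<lambda>(x, u). (\<phi>' (x - u) - \<phi>' (x + u)) * w u t)"
      unfolding case_prod_beta
      by (intro continuous_intros continuous_on_compose2[OF \<phi>'_cont[of UNIV]] continuous_on_compose2[OF wc]) auto
  qed auto
  then show ?thesis
    by (rule has_field_derivative_transform_within_open[of _ _ _ "{-K<..<K}"]) (use K eq in auto)
qed

lemma M_deriv: "((\<lambda>R. M R t) has_real_derivative A R t) (at R)"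
  using M_deriv_explicit[of R "\<bar>R\<bar> + 1" t] unfolding A_def by (simp add: DERIV_imp_deriv)

text \<open>The derivative is the limit of right difference quotients, so increments over small k >
  0 decide. In this way increments of G can be used although G jumps and w has a kink.\<close>

lemma A_ge:
  assumes "k0 > 0" "\<And>k. 0 < k \<Longrightarrow> k < k0 \<Longrightarrow> m * k \<le> M (R + k) t - M R t"
  shows "m \<le> A R t"
proof (rule tendsto_lowerbound)
  show "((\<lambda>k. (M (R + k) t - M R t) / k) \<longlongrightarrow> A R t) (at_right 0)"
    using M_deriv[of t R] unfolding DERIV_def by (rule filterlim_mono) (auto simp: at_le)
  have "\<forall>\<^sub>F k in at_right 0. k < k0" using assms(1) eventually_at_right by blast
  moreover have "\<forall>\<^sub>F k in at_right (0::real). k > 0" by (rule eventually_at_right_less)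
  ultimately show "\<forall>\<^sub>F k in at_right 0. m \<le> (M (R + k) t - M R t) / k"
    by eventually_elim (use assms(2) in \<open>simp add: field_simps\<close>)
qed simp

lemma A_le:
  assumes "k0 > 0" "\<And>k. 0 < k \<Longrightarrow> k < k0 \<Longrightarrow> M (R + k) t - M R t \<le> m * k"
  shows "A R t \<le> m"
proof (rule tendsto_upperbound)
  show "((\<lambda>k. (M (R + k) t - M R t) / k) \<longlongrightarrow> A R t) (at_right 0)"
    using M_deriv[of t R] unfolding DERIV_def by (rule filterlim_mono) (auto simp: at_le)
  have "\<forall>\<^sub>F k in at_right 0. k < k0" using assms(1) eventually_at_right by blast
  moreover have "\<forall>\<^sub>F k in at_right (0::real). k > 0" by (rule eventually_at_right_less)
  ultimately show "\<forall>\<^sub>F k in at_right 0. (M (R + k) t - M R t) / k \<le> m"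
    by eventually_elim (use assms(2) in \<open>simp add: field_simps\<close>)
qed simp

text \<open>At R = 0 this is the limit of M(R,t)/R, so that \<open>B\<close> describes the gradient
  at the origin as well.\<close>

definition B :: "real \<Rightarrow> real \<Rightarrow> real" where "B R t = (if R = 0 then A 0 t else M R t / R)"

lemma M_mvt:
  assumes "a < b" obtains \<xi> where "a < \<xi>" "\<xi> < b" "M b t - M a t = (b - a) * A \<xi> t"
  using MVT2[OF assms, of "\<lambda>R. M R t" "\<lambda>R. A R t"] M_deriv by blast

text \<open>M vanishes at R = 0, so by the mean value theorem B(R,t) is a value of A on
  [0, R].\<close>

lemma B_ge:
  assumes "R \<ge> 0" "\<And>x. 0 \<le> x \<Longrightarrow> x \<le> R \<Longrightarrow> m \<le> A x t" shows "m \<le> B R t"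
proof (cases "R = 0")
  case False
  then obtain \<xi> where "0 < \<xi>" "\<xi> < R" "M R t - M 0 t = (R - 0) * A \<xi> t" using M_mvt[of 0 R t] assms(1) by auto
  then show ?thesis using assms(2)[of \<xi>] False by (simp add: B_def M_0)
qed (use assms in \<open>simp add: B_def\<close>)

lemma B_le:
  assumes "R \<ge> 0" "\<And>x. 0 \<le> x \<Longrightarrow> x \<le> R \<Longrightarrow> A x t \<le> m" shows "B R t \<le> m"
proof (cases "R = 0")
  case False
  then obtain \<xi> where "0 < \<xi>" "\<xi> < R" "M R t - M 0 t = (R - 0) * A \<xi> t" using M_mvt[of 0 R t] assms(1) by auto
  then show ?thesis using assms(2)[of \<xi>] False by (simp add: B_def M_0)
qed (use assms in \<open>simp add: B_def\<close>)

lemma B_tendsto: "((\<lambda>R. M R t / R) \<longlongrightarrow> B 0 t) (at_right 0)"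
proof -
  have "((\<lambda>k. (M (0 + k) t - M 0 t) / k) \<longlongrightarrow> A 0 t) (at_right 0)"
    using M_deriv[of t 0] unfolding DERIV_def by (rule filterlim_mono) (auto simp: at_le)
  then show ?thesis by (simp add: M_0 B_def)
qed

section \<open>Bounds for the stretches of the averaged map\<close>

lemma A_upper_inner: obtains C where "C > 0" "\<And>R t. 0 \<le> R \<Longrightarrow> R \<le> 3 \<Longrightarrow> A R t \<le> C * (1 + T0 t)"
proof -
  obtain \<Phi> where \<Phi>: "\<Phi> > 0" "\<And>x. \<bar>\<phi>' x\<bar> \<le> \<Phi>" using \<phi>'_bounded by blast
  show ?thesis
  \<comment> \<open>The kernel is at most twice the bound of \<phi>', w is at most (1 + 5 lam)(1 +
    T0 t) on [0, 5], and 5 is the length of the box, which for R <= 3 contains the range of the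
    kernel.\<close>
  proof (rule that[of "2 * \<Phi> * (1 + lam * 5) * 5"])
    fix R t :: real assume R: "0 \<le> R" "R \<le> 3"
    let ?f = "\<lambda>u. (\<phi>' (R - u) - \<phi>' (R + u)) * w u t"
    have wc: "continuous_on (cbox 0 5) (\<lambda>u. w u t)"
      by (rule continuous_on_subset[OF w_cont]) (auto simp: cbox_interval)
    have "A R t = integral (cbox 0 (4 + 1)) ?f"
      using DERIV_unique[OF M_deriv M_deriv_explicit[of R 4 t]] R by simp
    also have "\<dots> \<le> norm (integral (cbox 0 5) ?f)" by simp
    also have "\<dots> \<le> 2 * \<Phi> * (T0 t + lam * 5) * measure lborel (cbox 0 (5::real))"
    proof (rule has_integral_bound)
      show "0 \<le> 2 * \<Phi> * (T0 t + lam * 5)" using \<Phi> T0_nonneg[of t] lam by simp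
      show "(?f has_integral integral (cbox 0 5) ?f) (cbox 0 5)"
        by (rule integrable_integral, rule integrable_continuous)
          (intro continuous_intros wc continuous_on_compose2[OF \<phi>'_cont[of UNIV]]; auto)
      fix u :: real assume u: "u \<in> cbox 0 5"
      have "\<bar>\<phi>' (R - u) - \<phi>' (R + u)\<bar> \<le> 2 * \<Phi>" using \<Phi>(2)[of "R - u"] \<Phi>(2)[of "R + u"] by linarith
      moreover have "\<bar>w u t\<bar> \<le> T0 t + lam * 5"
      proof -
        have "0 \<le> w u t" "w u t \<le> T0 t + lam * u"
          using w_bounds[of u t] T0_nonneg[of t] u by (auto simp: cbox_interval)
        moreover have "lam * u \<le> lam * 5" using u lam by (intro mult_left_mono) (auto simp: cbox_interval)
        ultimately show ?thesis by linarith
      qed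
      ultimately show "norm (?f u) \<le> 2 * \<Phi> * (T0 t + lam * 5)"
        unfolding real_norm_def abs_mult using \<Phi> by (intro mult_mono) auto
    qed
    also have "\<dots> = 2 * \<Phi> * (T0 t + lam * 5) * 5" by simp
    also have "\<dots> \<le> 2 * \<Phi> * ((1 + lam * 5) * (1 + T0 t)) * 5"
      using \<Phi> T0_nonneg[of t] lam by (intro mult_right_mono mult_left_mono) (auto simp: algebra_simps)
    finally show "A R t \<le> 2 * \<Phi> * (1 + lam * 5) * 5 * (1 + T0 t)" by (simp add: algebra_simps)
  qed (use \<Phi> lam in simp)
qed

lemma AB_upper_inner:
  obtains C where "C > 0" "\<And>R t. 0 \<le> R \<Longrightarrow> R \<le> 3 \<Longrightarrow> A R t \<le> C * (1 + T0 t) \<and> B R t \<le> C * (1 + T0 t)"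
proof -
  obtain C where C: "C > 0" "\<And>R t. 0 \<le> R \<Longrightarrow> R \<le> 3 \<Longrightarrow> A R t \<le> C * (1 + T0 t)" using A_upper_inner by blast
  moreover have "B R t \<le> C * (1 + T0 t)" if "0 \<le> R" "R \<le> 3" for R t
    by (rule B_le) (use C that in auto)
  ultimately show ?thesis using that by blast
qed

lemma A_nonneg: "0 \<le> A R t"
proof (rule A_ge[of 1])
  fix k :: real assume "0 < k"
  then show "0 * k \<le> M (R + k) t - M R t"
    using M_diff_ge[of 0 R k t] G_mono[of "R - z" "R + k - z" t for z] by simp
qed simp

text \<open>The bound by a power of \<open>T0 t + lam\<close> comes from the slope of \<open>w\<close>, the bounds by \<open>T0 t\<close> from the jump
  at the origin.\<close>
lemma A_lower:
  obtains \<kappa> \<delta> where "\<kappa> > 0" "\<delta> > 0" "\<delta> \<le> 1"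
    "\<And>R t. 0 \<le> R \<Longrightarrow> \<kappa> / (T0 t + lam) ^ (d - 1) \<le> A R t"
    "\<And>R t. 0 \<le> R \<Longrightarrow> R \<le> \<delta> \<Longrightarrow> \<kappa> * T0 t \<le> A R t"
    "\<And>R t. 0 \<le> R \<Longrightarrow> R \<le> 3 \<Longrightarrow> \<kappa> * T0 t \<le> B R t"
    "\<And>R t. 0 \<le> R \<Longrightarrow> \<kappa> / (T0 t + lam) ^ (d - 1) \<le> B R t"
proof -
  obtain c e where c: "c > 0" "0 < e" "e \<le> 1" "\<And>z. \<bar>z\<bar> \<le> e \<Longrightarrow> c \<le> \<phi> z" using \<phi>_core by blast
  define \<delta> where "\<delta> = e / 4"
  have \<delta>: "\<delta> > 0" "\<delta> \<le> 1" "e = 4 * \<delta>" using c by (auto simp: \<delta>_def)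
  \<comment> \<open>A lower bound for the slope of w at distances of at least 2 \<delta>.\<close>
  define m where "m t = H * ((2 * \<delta>) / w (2 * \<delta>) t) ^ (d - 1)" for t
  have m0: "m t \<ge> 0" for t using w_pos[of "2 * \<delta>" t] \<delta> H by (simp add: m_def)
  have A1: "c * m t * (2 * \<delta>) \<le> A R t" if R: "0 \<le> R" for R t
  proof (rule A_ge[of 1])
    fix k :: real assume k: "0 < k" "k < 1"
    \<comment> \<open>For these z the points R - z lie beyond 2 \<delta>, away from the jump, and
      there w has slope at least m t because R/w increases. The interval has length e - 2 \<delta> =
      2 \<delta>.\<close>
    have "c * (m t * k) * (- (2 * \<delta>) - (- e)) \<le> M (R + k) t - M R t"
    proof (rule M_diff_ge_partial)
      fix z assume z: "- e \<le> z" "z \<le> - (2 * \<delta>)"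
      show "c \<le> \<phi> z" using c z \<delta> by auto
      have a: "2 * \<delta> \<le> R - z" using z R by linarith
      have 2: "H * ((R - z) / w (R - z) t) ^ (d - 1) * (R + k - z - (R - z)) \<le> w (R + k - z) t - w (R - z) t"
        by (rule w_increment2(1)) (use a \<delta> k in linarith)+
      have "m t \<le> H * ((R - z) / w (R - z) t) ^ (d - 1)"
      proof -
        have "w (R - z) t / (R - z) \<le> w (2 * \<delta>) t / (2 * \<delta>)" by (rule w_ratio_antimono) (use a \<delta> in auto)
        then have "2 * \<delta> / w (2 * \<delta>) t \<le> (R - z) / w (R - z) t"
          using w_pos[of "R - z" t] w_pos[of "2 * \<delta>" t] a \<delta> by (simp add: field_simps)
        then show ?thesis unfolding m_def using H w_pos[of "2 * \<delta>" t] \<delta>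
          by (intro mult_left_mono power_mono) auto
      qed
      then have "m t * k \<le> H * ((R - z) / w (R - z) t) ^ (d - 1) * k" using k by (intro mult_right_mono) auto
      also have "\<dots> \<le> w (R + k - z) t - w (R - z) t" using 2 by simp
      also have "\<dots> = G (R + k - z) t - G (R - z) t" using a \<delta> k by (simp add: G_pos)
      finally show "m t * k \<le> G (R + k - z) t - G (R - z) t" .
    qed (use k c m0 \<delta> in auto)
    then show "c * m t * (2 * \<delta>) * k \<le> M (R + k) t - M R t" using \<delta> by (simp add: algebra_simps)
  qed simp
  have A2: "c * T0 t \<le> A R t" if R: "0 \<le> R" "R \<le> \<delta>" for R t
  proof (rule A_ge[of \<delta>])
    fix k assume k: "0 < k" "k < \<delta>"
    \<comment> \<open>For z in [R, R + k] the origin lies between R - z and R + k - z, so G grows by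
      at least T0 t. The length of this interval supplies the factor k.\<close>
    have "c * T0 t * (R + k - R) \<le> M (R + k) t - M R t"
    proof (rule M_diff_ge_partial)
      fix z assume z: "R \<le> z" "z \<le> R + k"
      show "c \<le> \<phi> z" using c z \<delta> R k by auto
      show "T0 t \<le> G (R + k - z) t - G (R - z) t"
      proof (cases "z < R + k")
        case True
        then have "T0 t \<le> G (R + k - z) t" by (intro G_ge) simp
        moreover have "G (R - z) t \<le> 0" using G_mono[of "R - z" 0 t] z by (simp add: G_0)
        ultimately show ?thesis by simp
      next
        case False
        then have "z = R + k" using z by simp
        then show ?thesis using G_ge[of k t] k by (simp add: G_0 G_odd)
      qed
    qed (use k c T0_nonneg in auto)
    then show "c * T0 t * k \<le> M (R + k) t - M R t" by simp
  qed (use \<delta> in simp)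
  have M_mono: "M x t \<le> M y t" if "x \<le> y" for x y t
  proof -
    have "0 \<le> M (x + (y - x)) t - M x t" 
      by (rule M_diff_ge) (use that G_mono in auto)
    then show ?thesis by simp
  qed
  have B2: "c * \<delta> / 3 * T0 t \<le> B R t" if R: "0 \<le> R" "R \<le> 3" for R t
  proof (cases "R \<le> \<delta>")
    case True
    have "c * T0 t \<le> B R t" by (rule B_ge) (use True R A2 in auto)
    moreover have "c * \<delta> / 3 * T0 t \<le> c * T0 t"
      using c \<delta> T0_nonneg[of t] by (intro mult_right_mono) auto
    ultimately show ?thesis by linarith
  next
    case False
    have "c * T0 t \<le> B \<delta> t" by (rule B_ge) (use \<delta> A2 in auto)
    then have "c * T0 t * \<delta> \<le> M \<delta> t" using \<delta> by (simp add: B_def field_simps)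
    \<comment> \<open>M is increasing, so beyond \<delta> its value at \<delta> is still available;
      dividing by R <= 3 costs only a constant.\<close>
    also have "\<dots> \<le> M R t" using False by (intro M_mono) simp
    finally have "c * T0 t * \<delta> / R \<le> B R t" using False R \<delta> by (simp add: B_def divide_right_mono)
    moreover have "c * T0 t * \<delta> / 3 \<le> c * T0 t * \<delta> / R"
      using R False \<delta> c T0_nonneg[of t] by (intro divide_left_mono) auto
    ultimately have "c * T0 t * \<delta> / 3 \<le> B R t" by linarith
    then show ?thesis by (simp add: mult_ac)
  qed
  define \<kappa> where "\<kappa> = min (c * \<delta> / 3) (c * H * (2 * \<delta>) ^ (d - 1) * (2 * \<delta>))"
  have \<kappa>: "\<kappa> > 0" "\<kappa> \<le> c * \<delta> / 3" "\<kappa> \<le> c * H * (2 * \<delta>) ^ (d - 1) * (2 * \<delta>)" "\<kappa> \<le> c"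
  proof -
    have "c * \<delta> / 3 \<le> c" using c \<delta> by simp
    moreover show "\<kappa> \<le> c * \<delta> / 3" by (simp add: \<kappa>_def)
    ultimately show "\<kappa> \<le> c" by linarith
    show "\<kappa> \<le> c * H * (2 * \<delta>) ^ (d - 1) * (2 * \<delta>)" by (simp add: \<kappa>_def)
  qed (use c \<delta> H in \<open>simp add: \<kappa>_def\<close>)
  have A1': "\<kappa> / (T0 t + lam) ^ (d - 1) \<le> A R t" if "0 \<le> R" for R t
  proof -
    have wd: "0 < w (2 * \<delta>) t" "w (2 * \<delta>) t \<le> T0 t + lam"
    proof -
      have "lam * (2 * \<delta>) \<le> lam * 1" using \<delta> c lam by (intro mult_left_mono) auto
      then show "w (2 * \<delta>) t \<le> T0 t + lam" using w_bounds(2)[of "2 * \<delta>" t] \<delta> by simp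
    qed (use w_pos \<delta> in auto)
    have "\<kappa> / (T0 t + lam) ^ (d - 1) \<le> c * H * (2 * \<delta>) ^ (d - 1) * (2 * \<delta>) / (w (2 * \<delta>) t) ^ (d - 1)"
      using \<kappa> wd c \<delta> H by (intro frac_le power_mono) auto
    also have "\<dots> = c * m t * (2 * \<delta>)" by (simp add: m_def power_divide)
    also have "\<dots> \<le> A R t" by (rule A1[OF that])
    finally show ?thesis .
  qed
  have A2': "\<kappa> * T0 t \<le> A R t" if "0 \<le> R" "R \<le> \<delta>" for R t
    using A2[OF that, of t] mult_right_mono[OF \<kappa>(4) T0_nonneg[of t]] by linarith
  show ?thesis
  proof (rule that[OF \<kappa>(1) \<delta>(1,2) A1' A2'])
    fix R t :: real assume R: "0 \<le> R"
    show "\<kappa> * T0 t \<le> B R t" if "R \<le> 3"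
      using B2[OF R that, of t] mult_right_mono[OF \<kappa>(2) T0_nonneg[of t]] by linarith
    show "\<kappa> / (T0 t + lam) ^ (d - 1) \<le> B R t" by (rule B_ge) (use R A1' in auto)
  qed
qed

text \<open>The averaging window around R, enlarged by an increment k < 1/2, lies in [R/2, 3R/2] as
  soon as R + 3/2 <= 3R/2; this is the origin of the threshold 3. The slope of w is controlled by a
  power of R'/w(R',t) and the quotient B by w(R',t)/R, both at an end point R' of this interval. In
  the determinant the values of w cancel, and only the factors 2^(1-d) and (3/2)^(d-1)
  remain.\<close>

lemma AB_outer:
  assumes R: "R \<ge> 3"
  shows "A R t \<le> lam" "B R t \<le> T0 t / R + 3 / 2 * lam" "0 < B R t"
    "H / 2 ^ (d - 1) \<le> A R t * B R t ^ (d - 1)" "A R t * B R t ^ (d - 1) \<le> lam ^ d * (3 / 2) ^ (d - 1)"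
proof -
  let ?a = "R / 2" and ?b = "3 / 2 * R"
  let ?m = "H * (?a / w ?a t) ^ (d - 1)" and ?M = "lam ^ d * (?b / w ?b t) ^ (d - 1)"
  have wa: "w ?a t > 0" and wb: "w ?b t > 0" using w_pos R by auto
  have inc: "?m * k \<le> G (R + k - z) t - G (R - z) t \<and> G (R + k - z) t - G (R - z) t \<le> ?M * k \<and>
     G (R + k - z) t - G (R - z) t \<le> lam * k"
    if z: "\<bar>z\<bar> \<le> 1" and k: "0 < k" "k < 1 / 2" for z k
  proof -
    let ?x = "R - z" and ?y = "R + k - z"
    have xy: "?a \<le> ?x" "?x \<le> ?y" "?y \<le> ?b" "0 < ?x" using z k R by (auto simp: abs_le_iff)
    have GG: "G ?y t - G ?x t = w ?y t - w ?x t" using xy by (simp add: G_pos)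
    have "w ?x t / ?x \<le> w ?a t / ?a" "w ?b t / ?b \<le> w ?y t / ?y"
      by (rule w_ratio_antimono; use xy R in linarith)+
    then have q: "?a / w ?a t \<le> ?x / w ?x t" "?y / w ?y t \<le> ?b / w ?b t"
      using wa wb w_pos[of ?x t] w_pos[of ?y t] xy R by (auto simp: field_simps)
    have "?m * k \<le> H * (?x / w ?x t) ^ (d - 1) * k"
      using q H k wa R by (intro mult_right_mono mult_left_mono power_mono) auto
    also have "\<dots> \<le> w ?y t - w ?x t" using w_increment2(1)[OF xy(4,2), of t] by simp
    finally have 1: "?m * k \<le> w ?y t - w ?x t" .
    have "w ?y t - w ?x t \<le> lam ^ d * (?y / w ?y t) ^ (d - 1) * k"
      using w_increment2(2)[OF xy(4,2), of t] by simp
    also have "\<dots> \<le> ?M * k"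
      using q lam k w_pos[of ?y t] xy by (intro mult_right_mono mult_left_mono power_mono) auto
    finally have 2: "w ?y t - w ?x t \<le> ?M * k" .
    have "w ?y t - w ?x t \<le> lam * k" using w_increment(2)[of ?x ?y t] xy by simp
    with 1 2 GG show ?thesis by simp
  qed
  have A1: "?m \<le> A R t" by (rule A_ge[of "1 / 2"]) (use inc in \<open>auto intro!: M_diff_ge\<close>)
  have A2: "A R t \<le> ?M" by (rule A_le[of "1 / 2"]) (use inc in \<open>auto intro!: M_diff_le\<close>)
  show A3: "A R t \<le> lam" by (rule A_le[of "1 / 2"]) (use inc in \<open>auto intro!: M_diff_le\<close>)
  have M1: "w ?a t \<le> M R t"
  proof (rule M_ge)
    fix z :: real assume "\<bar>z\<bar> \<le> 1"
    then have "?a \<le> R - z" "0 < ?a" using R by (auto simp: abs_le_iff)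
    then show "w ?a t \<le> G (R - z) t" using G_mono[of ?a "R - z" t] by (simp add: G_pos)
  qed
  have M2: "M R t \<le> w ?b t"
  proof (rule M_le)
    fix z :: real assume "\<bar>z\<bar> \<le> 1"
    then have "R - z \<le> ?b" "0 < ?b" using R by (auto simp: abs_le_iff)
    then show "G (R - z) t \<le> w ?b t" using G_mono[of "R - z" ?b t] by (simp add: G_pos)
  qed
  have B: "B R t = M R t / R" using R by (simp add: B_def)
  show Bpos: "0 < B R t" unfolding B using M1 wa R by simp
  have "w ?b t \<le> T0 t + lam * ?b" using w_bounds(2)[of ?b t] R by simp
  then have "M R t / R \<le> (T0 t + lam * ?b) / R" using M2 R by (intro divide_right_mono) auto
  also have "\<dots> = T0 t / R + 3 / 2 * lam" using R by (simp add: add_divide_distrib)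
  finally show "B R t \<le> T0 t / R + 3 / 2 * lam" by (simp add: B)
  have "H / 2 ^ (d - 1) = ?m * (w ?a t / R) ^ (d - 1)"
    using wa R by (simp add: power_divide power_mult_distrib)
  also have "\<dots> \<le> A R t * B R t ^ (d - 1)"
    unfolding B using M1 wa R A1 A_nonneg H by (intro mult_mono power_mono divide_right_mono) auto
  finally show "H / 2 ^ (d - 1) \<le> A R t * B R t ^ (d - 1)" .
  have "A R t * B R t ^ (d - 1) \<le> ?M * (w ?b t / R) ^ (d - 1)"
    unfolding B using M1 M2 wa wb R A2 lam by (intro mult_mono power_mono divide_right_mono) auto
  also have "\<dots> = lam ^ d * (3 / 2) ^ (d - 1)"
    using wb R by (simp add: power_divide power_mult_distrib)
  finally show "A R t * B R t ^ (d - 1) \<le> lam ^ d * (3 / 2) ^ (d - 1)" .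
qed

text \<open>The bound has to hold for all t, since t enters as n t. While T0 t <= 1, both stretches
  are at least \<open>\<mu>\<close>. For a larger cavity the radial stretch is at least \<kappa>/(T0
  + lam)^(d-1) and the tangential one at least \<kappa> T0; in the product T0/(T0 + lam) >= 1/(1 +
  lam) removes the dependence on T0.\<close>

lemma det_lower:
  obtains \<epsilon> where "\<epsilon> > 0"
    "\<And>R t. R \<ge> 0 \<Longrightarrow> A R t > 0 \<and> B R t > 0 \<and> \<epsilon> \<le> A R t * B R t ^ (d - 1)"
proof -
  obtain \<kappa> \<delta> where \<kappa>: "\<kappa> > 0"
    and A: "\<And>R t. 0 \<le> R \<Longrightarrow> \<kappa> / (T0 t + lam) ^ (d - 1) \<le> A R t"
    and B2: "\<And>R t. 0 \<le> R \<Longrightarrow> R \<le> 3 \<Longrightarrow> \<kappa> * T0 t \<le> B R t"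
    and B1: "\<And>R t. 0 \<le> R \<Longrightarrow> \<kappa> / (T0 t + lam) ^ (d - 1) \<le> B R t"
    using A_lower by metis
  define \<mu> where "\<mu> = \<kappa> / (1 + lam) ^ (d - 1)"
  have \<mu>: "\<mu> > 0" using \<kappa> lam by (simp add: \<mu>_def)
  have pos: "\<kappa> / (T0 t + lam) ^ (d - 1) > 0" for t 
    using \<kappa> lam T0_nonneg[of t] by (intro divide_pos_pos zero_less_power) auto
  define \<epsilon> where "\<epsilon> = min (H / 2 ^ (d - 1)) (min (\<mu> * \<mu> ^ (d - 1)) (\<mu> * \<kappa> ^ (d - 1)))"
  show ?thesis
  proof (rule that[of \<epsilon>])
    show "\<epsilon> > 0" using H \<mu> \<kappa> by (simp add: \<epsilon>_def)
    fix R t :: real assume R: "R \<ge> 0"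
    have AB: "A R t > 0" "B R t > 0" using A[OF R, of t] B1[OF R, of t] pos[of t] by linarith+
    have "\<epsilon> \<le> A R t * B R t ^ (d - 1)"
    proof (cases "R \<ge> 3")
      case True
      then show ?thesis using AB_outer(4)[OF True, of t] unfolding \<epsilon>_def by linarith
    next
      case R3: False
      show ?thesis
      proof (cases "T0 t \<le> 1")
        case True
        have "\<mu> \<le> \<kappa> / (T0 t + lam) ^ (d - 1)"
          unfolding \<mu>_def using \<kappa> lam True T0_nonneg[of t] 
          by (intro divide_left_mono power_mono mult_pos_pos zero_less_power) auto
        then have "\<mu> \<le> A R t" "\<mu> \<le> B R t" using A[OF R, of t] B1[OF R, of t] by linarith+
        then have "\<mu> * \<mu> ^ (d - 1) \<le> A R t * B R t ^ (d - 1)"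
          using \<mu> by (intro mult_mono power_mono) auto
        then show ?thesis unfolding \<epsilon>_def by linarith
      next
        case False
        have "\<mu> * \<kappa> ^ (d - 1) = \<kappa> * \<kappa> ^ (d - 1) / (1 + lam) ^ (d - 1)" by (simp add: \<mu>_def)
        also have "\<dots> = \<kappa> * (\<kappa> / (1 + lam)) ^ (d - 1)" by (simp add: power_divide)
        also have "\<dots> \<le> \<kappa> * (\<kappa> * T0 t / (T0 t + lam)) ^ (d - 1)"
        proof (intro mult_left_mono power_mono)
          have "T0 t + lam \<le> T0 t * (1 + lam)" using False lam by (simp add: algebra_simps)
          then have "1 / (1 + lam) \<le> T0 t / (T0 t + lam)" using lam False by (simp add: field_simps)
          then have "\<kappa> * (1 / (1 + lam)) \<le> \<kappa> * (T0 t / (T0 t + lam))" using \<kappa> by (intro mult_left_mono) auto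
          then show "\<kappa> / (1 + lam) \<le> \<kappa> * T0 t / (T0 t + lam)" by simp
        qed (use \<kappa> lam in auto)
        also have "\<dots> = (\<kappa> / (T0 t + lam) ^ (d - 1)) * (\<kappa> * T0 t) ^ (d - 1)" by (simp add: power_divide)
        also have "\<dots> \<le> A R t * B R t ^ (d - 1)"
          using A[OF R, of t] B2[of R t] R R3 \<kappa> T0_nonneg[of t] AB pos[of t]
          by (intro mult_mono power_mono) auto
        finally show ?thesis unfolding \<epsilon>_def by linarith
      qed
    qed
    with AB show "A R t > 0 \<and> B R t > 0 \<and> \<epsilon> \<le> A R t * B R t ^ (d - 1)" by blast
  qed
qed


section \<open>Limits and measurability of the averaged coefficients\<close>

lemma M_abs: "\<bar>M R t\<bar> \<le> T0 t + lam * (\<bar>R\<bar> + 1)"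
proof -
  have "\<bar>G (R - z) t\<bar> \<le> T0 t + lam * (\<bar>R\<bar> + 1)" if "\<bar>z\<bar> \<le> 1" for z
  proof -
    have "lam * \<bar>R - z\<bar> \<le> lam * (\<bar>R\<bar> + 1)" using that lam by (intro mult_left_mono) auto
    then show ?thesis using G_abs[of "R - z" t] by linarith
  qed
  then have b: "- (T0 t + lam * (\<bar>R\<bar> + 1)) \<le> G (R - z) t" "G (R - z) t \<le> T0 t + lam * (\<bar>R\<bar> + 1)"
    if "\<bar>z\<bar> \<le> 1" for z using that by fastforce+
  have "- (T0 t + lam * (\<bar>R\<bar> + 1)) \<le> M R t" by (rule M_ge) (rule b)
  moreover have "M R t \<le> T0 t + lam * (\<bar>R\<bar> + 1)" by (rule M_le) (rule b)
  ultimately show ?thesis by linarith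
qed

text \<open>Scaling back by n shrinks the window to a width of order 1/n, so
  \<open>w_increment_local\<close> finally applies to all of it.\<close>

lemma A_limit:
  assumes R: "R > 0" "R \<noteq> \<sigma> * t"
  shows "(\<lambda>n. A (real n * R) (real n * t)) \<longlonglongrightarrow> dw R t"
proof (rule LIMSEQ_I)
  fix e :: real assume "e > 0"
  then have e: "e / 2 > 0" by simp
  obtain \<delta> where \<delta>: "\<delta> > 0" "\<delta> < R"
    "\<And>a b. R - \<delta> < a \<Longrightarrow> a \<le> b \<Longrightarrow> b < R + \<delta> \<Longrightarrow>
      (dw R t - e / 2) * (b - a) \<le> w b t - w a t \<and> w b t - w a t \<le> (dw R t + e / 2) * (b - a)"
    using w_increment_local[OF R e] by blast
  \<comment> \<open>|z| <= 1 and 0 < k < 1 move the arguments by less than 2/n, and this is less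
    than \<delta>.\<close>
  obtain N where N: "real N > 2 / \<delta>" using reals_Archimedean2 by blast
  show "\<exists>N. \<forall>n\<ge>N. norm (A (real n * R) (real n * t) - dw R t) < e"
  proof (intro exI allI impI)
    fix n assume "n \<ge> N"
    then have "real n > 2 / \<delta>" using N by (meson less_le_trans of_nat_le_iff)
    then have nd: "2 < \<delta> * real n" using \<delta>(1) by (simp add: field_simps)
    then have n0: "real n > 0" using \<delta>(1) by (smt (verit) mult_nonneg_nonpos of_nat_0_le_iff)
    let ?D = "\<lambda>z k. G (real n * R + k - z) (real n * t) - G (real n * R - z) (real n * t)"
    have inc: "(dw R t - e / 2) * k \<le> ?D z k \<and> ?D z k \<le> (dw R t + e / 2) * k"
      if z: "\<bar>z\<bar> \<le> 1" and k: "0 < k" "k < 1" for z k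
    proof -
      let ?x = "R - z / real n" and ?y = "R + (k - z) / real n"
      have b: "R - \<delta> < ?x" "?x \<le> ?y" "?y < R + \<delta>"
      proof -
        have "z \<le> 1" "-1 \<le> z" using z by (auto simp: abs_le_iff)
        then have "z < \<delta> * real n" "k - z < \<delta> * real n" using nd k by linarith+
        then show "R - \<delta> < ?x" "?y < R + \<delta>" using n0 by (auto simp: field_simps)
        have "- z \<le> k - z" using k by simp
        then have "- z / real n \<le> (k - z) / real n" using n0 by (intro divide_right_mono) auto
        then show "?x \<le> ?y" by simp
      qed
      have x0: "0 < ?x" "0 < ?y" using b \<delta>(2) by linarith+
      have xy: "real n * R - z = real n * ?x" "real n * R + k - z = real n * ?y"
        using n0 by (auto simp: field_simps)
      have "?D z k = w (real n * ?y) (real n * t) - w (real n * ?x) (real n * t)"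
        unfolding xy using x0 n0 by (simp add: G_pos)
      also have "\<dots> = real n * (w ?y t - w ?x t)" unfolding w_scale[OF n0] by (rule right_diff_distrib[symmetric])
      finally have D: "?D z k = real n * (w ?y t - w ?x t)" .
      have yx: "?y - ?x = k / real n" by (simp add: diff_divide_distrib)
      have "(dw R t - e / 2) * (k / real n) \<le> w ?y t - w ?x t \<and> w ?y t - w ?x t \<le> (dw R t + e / 2) * (k / real n)"
        using \<delta>(3)[OF b] unfolding yx .
      then show ?thesis unfolding D using n0 by (auto simp: field_simps)
    qed
    have "dw R t - e / 2 \<le> A (real n * R) (real n * t)"
      by (rule A_ge[of 1]) (use inc in \<open>auto intro!: M_diff_ge\<close>)
    moreover have "A (real n * R) (real n * t) \<le> dw R t + e / 2"
      by (rule A_le[of 1]) (use inc in \<open>auto intro!: M_diff_le\<close>)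
    ultimately show "norm (A (real n * R) (real n * t) - dw R t) < e"
      using \<open>e > 0\<close> unfolding real_norm_def by linarith
  qed
qed

text \<open>Once n R > 1 the window misses the jump. There w is Lipschitz in R with constant lam, so
  averaging over radius 1 changes it by at most lam, and by lam/n after scaling.\<close>

lemma M_limit:
  assumes R: "R > 0"
  shows "(\<lambda>n. M (real n * R) (real n * t) / real n) \<longlonglongrightarrow> w R t"
proof (rule LIM_zero_cancel, rule Lim_null_comparison)
  obtain N where N: "real N > 1 / R" using reals_Archimedean2 by blast
  show "\<forall>\<^sub>F n in sequentially. norm (M (real n * R) (real n * t) / real n - w R t) \<le> lam / real n"
    unfolding eventually_sequentially
  proof (intro exI allI impI)
    fix n assume "n \<ge> N"
    then have "real n > 1 / R" using N by (meson less_le_trans of_nat_le_iff)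
    then have nR: "real n * R > 1" using R by (simp add: field_simps)
    then have n0: "real n > 0" using R by (smt (verit) mult_nonpos_nonneg of_nat_0_le_iff)
    have "M (real n * R) (real n * t) \<le> w (real n * R) (real n * t) + lam"
    proof (rule M_le)
      fix z :: real assume z: "\<bar>z\<bar> \<le> 1"
      have "G (real n * R - z) (real n * t) \<le> G (real n * R + 1) (real n * t)" using z by (intro G_mono) auto
      also have "\<dots> = w (real n * R + 1) (real n * t)" using nR by (intro G_pos) simp
      also have "\<dots> \<le> w (real n * R) (real n * t) + lam"
        using w_increment(2)[of "real n * R" "real n * R + 1" "real n * t"] nR by simp
      finally show "G (real n * R - z) (real n * t) \<le> w (real n * R) (real n * t) + lam" .
    qed
    moreover have "w (real n * R) (real n * t) - lam \<le> M (real n * R) (real n * t)"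
    proof (rule M_ge)
      fix z :: real assume z: "\<bar>z\<bar> \<le> 1"
      have "w (real n * R) (real n * t) - lam \<le> w (real n * R - 1) (real n * t)"
        using w_increment(2)[of "real n * R - 1" "real n * R" "real n * t"] nR by simp
      also have "\<dots> = G (real n * R - 1) (real n * t)" using nR by (intro G_pos[symmetric]) simp
      also have "\<dots> \<le> G (real n * R - z) (real n * t)" using z by (intro G_mono) auto
      finally show "w (real n * R) (real n * t) - lam \<le> G (real n * R - z) (real n * t)" .
    qed
    ultimately have "\<bar>M (real n * R) (real n * t) - real n * w R t\<bar> \<le> lam"
      unfolding w_scale[OF n0] by linarith
    then have "\<bar>M (real n * R) (real n * t) - real n * w R t\<bar> / real n \<le> lam / real n"
      by (intro divide_right_mono) auto
    moreover have "M (real n * R) (real n * t) / real n - w R t = (M (real n * R) (real n * t) - real n * w R t) / real n"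
      using n0 by (simp add: diff_divide_distrib)
    ultimately show "norm (M (real n * R) (real n * t) / real n - w R t) \<le> lam / real n"
      by simp
  qed
  show "(\<lambda>n. lam / real n) \<longlonglongrightarrow> 0" by (rule lim_const_over_n)
qed

lemma M_borel [measurable]: "(\<lambda>p. M (fst p) (snd p)) \<in> borel_measurable (borel \<Otimes>\<^sub>M borel)"
proof -
  have "(\<lambda>q. G (fst (fst q) - snd q) (snd (fst q))) \<in> borel_measurable ((borel \<Otimes>\<^sub>M borel) \<Otimes>\<^sub>M (lborel :: real measure))"
    using measurable_compose[OF _ G_borel_prod, of "\<lambda>q. (fst (fst q) - snd q, snd (fst q))" "(borel \<Otimes>\<^sub>M borel) \<Otimes>\<^sub>M lborel"]
    by simp
  then have "(\<lambda>(p, z). \<phi> z * G (fst p - z) (snd p)) \<in> borel_measurable ((borel \<Otimes>\<^sub>M borel) \<Otimes>\<^sub>M (lborel :: real measure))"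
    unfolding case_prod_beta by measurable
  from lborel.borel_measurable_lebesgue_integral[OF this] show ?thesis by (simp add: M_def)
qed

lemma A_borel [measurable]: "(\<lambda>p. A (fst p) (snd p)) \<in> borel_measurable (borel \<Otimes>\<^sub>M borel)"
proof (rule borel_measurable_LIMSEQ_real)
  let ?k = "\<lambda>n. 1 / real (Suc n)"
  fix p :: "real \<times> real"
  have "filterlim ?k (at 0) sequentially"
    unfolding filterlim_at using LIMSEQ_Suc[OF lim_const_over_n[of "1::real"]] by (auto intro!: always_eventually)
  with M_deriv[of "snd p" "fst p", unfolded DERIV_def]
  show "(\<lambda>n. (M (fst p + ?k n) (snd p) - M (fst p) (snd p)) / ?k n) \<longlonglongrightarrow> A (fst p) (snd p)"
    by (rule filterlim_compose)
  fix n
  have "(\<lambda>p. M (fst p + ?k n) (snd p)) \<in> borel_measurable (borel \<Otimes>\<^sub>M borel)"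
    using measurable_compose[OF _ M_borel, of "\<lambda>p. (fst p + ?k n, snd p)" "borel \<Otimes>\<^sub>M borel"] by simp
  then show "(\<lambda>p. (M (fst p + ?k n) (snd p) - M (fst p) (snd p)) / ?k n) \<in> borel_measurable (borel \<Otimes>\<^sub>M borel)"
    by (intro borel_measurable_divide borel_measurable_diff M_borel borel_measurable_const)
qed

lemma B_borel [measurable]: "(\<lambda>p. B (fst p) (snd p)) \<in> borel_measurable (borel \<Otimes>\<^sub>M borel)"
proof -
  have "(\<lambda>p. A 0 (snd p)) \<in> borel_measurable (borel \<Otimes>\<^sub>M borel)"
    using measurable_compose[OF _ A_borel, of "\<lambda>p. (0, snd p)" "borel \<Otimes>\<^sub>M borel"] by simp
  moreover have Z: "{p \<in> space (borel \<Otimes>\<^sub>M borel). fst p = (0::real)} \<in> sets (borel \<Otimes>\<^sub>M (borel :: real measure))"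
    using measurable_sets[OF measurable_fst[of borel borel], of "{0::real}"]
    by (simp add: vimage_def Int_def conj_commute)
  ultimately show ?thesis unfolding B_def
    by (intro measurable_If borel_measurable_divide M_borel measurable_fst Z)
qed

end

section \<open>Integration over space-time\<close>

text \<open>The weak integrand is known only off a null set and need not be Borel; completeness of
  Lebesgue measure supplies its measurability.\<close>

lemma integral_completion_AE:
  fixes f g :: "'a::euclidean_space \<Rightarrow> real"
  assumes g: "g \<in> borel_measurable borel" and eq: "AE x in lborel. f x = g x"
  shows "integrable lebesgue f \<longleftrightarrow> integrable lborel g" "(LINT x|lebesgue. f x) = (LINT x|lborel. g x)"
proof -
  have gl: "g \<in> borel_measurable lebesgue" using g by (intro measurable_completion) simp
  have eq': "AE x in lebesgue. g x = f x" using AE_completion[OF eq] by (auto simp: eq_commute)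
  have fl: "f \<in> borel_measurable lebesgue" by (rule borel_measurable_AE[OF gl eq'])
  have "integrable lebesgue f \<longleftrightarrow> integrable lebesgue g"
    by (rule integrable_cong_AE[OF fl gl]) (use eq' in \<open>auto simp: eq_commute\<close>)
  also have "\<dots> \<longleftrightarrow> integrable lborel g" by (rule integrable_completion) (use g in simp)
  finally show "integrable lebesgue f \<longleftrightarrow> integrable lborel g" .
  have "(LINT x|lebesgue. f x) = (LINT x|lebesgue. g x)"
    by (rule integral_cong_AE[OF fl gl]) (use eq' in \<open>auto simp: eq_commute\<close>)
  also have "\<dots> = (LINT x|lborel. g x)" by (rule integral_completion) (use g in simp)
  finally show "(LINT x|lebesgue. f x) = (LINT x|lborel. g x)" .
qed

lemma lborel_null_by_sections:
  fixes S :: "('a::euclidean_space \<times> 'b::euclidean_space) set"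
  assumes S: "S \<in> sets borel" and null: "\<And>t. emeasure lborel {x. (x, t) \<in> S} = 0"
  shows "S \<in> null_sets lborel"
proof -
  have S': "S \<in> sets (lborel \<Otimes>\<^sub>M lborel)" using S by (simp only: lborel_prod sets_lborel)
  have "emeasure (lborel \<Otimes>\<^sub>M lborel) S = (\<integral>\<^sup>+t. emeasure lborel ((\<lambda>x. (x, t)) -` S) \<partial>lborel)"
    by (rule lborel_pair.emeasure_pair_measure_alt2[OF S'])
  also have "\<dots> = 0" using null by (simp add: vimage_def)
  finally show ?thesis using S by (simp add: lborel_prod null_sets_def)
qed

text \<open>The sections of S are null for every t, so the inner integrals of f and F agree for
  every t, and Fubini's theorem is applied to the Borel function F alone.\<close>

lemma iterated_integral_AE:
  fixes f :: "'a::euclidean_space \<Rightarrow> real \<Rightarrow> real" and F :: "'a \<times> real \<Rightarrow> real"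
  assumes F: "integrable lborel F" and S: "S \<in> sets borel"
    and null: "\<And>t. emeasure lborel {x. (x, t) \<in> S} = 0"
    and eq: "\<And>x t. (x, t) \<notin> S \<Longrightarrow> f x t = F (x, t)"
  shows "integrable lebesgue (\<lambda>(x, t). f x t)"
    "(LINT t|lebesgue. LINT x|lebesgue. f x t) = (LINT z|lborel. F z)"
proof -
  have Fb: "F \<in> borel_measurable borel" using borel_measurable_integrable[OF F] by simp
  have "AE z in lborel. z \<notin> S" by (rule AE_not_in[OF lborel_null_by_sections[OF S null]])
  then have AE: "AE z in lborel. (\<lambda>(x, t). f x t) z = F z"
    by eventually_elim (auto simp: case_prod_beta eq)
  show "integrable lebesgue (\<lambda>(x, t). f x t)"
    using integral_completion_AE(1)[OF Fb AE] F by simp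
  have F2: "integrable (lborel \<Otimes>\<^sub>M lborel) (\<lambda>(x, t). F (x, t))" using F by (simp add: lborel_prod)
  have Fs: "(\<lambda>x. F (x, t)) \<in> borel_measurable borel" for t
    using measurable_compose[OF _ Fb, of "\<lambda>x. (x, t)" borel] by (simp add: borel_prod[symmetric])
  have inner: "(LINT x|lebesgue. f x t) = (LINT x|lborel. F (x, t))" for t
  proof (rule integral_completion_AE(2)[OF Fs])
    have "{x. (x, t) \<in> S} \<in> null_sets lborel"
    proof (rule null_setsI[OF null])
      have "(\<lambda>x. (x, t)) -` S \<inter> space borel \<in> sets (borel :: 'a measure)"
        by (rule measurable_sets[OF _ S]) (simp add: borel_prod[symmetric])
      then show "{x. (x, t) \<in> S} \<in> sets lborel" by (simp add: vimage_def)
    qed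
    from AE_not_in[OF this] show "AE x in lborel. f x t = F (x, t)"
      by eventually_elim (auto simp: eq)
  qed
  have "(\<lambda>t. LINT x|lborel. F (x, t)) \<in> borel_measurable lborel"
  proof -
    have "(\<lambda>(t, x). F (x, t)) \<in> borel_measurable (lborel \<Otimes>\<^sub>M lborel)"
      unfolding case_prod_beta
      by (rule measurable_compose[OF _ Fb]) (simp add: borel_prod[symmetric])
    from lborel.borel_measurable_lebesgue_integral[OF this] show ?thesis by simp
  qed
  then have "(LINT t|lebesgue. LINT x|lebesgue. f x t) = (LINT t|lborel. LINT x|lborel. F (x, t))"
    unfolding inner by (intro integral_completion) simp
  also have "\<dots> = (LINT z|(lborel \<Otimes>\<^sub>M lborel). (\<lambda>(x, t). F (x, t)) z)"
    by (rule lborel_pair.integral_snd[OF F2])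
  finally show "(LINT t|lebesgue. LINT x|lebesgue. f x t) = (LINT z|lborel. F z)"
    by (simp add: lborel_prod)
qed

text \<open>The ball is cut into dyadic annuli, on each of which the integrand is bounded.\<close>
lemma nn_integral_inverse_norm_power:
  fixes k :: nat
  assumes k: "k < DIM('a::euclidean_space)"
  shows "(\<integral>\<^sup>+x. ennreal (indicator (ball (0::'a) 1) x * (1 / norm x ^ k)) \<partial>lborel) < \<infinity>"
proof -
  let ?N = "DIM('a)"
  define c where "c = unit_ball_vol (real ?N)"
  have c0: "c \<ge> 0" by (simp add: c_def)
  let ?g = "\<lambda>j (x::'a). ennreal (2 ^ (k * Suc j)) * indicator (ball 0 ((1/2) ^ j)) x"
  have suminf_ge: "f j \<le> suminf f" for f :: "nat \<Rightarrow> ennreal" and j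
    using sum_le_suminf[of f "{j}"] by simp
  have le: "ennreal (indicator (ball 0 1) x * (1 / norm x ^ k)) \<le> (\<Sum>j. ?g j x)" if x: "x \<noteq> 0" for x :: 'a
  proof (cases "norm x < 1")
    case True
    have "\<exists>j. (1/2) ^ j \<le> norm x"
      using real_arch_pow_inv[of "norm x" "1/2"] x by (auto intro: less_imp_le)
    then obtain J where J: "(1/2) ^ J \<le> norm x" "\<And>i. i < J \<Longrightarrow> \<not> (1/2) ^ i \<le> norm x"
      using exists_least_iff[of "\<lambda>j. (1/2) ^ j \<le> norm x"] by blast
    have "J \<noteq> 0" using J(1) True by (intro notI) simp
    then obtain j where j: "J = Suc j" using not0_implies_Suc by blast
    have xj: "norm x < (1/2) ^ j" using J(2)[of j] j by simp
    have "1 / norm x ^ k \<le> 1 / ((1/2) ^ Suc j) ^ k"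
      using J(1) x unfolding j by (intro divide_left_mono power_mono mult_pos_pos zero_less_power) auto
    also have "\<dots> = 2 ^ (k * Suc j)" by (simp add: power_mult[symmetric] power_one_over mult.commute power_add)
    finally have "ennreal (indicator (ball 0 1) x * (1 / norm x ^ k)) \<le> ennreal (2 ^ (k * Suc j))"
      using True by (intro ennreal_leI) simp
    also have "\<dots> = ?g j x" using xj by simp
    also have "\<dots> \<le> (\<Sum>j. ?g j x)" by (rule suminf_ge)
    finally show ?thesis .
  qed simp
  have "(\<integral>\<^sup>+x. ennreal (indicator (ball (0::'a) 1) x * (1 / norm x ^ k)) \<partial>lborel) \<le> (\<integral>\<^sup>+x. (\<Sum>j. ?g j x) \<partial>lborel)"
  proof (rule nn_integral_mono_AE)
    show "AE x in lborel. ennreal (indicator (ball (0::'a) 1) x * (1 / norm x ^ k)) \<le> (\<Sum>j. ?g j x)"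
      using AE_lborel_singleton[of "0::'a"] by eventually_elim (rule le)
  qed
  also have "\<dots> = (\<Sum>j. \<integral>\<^sup>+x. ?g j x \<partial>lborel)"
  proof (rule nn_integral_suminf)
    fix j
    have [measurable]: "ball (0::'a) ((1/2) ^ j) \<in> sets borel" by simp
    show "?g j \<in> borel_measurable lborel" by measurable
  qed
  also have "\<dots> = (\<Sum>j. ennreal (2 ^ k * c * (1/2) ^ (j * (?N - k))))"
  proof (intro arg_cong[of _ _ suminf] ext)
    fix j
    have "(\<integral>\<^sup>+x. ?g j x \<partial>lborel) = ennreal (2 ^ (k * Suc j)) * emeasure lborel (ball (0::'a) ((1/2) ^ j))"
      by (subst nn_integral_cmult_indicator) auto
    also have "\<dots> = ennreal (2 ^ (k * Suc j) * (c * ((1/2) ^ j) ^ ?N))"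
      using c0 by (simp add: emeasure_ball c_def ennreal_mult)
    also have "2 ^ (k * Suc j) * (c * ((1/2) ^ j) ^ ?N) = 2 ^ k * c * (1/2 :: real) ^ (j * (?N - k))"
    proof -
      have "((1/2 :: real) ^ j) ^ ?N = (1/2) ^ (j * k) * (1/2) ^ (j * (?N - k))"
        using k by (simp add: power_mult[symmetric] power_add[symmetric] distrib_left[symmetric])
      moreover have "(2::real) ^ (k * Suc j) = 2 ^ k * 2 ^ (j * k)" by (simp add: power_add mult.commute)
      moreover have "(2::real) ^ (j * k) * (1/2) ^ (j * k) = 1" by (simp add: power_mult_distrib[symmetric])
      ultimately show ?thesis by (simp add: mult_ac)
    qed
    finally show "(\<integral>\<^sup>+x. ?g j x \<partial>lborel) = ennreal (2 ^ k * c * (1/2) ^ (j * (?N - k)))" .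
  qed
  also have "\<dots> < \<infinity>"
  proof -
    have "summable (\<lambda>j. 2 ^ k * c * ((1/2) ^ (?N - k)) ^ j)"
      using k by (intro summable_mult summable_geometric) (simp add: power_less_one_iff)
    then have "summable (\<lambda>j. 2 ^ k * c * (1/2) ^ (j * (?N - k)))"
      by (simp add: power_mult[symmetric] mult.commute)
    then have "(\<Sum>j. ennreal (2 ^ k * c * (1/2) ^ (j * (?N - k)))) = ennreal (\<Sum>j. 2 ^ k * c * (1/2) ^ (j * (?N - k)))"
      using c0 by (intro suminf_ennreal2) auto
    then show ?thesis by simp
  qed
  finally show ?thesis .
qed

lemma integrable_inverse_norm_power:
  assumes k: "k < DIM('a::euclidean_space)"
  shows "integrable lborel (\<lambda>x::'a. indicator (cball 0 \<rho>) x * (1 / norm x ^ k))"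
proof -
  have 1: "integrable lborel (\<lambda>x::'a. indicator (ball 0 1) x * (1 / norm x ^ k))"
  proof (rule integrableI_bounded)
    have [measurable]: "ball (0::'a) 1 \<in> sets borel" by simp
    show "(\<lambda>x::'a. indicator (ball 0 1) x * (1 / norm x ^ k)) \<in> borel_measurable lborel" by measurable
    show "(\<integral>\<^sup>+x. ennreal (norm (indicator (ball (0::'a) 1) x * (1 / norm x ^ k))) \<partial>lborel) < \<infinity>"
      using nn_integral_inverse_norm_power[OF k] by simp
  qed
  have 2: "integrable lborel (\<lambda>x::'a. indicator (cball 0 \<rho>) x :: real)"
    by (rule integrable_real_indicator) (use emeasure_bounded_finite[OF bounded_cball, of "0::'a" \<rho>] in auto)
  have [measurable]: "cball (0::'a) \<rho> \<in> sets borel" by simp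
  show ?thesis
  proof (rule Bochner_Integration.integrable_bound[OF Bochner_Integration.integrable_add[OF 1 2]])
    show "AE x::'a in lborel. norm (indicator (cball 0 \<rho>) x * (1 / norm x ^ k)) \<le>
        norm (indicator (ball 0 1) x * (1 / norm x ^ k) + indicator (cball 0 \<rho>) x :: real)"
    proof (intro always_eventually allI)
      fix x :: 'a
      have "1 / norm x ^ k \<le> 1" if "norm x \<ge> 1" using that one_le_power[OF that, of k] by (simp add: divide_simps)
      then show "norm (indicator (cball 0 \<rho>) x * (1 / norm x ^ k)) \<le>
        norm (indicator (ball 0 1) x * (1 / norm x ^ k) + indicator (cball 0 \<rho>) x :: real)"
        by (auto simp: indicator_def not_less)
    qed
  qed measurable
qed

text \<open>The common majorant of all densities on a cylinder: the summand 1 covers the bounded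
  terms, and the exponent k = d - 1 keeps the singularity integrable in dimension d.\<close>

definition majorant :: "nat \<Rightarrow> real \<Rightarrow> ('a::euclidean_space) \<times> real \<Rightarrow> real" where
  "majorant k \<rho> z = indicator (cball 0 \<rho>) (fst z) * (1 + 1 / norm (fst z) ^ k) * indicator {-\<rho>..\<rho>} (snd z)"

lemma integrable_majorant:
  assumes k: "k < DIM('a::euclidean_space)"
  shows "integrable lborel (majorant k \<rho> :: 'a \<times> real \<Rightarrow> real)"
proof -
  let ?f = "\<lambda>x::'a. indicator (cball 0 \<rho>) x * (1 + 1 / norm x ^ k)"
  have [measurable]: "cball (0::'a) \<rho> \<in> sets borel" by simp
  have "integrable lborel (\<lambda>x::'a. indicator (cball 0 \<rho>) x :: real)"
    by (rule integrable_real_indicator) (use emeasure_bounded_finite[OF bounded_cball, of "0::'a" \<rho>] in auto)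
  from Bochner_Integration.integrable_add[OF this integrable_inverse_norm_power[OF k, of \<rho>]]
  have f: "integrable lborel ?f" by (simp add: distrib_left)
  have g: "integrable lborel (indicator {-\<rho>..\<rho>} :: real \<Rightarrow> real)"
    by (rule integrable_real_indicator) (use emeasure_bounded_finite[of "{-\<rho>..\<rho>}"] in auto)
  have "integrable (lborel \<Otimes>\<^sub>M lborel) (\<lambda>(x, t). ?f x * indicator {-\<rho>..\<rho>} t)"
  proof (rule lborel_pair.Fubini_integrable)
    show "(\<lambda>(x, t). ?f x * indicator {-\<rho>..\<rho>} t) \<in> borel_measurable (lborel \<Otimes>\<^sub>M lborel)"
      by measurable
    show "integrable lborel (\<lambda>x. LINT t|lborel. norm ((\<lambda>(x, t). ?f x * indicator {-\<rho>..\<rho>} t) (x, t)))"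
      using f by (simp add: abs_mult)
    show "AE x in lborel. integrable lborel (\<lambda>t. (\<lambda>(x, t). ?f x * indicator {-\<rho>..\<rho>} t) (x, t))"
      using g by simp
  qed
  moreover have "majorant k \<rho> = (\<lambda>(x::'a, t). ?f x * indicator {-\<rho>..\<rho>} t)"
    by (auto simp: majorant_def fun_eq_iff)
  ultimately show ?thesis by (simp only: lborel_prod)
qed

section \<open>The weak form for radial maps\<close>

definition psi_tt :: "((real^'n) \<times> real \<Rightarrow> real^'n) \<Rightarrow> (real^'n) \<times> real \<Rightarrow> real^'n" where
  "psi_tt \<psi> = dd (dd \<psi> (0, 1)) (0, 1)"

definition psi_grad :: "((real^'n) \<times> real \<Rightarrow> real^'n) \<Rightarrow> (real^'n) \<times> real \<Rightarrow> real^'n^'n" where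
  "psi_grad \<psi> z = (\<chi> i j. dd \<psi> (axis j 1, 0) z $ i)"

lemma vector_derivative_time:
  assumes "Ck (Suc k) f"
  shows "vector_derivative (\<lambda>s. f (x, s)) (at s) = dd f (0, 1) (x, s)"
proof (rule vector_derivative_at)
  have "((\<lambda>s. (x, s)) has_derivative (\<lambda>k. (0, k))) (at s)"
    by (auto intro!: derivative_eq_intros)
  from has_derivative_compose[OF this Ck_dd_has_derivative[OF assms]]
  have d: "((\<lambda>s. f (x, s)) has_derivative (\<lambda>k. dd f (0, k) (x, s))) (at s)" .
  have "dd f (0, k) (x, s) = k *\<^sub>R dd f (0, 1) (x, s)" for k
  proof -
    have "dd f (0, k *\<^sub>R 1) (x, s) = k *\<^sub>R dd f (0, 1) (x, s)"
      by (rule linear_scale[OF has_derivative_linear[OF d]])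
    then show ?thesis by (simp only: real_scaleR_def mult_1_right)
  qed
  then have "(\<lambda>k. dd f (0, k) (x, s)) = (\<lambda>k. k *\<^sub>R dd f (0, 1) (x, s))" by (rule ext)
  with d show "((\<lambda>s. f (x, s)) has_vector_derivative dd f (0, 1) (x, s)) (at s)"
    unfolding has_vector_derivative_def by (simp only:)
qed

lemma d_tt_eq:
  assumes "Ck 2 \<psi>"
  shows "d_tt (curry \<psi>) x t = psi_tt \<psi> (x, t)"
proof -
  have S2: "Ck (Suc (Suc 0)) \<psi>" using assms by (simp add: numeral_2_eq_2)
  show ?thesis
    unfolding d_tt_def curry_def psi_tt_def vector_derivative_time[OF S2]
    by (rule vector_derivative_time[OF Ck_dd[OF S2]])
qed

lemma grad_x_eq:
  assumes "Ck 2 \<psi>"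
  shows "grad_x (curry \<psi>) x t = psi_grad \<psi> (x, t)"
proof (rule grad_x_eqI)
  have S2: "Ck (Suc (Suc 0)) \<psi>" using assms by (simp add: numeral_2_eq_2)
  have "((\<lambda>x. (x, t)) has_derivative (\<lambda>v. (v, 0))) (at x)"
    by (auto intro!: derivative_eq_intros)
  from has_derivative_compose[OF this Ck_dd_has_derivative[OF S2]]
  have d: "((\<lambda>x. \<psi> (x, t)) has_derivative (\<lambda>v. dd \<psi> (v, 0) (x, t))) (at x)" .
  have "psi_grad \<psi> (x, t) = matrix (\<lambda>v. dd \<psi> (v, 0) (x, t))"
    by (simp add: psi_grad_def matrix_def)
  then have "(\<lambda>v. psi_grad \<psi> (x, t) *v v) = (\<lambda>v. dd \<psi> (v, 0) (x, t))"
    using matrix_vector_mul(2)[OF has_derivative_linear[OF d]] by simp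
  with d show "((\<lambda>x'. curry \<psi> x' t) has_derivative (\<lambda>v. psi_grad \<psi> (x, t) *v v)) (at x)"
    by (simp add: curry_def)
qed

text \<open>The weak integrand of a radial field in terms of its coefficients: with u = x/|x|, the
  displacement is m u and the stress p u u^T + q (1 - u u^T). The solution and its averages differ
  only in m, p and q.\<close>

definition wform :: "real \<Rightarrow> real \<Rightarrow> real \<Rightarrow> ((real^'n) \<times> real \<Rightarrow> real^'n) \<Rightarrow> (real^'n) \<times> real \<Rightarrow> real" where
  "wform m p q \<psi> z = (m / norm (fst z)) * (fst z \<bullet> psi_tt \<psi> z)
     + (p - q) * ((fst z /\<^sub>R norm (fst z)) \<bullet> (psi_grad \<psi> z *v (fst z /\<^sub>R norm (fst z))))
     + q * trace (psi_grad \<psi> z)"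

lemma weak_integrand_radial:
  fixes x :: "real^'n"
  assumes "x \<noteq> 0" "((\<lambda>R. W R t) has_real_derivative a) (at (norm x))" "W (norm x) t / norm x = b"
    "a > 0" "b > 0" "CARD('n) \<ge> 2" "\<And>v. v > 0 \<Longrightarrow> h differentiable at v" "Ck 2 \<psi>"
  shows "weak_integrand h (radial_map W) \<psi> x t =
    wform (W (norm x) t) (stress1 CARD('n) h a b) (stress2 CARD('n) h a b) \<psi> (x, t)"
proof -
  have u: "norm (x /\<^sub>R norm x) = 1" using assms(1) by simp
  have S: "stress h (grad_x (radial_map W) x t) =
      radial_matrix (stress1 CARD('n) h a b) (stress2 CARD('n) h a b) (x /\<^sub>R norm x)"
    unfolding grad_x_radial_map[where w=W and t=t and x=x and a=a, OF assms(1,2)] assms(3)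
    by (rule stress_radial_matrix[OF u assms(4-7)])
  show ?thesis
    unfolding weak_integrand_def S inner_radial_matrix d_tt_eq[OF assms(8)] grad_x_eq[OF assms(8)]
    by (simp add: wform_def radial_map_def divide_inverse)
qed

text \<open>The entries of the gradient are at most K and the components of u at most 1 in modulus,
  so with N the dimension both the quadratic form and the trace are at most N^2 K.\<close>

lemma wform_bound:
  fixes \<psi> :: "(real^'n) \<times> real \<Rightarrow> real^'n"
  assumes K: "norm (psi_tt \<psi> z) \<le> K" "\<And>j. norm (dd \<psi> (axis j 1, 0) z) \<le> K"
  shows "\<bar>wform m p q \<psi> z\<bar> \<le> 2 * real CARD('n) ^ 2 * K * (\<bar>m\<bar> + \<bar>p\<bar> + \<bar>q\<bar>)"
proof -
  let ?N = "real CARD('n)" and ?u = "fst z /\<^sub>R norm (fst z)" and ?G = "psi_grad \<psi> z"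
  have K0: "K \<ge> 0" using K(1) norm_ge_zero order_trans by blast
  have N: "?N \<ge> 1" by simp
  have N2: "?N \<le> ?N\<^sup>2" "1 \<le> ?N\<^sup>2"
    by (rule self_le_power[OF N], simp) (rule one_le_power[OF N])
  have G: "\<bar>?G $ i $ j\<bar> \<le> K" for i j
    using component_le_norm_cart[of "dd \<psi> (axis j 1, 0) z" i] K(2)[of j] by (simp add: psi_grad_def)
  have "norm ?u \<le> 1" by (cases "fst z = 0") auto
  then have u: "\<bar>?u $ i\<bar> \<le> 1" for i using component_le_norm_cart[of ?u i] by linarith
  have 1: "\<bar>m / norm (fst z) * (fst z \<bullet> psi_tt \<psi> z)\<bar> \<le> \<bar>m\<bar> * K"
  proof (cases "fst z = 0")
    case False
    have "\<bar>fst z \<bullet> psi_tt \<psi> z\<bar> \<le> norm (fst z) * K"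
      using Cauchy_Schwarz_ineq2[of "fst z" "psi_tt \<psi> z"] K(1) 
      by (meson mult_left_mono norm_ge_zero order_trans)
    then have "\<bar>m\<bar> / norm (fst z) * \<bar>fst z \<bullet> psi_tt \<psi> z\<bar> \<le> \<bar>m\<bar> / norm (fst z) * (norm (fst z) * K)"
      by (intro mult_left_mono) auto
    then show ?thesis using False by (simp add: abs_mult)
  qed (use K0 in simp)
  have "?u \<bullet> (?G *v ?u) = (\<Sum>i\<in>UNIV. \<Sum>j\<in>UNIV. ?u $ i * (?G $ i $ j * ?u $ j))"
    unfolding inner_vec_def matrix_vector_mult_def by (simp add: sum_distrib_left)
  also have "\<bar>\<dots>\<bar> \<le> (\<Sum>i\<in>(UNIV::'n set). \<Sum>j\<in>(UNIV::'n set). K)"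
  proof (rule order_trans[OF sum_abs], rule sum_mono, rule order_trans[OF sum_abs], rule sum_mono)
    fix i j
    have "\<bar>?u $ i\<bar> * (\<bar>?G $ i $ j\<bar> * \<bar>?u $ j\<bar>) \<le> 1 * (K * 1)"
      using G[of i j] u[of i] u[of j] K0 by (intro mult_mono) auto
    then show "\<bar>?u $ i * (?G $ i $ j * ?u $ j)\<bar> \<le> K" by (simp only: abs_mult mult_1 mult_1_right)
  qed
  also have "\<dots> = ?N\<^sup>2 * K" by (simp add: power2_eq_square)
  finally have 2: "\<bar>?u \<bullet> (?G *v ?u)\<bar> \<le> ?N\<^sup>2 * K" .
  have "\<bar>trace ?G\<bar> \<le> (\<Sum>i\<in>(UNIV::'n set). K)"
    unfolding trace_def by (rule order_trans[OF sum_abs]) (intro sum_mono G)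
  also have "\<dots> \<le> ?N\<^sup>2 * K" using mult_right_mono[OF N2(1) K0] by simp
  finally have 3: "\<bar>trace ?G\<bar> \<le> ?N\<^sup>2 * K" .
  have "\<bar>wform m p q \<psi> z\<bar> \<le> \<bar>m\<bar> * K + \<bar>p - q\<bar> * (?N\<^sup>2 * K) + \<bar>q\<bar> * (?N\<^sup>2 * K)"
  proof -
    have tri: "\<bar>a + b + c\<bar> \<le> \<bar>a\<bar> + \<bar>b\<bar> + \<bar>c\<bar>" for a b c :: real by linarith
    have A: "\<bar>(p - q) * (?u \<bullet> (?G *v ?u))\<bar> \<le> \<bar>p - q\<bar> * (?N\<^sup>2 * K)"
      unfolding abs_mult using 2 by (intro mult_left_mono) auto
    have B: "\<bar>q * trace ?G\<bar> \<le> \<bar>q\<bar> * (?N\<^sup>2 * K)"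
      unfolding abs_mult using 3 by (intro mult_left_mono) auto
    show ?thesis unfolding wform_def by (rule order_trans[OF tri add_mono[OF add_mono[OF 1 A] B]])
  qed
  also have "\<dots> \<le> \<bar>m\<bar> * (?N\<^sup>2 * K) + (\<bar>p\<bar> + \<bar>q\<bar>) * (?N\<^sup>2 * K) + \<bar>q\<bar> * (?N\<^sup>2 * K)"
    using mult_right_mono[OF N2(2) K0] K0 by (intro add_mono mult_left_mono mult_right_mono) auto
  also have "\<dots> = ?N\<^sup>2 * K * (\<bar>m\<bar> + \<bar>p\<bar> + 2 * \<bar>q\<bar>)" by (simp add: algebra_simps)
  also have "\<dots> \<le> ?N\<^sup>2 * K * (2 * (\<bar>m\<bar> + \<bar>p\<bar> + \<bar>q\<bar>))"
    using K0 by (intro mult_left_mono) auto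
  finally show ?thesis by (simp add: algebra_simps)
qed

lemma wform_eq_0:
  assumes "psi_tt \<psi> z = 0" "\<And>j. dd \<psi> (axis j 1, 0) z = 0"
  shows "wform m p q \<psi> z = 0"
  using wform_bound[of \<psi> z 0 m p q] assms by simp

lemma psi_borel:
  fixes \<psi> :: "(real^'n) \<times> real \<Rightarrow> real^'n"
  assumes "Ck 2 \<psi>"
  shows "psi_tt \<psi> \<in> borel_measurable borel" "(\<lambda>z. psi_grad \<psi> z $ i $ j) \<in> borel_measurable borel"
proof -
  have S2: "Ck (Suc (Suc 0)) \<psi>" using assms by (simp add: numeral_2_eq_2)
  show "psi_tt \<psi> \<in> borel_measurable borel" unfolding psi_tt_def
    by (rule borel_measurable_continuous_onI[OF Ck_continuous[OF Ck_dd[OF Ck_dd[OF S2]]]])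
  have "(\<lambda>z. dd \<psi> (axis j 1, 0) z $ i) \<in> borel_measurable borel"
    by (rule borel_measurable_continuous_onI[OF continuous_on_component[OF Ck_continuous[OF Ck_dd[OF S2]]]])
  then show "(\<lambda>z. psi_grad \<psi> z $ i $ j) \<in> borel_measurable borel"
    by (simp add: psi_grad_def)
qed

lemma wform_borel:
  fixes \<psi> :: "(real^'n) \<times> real \<Rightarrow> real^'n"
  assumes \<psi>: "Ck 2 \<psi>" and [measurable]: "m \<in> borel_measurable borel" "p \<in> borel_measurable borel" "q \<in> borel_measurable borel"
  shows "(\<lambda>z. wform (m z) (p z) (q z) \<psi> z) \<in> borel_measurable borel"
proof -
  note [measurable] = psi_borel[OF \<psi>]
  have [measurable]: "(\<lambda>z::(real^'n) \<times> real. fst z) \<in> borel_measurable borel"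
    by (rule borel_measurable_continuous_onI) (intro continuous_intros)
  have [measurable]: "(\<lambda>z::(real^'n) \<times> real. fst z $ i) \<in> borel_measurable borel" for i
    by (rule borel_measurable_continuous_onI) (intro continuous_intros)
  have "(fst z /\<^sub>R norm (fst z)) \<bullet> (psi_grad \<psi> z *v (fst z /\<^sub>R norm (fst z))) =
     (\<Sum>i\<in>UNIV. \<Sum>j\<in>UNIV. inverse (norm (fst z)) * fst z $ i * (psi_grad \<psi> z $ i $ j * (inverse (norm (fst z)) * fst z $ j)))" for z
    by (simp add: inner_vec_def matrix_vector_mult_def sum_distrib_left)
  then have "(\<lambda>z. (fst z /\<^sub>R norm (fst z)) \<bullet> (psi_grad \<psi> z *v (fst z /\<^sub>R norm (fst z)))) \<in> borel_measurable borel"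
    by simp
  moreover have "(\<lambda>z. trace (psi_grad \<psi> z)) \<in> borel_measurable borel" unfolding trace_def by measurable
  ultimately show ?thesis unfolding wform_def by measurable
qed

lemma test_function_bounds:
  fixes \<psi> :: "(real^'n) \<times> real \<Rightarrow> real^'n"
  assumes \<psi>: "Ck 2 \<psi>" and supp: "compactly_supported \<psi>"
  obtains K R where "K > 0" "R > 0" "\<And>z. norm (psi_tt \<psi> z) \<le> K" "\<And>j z. norm (dd \<psi> (axis j 1, 0) z) \<le> K"
    "\<And>z m p q. norm z > R \<Longrightarrow> wform m p q \<psi> z = 0"
proof -
  have S2: "Ck (Suc (Suc 0)) \<psi>" using \<psi> by (simp add: numeral_2_eq_2)
  obtain R where R: "R > 0" and z0: "\<And>z. norm z > R \<Longrightarrow> \<psi> z = 0"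
    using compactly_supportedD[OF supp] by blast
  have z1: "dd \<psi> v z = 0" if "norm z > R" for v z
    by (rule dd_eq_0_outside[of R]) (use z0 that in auto)
  have z2: "dd (dd \<psi> v) v' z = 0" if "norm z > R" for v v' z
    by (rule dd_eq_0_outside[of R]) (use z1 that in auto)
  have "\<exists>K>0. \<forall>z. norm (psi_tt \<psi> z) \<le> K" unfolding psi_tt_def
    by (rule continuous_zero_outside_bounded[OF Ck_continuous[OF Ck_dd[OF Ck_dd[OF S2]]]]) (rule z2)
  then obtain K1 where K1: "K1 > 0" "\<And>z. norm (psi_tt \<psi> z) \<le> K1" by blast
  have "\<forall>j. \<exists>K>0. \<forall>z. norm (dd \<psi> (axis j 1, 0) z) \<le> K"
    by (intro allI continuous_zero_outside_bounded[OF Ck_continuous[OF Ck_dd[OF S2]]]) (rule z1)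
  from choice[OF this] obtain K2 where K2: "\<And>j. K2 j > 0" "\<And>j z. norm (dd \<psi> (axis (j::'n) 1, 0) z) \<le> K2 j" by blast
  define K where "K = K1 + (\<Sum>j\<in>UNIV. K2 j)"
  have K2le: "K2 j \<le> (\<Sum>j\<in>UNIV. K2 j)" for j by (rule member_le_sum) (use K2(1) in \<open>auto intro: less_imp_le\<close>)
  have Kpos: "0 < (\<Sum>j\<in>UNIV. K2 j)" by (rule sum_pos) (use K2 in auto)
  show ?thesis
  proof (rule that[of K R])
    show "K > 0" "R > 0" using K1 Kpos R by (auto simp: K_def)
    show "norm (psi_tt \<psi> z) \<le> K" for z using K1(2)[of z] Kpos by (simp add: K_def)
    show "norm (dd \<psi> (axis j 1, 0) z) \<le> K" for j z using K2(2)[of j z] K2le[of j] K1(1) by (simp add: K_def)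
    show "wform m p q \<psi> z = 0" if "norm z > R" for z m p q
      by (rule wform_eq_0) (use z1[OF that] z2[OF that] in \<open>auto simp: psi_tt_def\<close>)
  qed
qed

section \<open>Stress along the cavitating solution\<close>

context cavitation
begin

lemma h_diff: "v > 0 \<Longrightarrow> h differentiable (at v)"
  using energy unfolding energy_function_def
  by (metis field_differentiable_imp_differentiable funpow_0 zero_less_numeral)

lemma deriv_h_deriv: "v > 0 \<Longrightarrow> (deriv h has_real_derivative deriv (deriv h) v) (at v)"
proof -
  assume v: "v > 0"
  have "\<forall>k<3. \<forall>v>0. (deriv ^^ k) h field_differentiable at v"
    using energy unfolding energy_function_def by blast
  from this[rule_format, of 1 v] have "(deriv ^^ 1) h field_differentiable at v" using v by simp
  then show ?thesis by (simp add: field_differentiable_derivI)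
qed

lemma deriv_h_mono: "0 < u \<Longrightarrow> u \<le> v \<Longrightarrow> deriv h u \<le> deriv h v"
proof -
  assume uv: "0 < u" "u \<le> v"
  show ?thesis
  proof (rule DERIV_nonneg_imp_nondecreasing[OF uv(2)])
    fix x assume "u \<le> x" "x \<le> v"
    then have x: "x > 0" using uv by simp
    have "(deriv ^^ 2) h x > 0" using energy x unfolding energy_function_def by blast
    then have "deriv (deriv h) x \<ge> 0" by (simp add: numeral_2_eq_2)
    then show "\<exists>y. (deriv h has_real_derivative y) (at x) \<and> 0 \<le> y" using deriv_h_deriv[OF x] by blast
  qed
qed

lemma isCont_deriv_h: "v > 0 \<Longrightarrow> isCont (deriv h) v"
  using deriv_h_deriv DERIV_isCont by blast

lemma deriv_h_abs: "0 < u \<Longrightarrow> u \<le> v \<Longrightarrow> v \<le> v' \<Longrightarrow> \<bar>deriv h v\<bar> \<le> \<bar>deriv h u\<bar> + \<bar>deriv h v'\<bar>"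
  using deriv_h_mono[of u v] deriv_h_mono[of v v'] by linarith

text \<open>\<open>deriv h\<close> is continuous on the positive half line; it is extended by 0
  before composing.\<close>

lemma deriv_h_borel:
  assumes [measurable]: "g \<in> borel_measurable N" and pos: "\<And>z. z \<in> space N \<Longrightarrow> g z > 0"
  shows "(\<lambda>z. deriv h (g z)) \<in> borel_measurable N"
proof -
  have "(\<lambda>v. if v \<in> {0<..} then deriv h v else 0) \<in> borel_measurable borel"
    by (rule borel_measurable_continuous_on_if)
      (auto intro!: continuous_at_imp_continuous_on isCont_deriv_h)
  then have "(\<lambda>z. if g z \<in> {0<..} then deriv h (g z) else 0) \<in> borel_measurable N"
    by (rule measurable_compose[OF assms(1)])
  then show ?thesis by (rule measurable_cong[THEN iffD1, rotated]) (use pos in auto)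
qed

lemma stress_borel:
  assumes [measurable]: "a \<in> borel_measurable N" "b \<in> borel_measurable N"
    and pos: "\<And>z. z \<in> space N \<Longrightarrow> a z * b z ^ (d - 1) > 0"
  shows "(\<lambda>z. stress1 d h (a z) (b z)) \<in> borel_measurable N" "(\<lambda>z. stress2 d h (a z) (b z)) \<in> borel_measurable N"
proof -
  have [measurable]: "(\<lambda>z. deriv h (a z * b z ^ (d - 1))) \<in> borel_measurable N"
    by (rule deriv_h_borel) (use pos in auto)
  show "(\<lambda>z. stress1 d h (a z) (b z)) \<in> borel_measurable N" "(\<lambda>z. stress2 d h (a z) (b z)) \<in> borel_measurable N"
    unfolding stress1_def stress2_def by measurable
qed

lemma stress_tendsto:
  assumes a: "(a \<longlongrightarrow> a0) F" and b: "(b \<longlongrightarrow> b0) F" and pos: "a0 * b0 ^ (d - 1) > 0"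
  shows "((\<lambda>z. stress1 d h (a z) (b z)) \<longlongrightarrow> stress1 d h a0 b0) F"
    "((\<lambda>z. stress2 d h (a z) (b z)) \<longlongrightarrow> stress2 d h a0 b0) F"
proof -
  have "((\<lambda>z. deriv h (a z * b z ^ (d - 1))) \<longlongrightarrow> deriv h (a0 * b0 ^ (d - 1))) F"
    by (rule isCont_tendsto_compose[OF isCont_deriv_h[OF pos]]) (intro tendsto_intros a b)
  then show "((\<lambda>z. stress1 d h (a z) (b z)) \<longlongrightarrow> stress1 d h a0 b0) F"
    "((\<lambda>z. stress2 d h (a z) (b z)) \<longlongrightarrow> stress2 d h a0 b0) F"
    unfolding stress1_def stress2_def by (intro tendsto_intros a b; assumption)+
qed

lemma inverse_power_le: "(s::real) > 0 \<Longrightarrow> k \<le> m \<Longrightarrow> (1 / s) ^ k \<le> 1 + 1 / s ^ m"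
proof (cases "1 / s \<le> 1")
  case True
  assume "s > 0"
  then have "(1 / s) ^ k \<le> 1" using True by (intro power_le_one) auto
  then show ?thesis using \<open>s > 0\<close> by (smt (verit) divide_nonneg_nonneg zero_le_power)
next
  case False
  assume "s > 0" "k \<le> m"
  then have "(1 / s) ^ k \<le> (1 / s) ^ m" using False by (intro power_increasing) auto
  then show ?thesis by (simp add: power_one_over)
qed

text \<open>Each term contains b <= \<beta>/s to a power of at most d - 1. With h' bounded, this
  produces the singularity |x|^(1-d) of the majorant.\<close>

lemma stress_bound:
  assumes a: "0 \<le> a" "a \<le> \<alpha>" and b: "0 \<le> b" "b \<le> \<beta> / s" and s: "s > 0" and \<beta>: "\<beta> \<ge> 0"
    and \<gamma>: "\<bar>deriv h (a * b ^ (d - 1))\<bar> \<le> \<gamma>"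
  shows "\<bar>stress1 d h a b\<bar> + \<bar>stress2 d h a b\<bar> \<le>
    (\<alpha> + \<beta> ^ (d - 1) * \<gamma> + \<beta> + \<alpha> * \<beta> ^ (d - 2) * \<gamma>) * (1 + 1 / s ^ (d - 1))"
proof -
  let ?S = "1 + 1 / s ^ (d - 1)"
  have bk: "b ^ k \<le> \<beta> ^ k * ?S" if "k \<le> d - 1" for k
  proof -
    have "b ^ k \<le> (\<beta> / s) ^ k" using b by (intro power_mono) auto
    also have "\<dots> = \<beta> ^ k * (1 / s) ^ k" by (simp add: power_divide)
    also have "\<dots> \<le> \<beta> ^ k * ?S" using inverse_power_le[OF s that] \<beta> by (intro mult_left_mono) auto
    finally show ?thesis .
  qed
  have S1: "?S \<ge> 1" using s by simp
  have 1: "b ^ (d - 1) * \<bar>deriv h (a * b ^ (d - 1))\<bar> \<le> \<beta> ^ (d - 1) * ?S * \<gamma>"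
    using bk[of "d - 1"] \<gamma> b \<beta> S1 by (intro mult_mono) auto
  have 2: "b \<le> \<beta> * ?S" using bk[of 1] d3 by simp
  have 3: "a * b ^ (d - 2) * \<bar>deriv h (a * b ^ (d - 1))\<bar> \<le> \<alpha> * (\<beta> ^ (d - 2) * ?S) * \<gamma>"
    using bk[of "d - 2"] \<gamma> a b \<beta> S1 by (intro mult_mono) auto
  have 4: "a \<le> \<alpha> * ?S" using mult_mono[OF a(2) S1] a S1 by simp
  have "\<bar>stress1 d h a b\<bar> \<le> a + b ^ (d - 1) * \<bar>deriv h (a * b ^ (d - 1))\<bar>"
    unfolding stress1_def using a b by (intro order_trans[OF abs_triangle_ineq]) (simp add: abs_mult)
  moreover have "\<bar>stress2 d h a b\<bar> \<le> b + a * b ^ (d - 2) * \<bar>deriv h (a * b ^ (d - 1))\<bar>"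
    unfolding stress2_def using a b by (intro order_trans[OF abs_triangle_ineq]) (simp add: abs_mult)
  ultimately have "\<bar>stress1 d h a b\<bar> + \<bar>stress2 d h a b\<bar> \<le>
     \<alpha> * ?S + \<beta> ^ (d - 1) * ?S * \<gamma> + \<beta> * ?S + \<alpha> * (\<beta> ^ (d - 2) * ?S) * \<gamma>"
    using 1 2 3 4 by linarith
  then show ?thesis by (simp add: algebra_simps)
qed

text \<open>A Borel version of \<open>dw\<close>: both agree for R > 0, while for R <= 0 the value
  lam replaces the derivative of r at arguments where it is not controlled.\<close>

definition sol_stretch :: "real \<Rightarrow> real \<Rightarrow> real" where
  "sol_stretch R t = (if t > 0 then (if R / t \<in> {0<..<\<sigma>} then deriv r (R / t) else lam) else lam)"

lemma sol_stretch_eq: "R > 0 \<Longrightarrow> sol_stretch R t = dw R t"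
  by (simp add: sol_stretch_def dw_def dr_def)

lemma sol_stretch_borel: "(\<lambda>p. sol_stretch (fst p) (snd p)) \<in> borel_measurable (borel \<Otimes>\<^sub>M borel)"
proof -
  have [measurable]: "(\<lambda>s. if s \<in> {0<..<\<sigma>} then deriv r s else lam) \<in> borel_measurable borel"
    by (rule borel_measurable_continuous_on_if)
      (auto intro!: continuous_at_imp_continuous_on field_differentiable_imp_continuous_at dr_diff)
  show ?thesis unfolding sol_stretch_def by measurable
qed

lemma dw_det:
  assumes R: "R > 0"
  shows "H \<le> dw R t * (w R t / R) ^ (d - 1)" "dw R t * (w R t / R) ^ (d - 1) \<le> lam ^ d" "dw R t > 0"
proof -
  note e = lam_power
  have *: "H \<le> dw R t * (w R t / R) ^ (d - 1) \<and> dw R t * (w R t / R) ^ (d - 1) \<le> lam ^ d"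
  proof (cases "t > 0")
    case True
    define s where "s = R / t"
    have s: "s > 0" "w R t / R = r s / s" "dw R t = dr s" using True R by (auto simp: s_def w_def dw_def field_simps)
    have rs: "r s > 0" using r_pos[of s] s by simp
    have i: "(s / r s) ^ (d - 1) * (r s / s) ^ (d - 1) = 1"
      using rs s by (simp add: power_mult_distrib[symmetric])
    have "H * (s / r s) ^ (d - 1) * (r s / s) ^ (d - 1) \<le> dr s * (r s / s) ^ (d - 1) \<and>
       dr s * (r s / s) ^ (d - 1) \<le> lam ^ d * (s / r s) ^ (d - 1) * (r s / s) ^ (d - 1)"
      using dr_eq[OF s(1)] rs s(1) by (intro conjI mult_right_mono) auto
    then show ?thesis unfolding s(2,3) mult.assoc i by simp
  next
    case False
    then show ?thesis using R H_le e by (simp add: dw_def w_def)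
  qed
  then show "H \<le> dw R t * (w R t / R) ^ (d - 1)" "dw R t * (w R t / R) ^ (d - 1) \<le> lam ^ d" by auto
  show "dw R t > 0"
  proof (rule ccontr)
    assume "\<not> dw R t > 0"
    then have "dw R t = 0" using dw_bounds[OF R, of t] by linarith
    then show False using * H d3 by simp
  qed
qed

lemma cavitating_map_eq: "cavitating_map lam r = (radial_map w :: real^'n \<Rightarrow> real \<Rightarrow> real^'n)"
  by (intro ext) (auto simp: cavitating_map_def radial_map_def w_def)

definition sol_density :: "((real^'n) \<times> real \<Rightarrow> real^'n) \<Rightarrow> (real^'n) \<times> real \<Rightarrow> real" where
  "sol_density \<psi> z = (let R = norm (fst z); t = snd z; b = w R t / R in
     wform (w R t) (stress1 d h (sol_stretch R t) b) (stress2 d h (sol_stretch R t) b) \<psi> z)"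

text \<open>The origin and the shock cone, off which the radial gradient formula applies. The same
  set serves the solution and its averages.\<close>

definition singular_set :: "((real^'n) \<times> real) set" where
  "singular_set = {z. fst z = 0 \<or> norm (fst z) = \<sigma> * snd z}"

lemma singular_set_borel: "(singular_set :: ((real^'n) \<times> real) set) \<in> sets borel"
proof -
  have "closed (singular_set :: ((real^'n) \<times> real) set)"
    unfolding singular_set_def by (intro closed_Collect_disj closed_Collect_eq continuous_intros)
  then show ?thesis by simp
qed

lemma singular_set_section: "emeasure lborel {x::real^'n. (x, t) \<in> singular_set} = 0"
proof -
  have "{x::real^'n. (x, t) \<in> singular_set} = {0} \<union> sphere 0 (\<sigma> * t)"
    by (auto simp: singular_set_def)
  moreover have "negligible ({0} \<union> sphere 0 (\<sigma> * t) :: (real^'n) set)"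
    by (intro negligible_Un negligible_sing negligible_sphere)
  ultimately have "negligible {x::real^'n. (x, t) \<in> singular_set}" by simp
  moreover have "closed ({0} \<union> sphere 0 (\<sigma> * t) :: (real^'n) set)" by auto
  ultimately show ?thesis
    using \<open>{x::real^'n. (x, t) \<in> singular_set} = _\<close>
    by (metis borel_closed negligible_iff_emeasure0 sets_lborel emeasure_completion fmeasurableD null_setsD1 null_sets_completion_iff negligible_iff_null_sets)
qed

lemma singular_AE: "AE z in lborel. z \<notin> (singular_set :: ((real^'n) \<times> real) set)"
  by (rule AE_not_in[OF lborel_null_by_sections[OF singular_set_borel singular_set_section]])

lemma weak_integrand_sol:
  fixes x :: "real^'n"
  assumes dn: "d = CARD('n)" and \<psi>: "Ck 2 \<psi>" and z: "(x, t) \<notin> singular_set"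
  shows "weak_integrand h (cavitating_map lam r) \<psi> x t = sol_density \<psi> (x, t)"
proof -
  have x: "x \<noteq> 0" "norm x > 0" "norm x \<noteq> \<sigma> * t" using z by (auto simp: singular_set_def)
  have "weak_integrand h (radial_map w) \<psi> x t = wform (w (norm x) t)
     (stress1 CARD('n) h (dw (norm x) t) (w (norm x) t / norm x))
     (stress2 CARD('n) h (dw (norm x) t) (w (norm x) t / norm x)) \<psi> (x, t)"
  proof (rule weak_integrand_radial[where W=w and t=t, OF x(1) w_deriv[OF x(2,3)] refl])
    show "dw (norm x) t > 0" by (rule dw_det(3)[OF x(2)])
    show "w (norm x) t / norm x > 0" using w_pos[OF x(2), of t] x(2) by simp
  qed (use d3 dn h_diff \<psi> in auto)
  then show ?thesis
    unfolding cavitating_map_eq sol_density_def Let_def by (simp add: sol_stretch_eq[OF x(2)] dn[symmetric])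
qed

lemma norm_time_measurable: "(\<lambda>z::(real^'n) \<times> real. (c * norm (fst z), c * snd z)) \<in> borel \<rightarrow>\<^sub>M (borel \<Otimes>\<^sub>M borel)"
proof -
  have "(\<lambda>z::(real^'n) \<times> real. (c * norm (fst z), c * snd z)) \<in> borel \<rightarrow>\<^sub>M borel"
    by (intro borel_measurable_continuous_onI continuous_intros)
  then show ?thesis by (simp add: borel_prod)
qed

text \<open>Off the origin the coefficients are positive; at the origin they are junk, which the
  indicator removes.\<close>
lemma sol_density_borel:
  fixes \<psi> :: "(real^'n) \<times> real \<Rightarrow> real^'n"
  assumes \<psi>: "Ck 2 \<psi>"
  shows "(\<lambda>z. if fst z = 0 then 0 else sol_density \<psi> z) \<in> borel_measurable borel"
proof -
  let ?R = "\<lambda>z::(real^'n) \<times> real. norm (fst z)"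
  let ?b = "\<lambda>z. if fst z = 0 then 1 else w (?R z) (snd z) / ?R z"
  let ?a = "\<lambda>z. if fst z = 0 then 1 else sol_stretch (?R z) (snd z)"
  have Z: "{z \<in> space borel. fst z = (0::real^'n)} \<in> sets (borel :: ((real^'n) \<times> real) measure)"
  proof -
    have "closed {z::(real^'n) \<times> real. fst z = 0}" by (intro closed_Collect_eq continuous_intros)
    then show ?thesis by simp
  qed
  have wm: "(\<lambda>z. w (?R z) (snd z)) \<in> borel_measurable borel"
    using measurable_compose[OF norm_time_measurable[of 1] w_abs_borel] by simp
  have am: "(\<lambda>z. sol_stretch (?R z) (snd z)) \<in> borel_measurable borel"
    using measurable_compose[OF norm_time_measurable[of 1] sol_stretch_borel] by simp
  have Rm: "?R \<in> borel_measurable borel" by (intro borel_measurable_continuous_onI continuous_intros)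
  have am': "?a \<in> borel_measurable borel" and bm': "?b \<in> borel_measurable borel"
    by (intro measurable_If am wm Rm borel_measurable_divide Z borel_measurable_const)+
  have pos: "?a z * ?b z ^ (d - 1) > 0" for z :: "(real^'n) \<times> real"
  proof (cases "fst z = 0")
    case False
    then have "?R z > 0" by simp
    then show ?thesis using dw_det(1)[of "?R z" "snd z"] H False by (simp add: sol_stretch_eq)
  qed simp
  have "(\<lambda>z. wform (w (?R z) (snd z)) (stress1 d h (?a z) (?b z)) (stress2 d h (?a z) (?b z)) \<psi> z) \<in> borel_measurable borel"
    by (intro wform_borel \<psi> wm stress_borel am' bm' pos)
  then have "(\<lambda>z. if fst z = 0 then 0 else wform (w (?R z) (snd z)) (stress1 d h (?a z) (?b z)) (stress2 d h (?a z) (?b z)) \<psi> z) \<in> borel_measurable borel"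
    by (intro measurable_If Z borel_measurable_const)
  also have "(\<lambda>z. if fst z = 0 then 0 else wform (w (?R z) (snd z)) (stress1 d h (?a z) (?b z)) (stress2 d h (?a z) (?b z)) \<psi> z)
     = (\<lambda>z. if fst z = 0 then 0 else sol_density \<psi> z)"
    by (auto simp: sol_density_def Let_def fun_eq_iff)
  finally show ?thesis .
qed

text \<open>Along the solution v stays in [H, lam^d], so h' is bounded, and w is bounded on the
  cylinder, so w/R is at most \<open>\<beta> / R\<close>.\<close>

lemma sol_density_bound:
  obtains C where "C > 0" "\<And>R t. 0 < R \<Longrightarrow> R \<le> \<rho> \<Longrightarrow> \<bar>t\<bar> \<le> \<rho> \<Longrightarrow>
    \<bar>w R t\<bar> + \<bar>stress1 d h (sol_stretch R t) (w R t / R)\<bar> + \<bar>stress2 d h (sol_stretch R t) (w R t / R)\<bar> \<le> C * (1 + 1 / R ^ (d - 1))"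
proof -
  define \<gamma> where "\<gamma> = \<bar>deriv h H\<bar> + \<bar>deriv h (lam ^ d)\<bar>"
  define \<beta> where "\<beta> = \<bar>\<rho>\<bar> * c0 + lam * \<bar>\<rho>\<bar>"
  define C where "C = 1 + \<beta> + (lam + \<beta> ^ (d - 1) * \<gamma> + \<beta> + lam * \<beta> ^ (d - 2) * \<gamma>)"
  have nn: "\<gamma> \<ge> 0" "\<beta> \<ge> 0" using c0 lam by (auto simp: \<gamma>_def \<beta>_def)
  show ?thesis
  proof (rule that[of C])
    have "0 \<le> lam + \<beta> ^ (d - 1) * \<gamma> + \<beta> + lam * \<beta> ^ (d - 2) * \<gamma>" using nn lam by (intro add_nonneg_nonneg mult_nonneg_nonneg) auto
    then show "C > 0" using nn by (simp add: C_def)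
    fix R t :: real assume R: "0 < R" "R \<le> \<rho>" "\<bar>t\<bar> \<le> \<rho>"
    have "T0 t \<le> \<bar>\<rho>\<bar> * c0" unfolding T0_def using R c0 by (intro mult_right_mono) auto
    moreover have "lam * R \<le> lam * \<bar>\<rho>\<bar>" using R lam by (intro mult_left_mono) auto
    ultimately have w: "w R t \<le> \<beta>" "0 < w R t" using w_bounds(2)[of R t] w_pos[of R t] R by (auto simp: \<beta>_def)
    have "\<bar>stress1 d h (sol_stretch R t) (w R t / R)\<bar> + \<bar>stress2 d h (sol_stretch R t) (w R t / R)\<bar>
       \<le> (lam + \<beta> ^ (d - 1) * \<gamma> + \<beta> + lam * \<beta> ^ (d - 2) * \<gamma>) * (1 + 1 / R ^ (d - 1))"
    proof (rule stress_bound)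
      show "0 \<le> sol_stretch R t" "sol_stretch R t \<le> lam" using dw_bounds[OF R(1), of t] by (auto simp: sol_stretch_eq R)
      show "w R t / R \<le> \<beta> / R" using w R by (intro divide_right_mono) auto
      show "\<bar>deriv h (sol_stretch R t * (w R t / R) ^ (d - 1))\<bar> \<le> \<gamma>"
        unfolding sol_stretch_eq[OF R(1)] \<gamma>_def by (rule deriv_h_abs[OF H dw_det(1,2)[OF R(1)]])
    qed (use R w nn in auto)
    moreover have "\<bar>w R t\<bar> \<le> (1 + \<beta>) * (1 + 1 / R ^ (d - 1))"
    proof -
      have "(1 + \<beta>) * 1 \<le> (1 + \<beta>) * (1 + 1 / R ^ (d - 1))" using nn R by (intro mult_left_mono) auto
      moreover have "w R t \<le> (1 + \<beta>) * 1" using w by simp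
      ultimately have "w R t \<le> (1 + \<beta>) * (1 + 1 / R ^ (d - 1))" by (rule order_trans[rotated])
      then show ?thesis using w(2) by (simp only: abs_of_pos)
    qed
    ultimately show "\<bar>w R t\<bar> + \<bar>stress1 d h (sol_stretch R t) (w R t / R)\<bar> + \<bar>stress2 d h (sol_stretch R t) (w R t / R)\<bar> \<le> C * (1 + 1 / R ^ (d - 1))"
      unfolding C_def by (simp add: distrib_right)
  qed
qed

end

section \<open>Stress along the averaged maps\<close>

context averaging
begin

lemma averaged_deriv:
  assumes w': "\<And>R'. R' > 0 \<Longrightarrow> w' R' t = w R' t" and n: "n \<ge> 1"
  shows "((\<lambda>R. averaged \<phi> n w' R t) has_real_derivative A (real n * R) (real n * t)) (at R)"
proof -
  have n0: "real n > 0" using n by simp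
  have "((\<lambda>R. real n * R) has_real_derivative real n) (at R)" by (auto intro!: derivative_eq_intros)
  then have "((\<lambda>R. M (real n * R) (real n * t)) has_real_derivative A (real n * R) (real n * t) * real n) (at R)"
    by (rule DERIV_chain2[where g="\<lambda>R. real n * R" and x=R, OF M_deriv])
  then have "((\<lambda>R. M (real n * R) (real n * t) / real n) has_real_derivative A (real n * R) (real n * t) * real n / real n) (at R)"
    by (rule DERIV_cdivide)
  then show ?thesis using n0 by (simp add: averaged_eq[where w'=w' and t=t, OF w' n])
qed

lemma averaged_quotient:
  assumes w': "\<And>R'. R' > 0 \<Longrightarrow> w' R' t = w R' t" and n: "n \<ge> 1" and R: "R > 0"
  shows "averaged \<phi> n w' R t / R = B (real n * R) (real n * t)"
  using n R by (simp add: averaged_eq[where w'=w' and t=t, OF w' n] B_def)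

lemma averaged_quotient_tendsto:
  assumes w': "\<And>R'. R' > 0 \<Longrightarrow> w' R' t = w R' t" and n: "n \<ge> 1"
  shows "((\<lambda>R. averaged \<phi> n w' R t / R) \<longlongrightarrow> B 0 (real n * t)) (at_right 0)"
proof -
  have n0: "real n > 0" using n by simp
  have f: "filterlim (\<lambda>R. real n * R) (at_right 0) (at_right 0)"
    unfolding filterlim_at using n0 by (auto intro!: tendsto_eq_intros simp: eventually_at_filter)
  show ?thesis
    by (rule Lim_transform_eventually[OF filterlim_compose[OF B_tendsto f]])
      (use n0 in \<open>auto simp: averaged_eq[where w'=w' and t=t, OF w' n] eventually_at_filter\<close>)
qed

text \<open>At the origin the gradient is a multiple of the identity, and the formula persists
  because A and B coincide there.\<close>

lemma det_averaged:
  fixes x :: "real^'n"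
  assumes dn: "d = CARD('n)" and w': "\<And>R'. R' > 0 \<Longrightarrow> w' R' t = w R' t" and n: "n \<ge> 1"
  shows "det (grad_x (radial_map (averaged \<phi> n w')) x t) =
     A (real n * norm x) (real n * t) * B (real n * norm x) (real n * t) ^ (d - 1)"
proof (cases "x = 0")
  case True
  have "grad_x (radial_map (averaged \<phi> n w')) x t = mat (B 0 (real n * t))"
    unfolding True by (rule grad_x_radial_map_0) (rule averaged_quotient_tendsto[where w'=w' and t=t, OF w' n])
  moreover have "det (mat a :: real^'n^'n) = a * a ^ (d - 1)" for a
  proof -
    have "det (mat a :: real^'n^'n) = a ^ CARD('n)" by (subst det_diagonal) (auto simp: mat_def)
    then show ?thesis using dn d3 by (simp add: power_eq_if)
  qed
  ultimately show ?thesis using True by (simp add: B_def)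
next
  case False
  then have R: "norm x > 0" by simp
  have "grad_x (radial_map (averaged \<phi> n w')) x t =
     radial_matrix (A (real n * norm x) (real n * t)) (averaged \<phi> n w' (norm x) t / norm x) (x /\<^sub>R norm x)"
    by (rule grad_x_radial_map[where w="averaged \<phi> n w'" and t=t, OF False averaged_deriv[where w'=w' and t=t, OF w' n]])
  then have g: "grad_x (radial_map (averaged \<phi> n w')) x t =
     radial_matrix (A (real n * norm x) (real n * t)) (B (real n * norm x) (real n * t)) (x /\<^sub>R norm x)"
    by (simp only: averaged_quotient[where w'=w' and t=t, OF w' n R])
  show ?thesis unfolding g using det_radial_matrix[of "x /\<^sub>R norm x"] False dn by simp
qed

definition avg_density :: "nat \<Rightarrow> ((real^'n) \<times> real \<Rightarrow> real^'n) \<Rightarrow> (real^'n) \<times> real \<Rightarrow> real" where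
  "avg_density n \<psi> z = (let R = real n * norm (fst z); t = real n * snd z in
     wform (M R t / real n) (stress1 d h (A R t) (B R t)) (stress2 d h (A R t) (B R t)) \<psi> z)"

lemma AB_pos: "R \<ge> 0 \<Longrightarrow> A R t > 0" "R \<ge> 0 \<Longrightarrow> B R t > 0"
  using det_lower by metis+

lemma weak_integrand_avg:
  fixes x :: "real^'n"
  assumes dn: "d = CARD('n)" and w': "\<And>R' t. R' > 0 \<Longrightarrow> w' R' t = w R' t" and n: "n \<ge> 1"
    and \<psi>: "Ck 2 \<psi>" and x: "x \<noteq> 0"
  shows "weak_integrand h (radial_map (averaged \<phi> n w')) \<psi> x t = avg_density n \<psi> (x, t)"
proof -
  have R: "norm x > 0" using x by simp
  have "weak_integrand h (radial_map (averaged \<phi> n w')) \<psi> x t =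
     wform (averaged \<phi> n w' (norm x) t)
      (stress1 CARD('n) h (A (real n * norm x) (real n * t)) (B (real n * norm x) (real n * t)))
      (stress2 CARD('n) h (A (real n * norm x) (real n * t)) (B (real n * norm x) (real n * t))) \<psi> (x, t)"
    by (rule weak_integrand_radial[where W="averaged \<phi> n w'" and t=t,
          OF x averaged_deriv[where w'=w' and t=t, OF w' n] averaged_quotient[where w'=w' and t=t, OF w' n R]])
      (use d3 dn h_diff \<psi> AB_pos in auto)
  then show ?thesis by (simp add: avg_density_def Let_def averaged_eq[where w'=w' and t=t, OF w' n] dn[symmetric])
qed

lemma avg_density_borel:
  fixes \<psi> :: "(real^'n) \<times> real \<Rightarrow> real^'n"
  assumes \<psi>: "Ck 2 \<psi>"
  shows "avg_density n \<psi> \<in> borel_measurable borel"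
proof -
  have m: "(\<lambda>z::(real^'n) \<times> real. M (real n * norm (fst z)) (real n * snd z)) \<in> borel_measurable borel"
    "(\<lambda>z::(real^'n) \<times> real. A (real n * norm (fst z)) (real n * snd z)) \<in> borel_measurable borel"
    "(\<lambda>z::(real^'n) \<times> real. B (real n * norm (fst z)) (real n * snd z)) \<in> borel_measurable borel"
    using measurable_compose[OF norm_time_measurable[of "real n"] M_borel]
      measurable_compose[OF norm_time_measurable[of "real n"] A_borel]
      measurable_compose[OF norm_time_measurable[of "real n"] B_borel] by simp_all
  have pos: "A (real n * norm (fst z)) (real n * snd z) * B (real n * norm (fst z)) (real n * snd z) ^ (d - 1) > 0"
    for z :: "(real^'n) \<times> real"
    using AB_pos[of "real n * norm (fst z)" "real n * snd z"] by simp
  show ?thesis unfolding avg_density_def[abs_def] Let_def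
    by (intro wform_borel \<psi> stress_borel borel_measurable_divide m pos borel_measurable_const)
qed

lemma T0_scale: "T0 (real n * t) = real n * T0 t"
  by (simp add: T0_def max_def zero_le_mult_iff mult_le_0_iff)

lemma T0_le: "\<bar>t\<bar> \<le> \<rho> \<Longrightarrow> T0 t \<le> \<rho> * c0"
  unfolding T0_def using c0 by (intro mult_right_mono) auto

lemma M_scaled_bound:
  assumes n: "n \<ge> 1" and R: "0 \<le> R" "R \<le> \<rho>" and t: "\<bar>t\<bar> \<le> \<rho>"
  shows "\<bar>M (real n * R) (real n * t) / real n\<bar> \<le> \<rho> * c0 + lam * (\<rho> + 1)"
proof -
  have n0: "real n \<ge> 1" using n by simp
  have "\<bar>M (real n * R) (real n * t)\<bar> \<le> real n * T0 t + lam * (real n * R + 1)"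
    using M_abs[of "real n * R" "real n * t"] R by (simp add: T0_scale)
  also have "\<dots> \<le> real n * (\<rho> * c0) + lam * (real n * \<rho> + real n * 1)"
    using T0_le[OF t] R n0 lam by (intro add_mono mult_left_mono) auto
  also have "\<dots> = (\<rho> * c0 + lam * (\<rho> + 1)) * real n" by (simp add: algebra_simps)
  finally show ?thesis using n0 by (simp add: abs_div divide_le_eq)
qed

text \<open>In \<open>AB_outer\<close> the bound for B contains T0(n t)/(n R), which homogeneity
  turns into T0(t)/R. Hence C does not depend on n.\<close>

lemma coefficients_outer_bound:
  obtains C where "C > 0" "\<And>n R t. n \<ge> 1 \<Longrightarrow> 3 \<le> real n * R \<Longrightarrow> R \<le> \<rho> \<Longrightarrow> \<bar>t\<bar> \<le> \<rho> \<Longrightarrow>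
    \<bar>M (real n * R) (real n * t) / real n\<bar>
     + \<bar>stress1 d h (A (real n * R) (real n * t)) (B (real n * R) (real n * t))\<bar>
     + \<bar>stress2 d h (A (real n * R) (real n * t)) (B (real n * R) (real n * t))\<bar> \<le> C * (1 + 1 / R ^ (d - 1))"
proof -
  define v0 where "v0 = H / 2 ^ (d - 1)"
  define v1 where "v1 = lam ^ d * (3 / 2) ^ (d - 1)"
  define \<gamma> where "\<gamma> = \<bar>deriv h v0\<bar> + \<bar>deriv h v1\<bar>"
  define \<beta> where "\<beta> = \<bar>\<rho>\<bar> * c0 + 3 / 2 * lam * \<bar>\<rho>\<bar>"
  define \<mu> where "\<mu> = \<bar>\<rho>\<bar> * c0 + lam * (\<bar>\<rho>\<bar> + 1)"
  define C where "C = 1 + \<mu> + (lam + \<beta> ^ (d - 1) * \<gamma> + \<beta> + lam * \<beta> ^ (d - 2) * \<gamma>)"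
  have nn: "\<gamma> \<ge> 0" "\<beta> \<ge> 0" "\<mu> \<ge> 0" using c0 lam by (auto simp: \<gamma>_def \<beta>_def \<mu>_def)
  have v0: "v0 > 0" using H by (simp add: v0_def)
  show ?thesis
  proof (rule that[of C])
    have "0 \<le> lam + \<beta> ^ (d - 1) * \<gamma> + \<beta> + lam * \<beta> ^ (d - 2) * \<gamma>" using nn lam by (intro add_nonneg_nonneg mult_nonneg_nonneg) auto
    then show "C > 0" using nn by (simp add: C_def)
    fix n :: nat and R t :: real assume n: "n \<ge> 1" and R: "3 \<le> real n * R" "R \<le> \<rho>" "\<bar>t\<bar> \<le> \<rho>"
    have n0: "real n > 0" using n by simp
    have R0: "R > 0"
    proof (rule ccontr)
      assume "\<not> R > 0"
      then have "real n * R \<le> 0" using n0 by (intro mult_nonneg_nonpos) auto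
      then show False using R by simp
    qed
    let ?a = "A (real n * R) (real n * t)" and ?b = "B (real n * R) (real n * t)"
    note out = AB_outer[OF R(1), of "real n * t"]
    have "\<bar>stress1 d h ?a ?b\<bar> + \<bar>stress2 d h ?a ?b\<bar>
       \<le> (lam + \<beta> ^ (d - 1) * \<gamma> + \<beta> + lam * \<beta> ^ (d - 2) * \<gamma>) * (1 + 1 / R ^ (d - 1))"
    proof (rule stress_bound)
      show "0 \<le> ?a" by (rule A_nonneg)
      show "?a \<le> lam" by (rule out(1))
      show "0 \<le> ?b" using out(3) by simp
      have "?b \<le> T0 t / R + 3 / 2 * lam" using out(2) n0 by (simp add: T0_scale)
      also have "\<dots> = (T0 t + 3 / 2 * lam * R) / R" using R0 by (simp add: add_divide_distrib)
      also have "\<dots> \<le> \<beta> / R"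
        unfolding \<beta>_def using T0_le[OF R(3)] R R0 lam by (intro divide_right_mono add_mono mult_left_mono) auto
      finally show "?b \<le> \<beta> / R" .
      show "\<bar>deriv h (?a * ?b ^ (d - 1))\<bar> \<le> \<gamma>"
        unfolding \<gamma>_def by (rule deriv_h_abs[OF v0]) (use out(4,5) in \<open>auto simp: v0_def v1_def\<close>)
    qed (use R0 nn in auto)
    moreover have "\<bar>M (real n * R) (real n * t) / real n\<bar> \<le> (1 + \<mu>) * (1 + 1 / R ^ (d - 1))"
    proof -
      have "\<bar>M (real n * R) (real n * t) / real n\<bar> \<le> (1 + \<mu>) * 1"
        using M_scaled_bound[OF n, of R \<rho> t] R R0 by (simp add: \<mu>_def)
      moreover have "(1 + \<mu>) * 1 \<le> (1 + \<mu>) * (1 + 1 / R ^ (d - 1))" using nn R0 by (intro mult_left_mono) auto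
      ultimately show ?thesis by (rule order_trans)
    qed
    ultimately show "\<bar>M (real n * R) (real n * t) / real n\<bar> + \<bar>stress1 d h ?a ?b\<bar> + \<bar>stress2 d h ?a ?b\<bar> \<le> C * (1 + 1 / R ^ (d - 1))"
      unfolding C_def by (simp add: distrib_right)
  qed
qed

text \<open>Since T0(n t) = n T0(t), the stretches are at most of order n for |t| <= \<rho>, and the
  determinant at most of order n^d. The lower bound is the one of \<open>det_lower\<close>, the same
  for all n.\<close>

lemma coefficients_inner_bound:
  fixes \<rho> :: real
  obtains C \<Gamma> \<epsilon> where "C > 0" "\<Gamma> > 0" "\<epsilon> > 0" "\<And>n R t. n \<ge> 1 \<Longrightarrow> 0 \<le> R \<Longrightarrow> real n * R \<le> 3 \<Longrightarrow> \<bar>t\<bar> \<le> \<rho> \<Longrightarrow>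
    \<bar>M (real n * R) (real n * t) / real n\<bar> \<le> C \<and>
    A (real n * R) (real n * t) \<le> \<Gamma> * real n \<and> B (real n * R) (real n * t) \<le> \<Gamma> * real n \<and>
    \<epsilon> \<le> A (real n * R) (real n * t) * B (real n * R) (real n * t) ^ (d - 1) \<and>
    A (real n * R) (real n * t) * B (real n * R) (real n * t) ^ (d - 1) \<le> (\<Gamma> * real n) ^ d"
proof -
  obtain K where K: "K > 0" "\<And>R t. 0 \<le> R \<Longrightarrow> R \<le> 3 \<Longrightarrow> A R t \<le> K * (1 + T0 t) \<and> B R t \<le> K * (1 + T0 t)"
    using AB_upper_inner by blast
  obtain \<epsilon> where \<epsilon>: "\<epsilon> > 0" "\<And>R t. R \<ge> 0 \<Longrightarrow> A R t > 0 \<and> B R t > 0 \<and> \<epsilon> \<le> A R t * B R t ^ (d - 1)"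
    using det_lower by blast
  \<comment> \<open>n R <= 3 only gives R <= 3, so the radius inserted into
    \<open>M_scaled_bound\<close> has to be at least 3.\<close>
  define \<rho>' where "\<rho>' = max \<bar>\<rho>\<bar> 3"
  define \<Gamma> where "\<Gamma> = K * (1 + \<bar>\<rho>\<bar> * c0)"
  show ?thesis
  proof (rule that[of "1 + (\<rho>' * c0 + lam * (\<rho>' + 1))" \<Gamma> \<epsilon>])
    show "\<Gamma> > 0" using K c0 by (auto simp: \<Gamma>_def intro!: mult_pos_pos add_pos_nonneg)
    show "1 + (\<rho>' * c0 + lam * (\<rho>' + 1)) > 0" using c0 lam by (auto simp: \<rho>'_def intro!: add_pos_nonneg)
    fix n :: nat and R t :: real assume n: "n \<ge> 1" and R: "0 \<le> R" "real n * R \<le> 3" and t: "\<bar>t\<bar> \<le> \<rho>"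
    have n0: "real n \<ge> 1" using n by simp
    have R': "0 \<le> real n * R" using R n0 by simp
    have "1 * R \<le> real n * R" using R n0 by (intro mult_right_mono) auto
    then have "R \<le> \<rho>'" "\<bar>t\<bar> \<le> \<rho>'" using R t by (auto simp: \<rho>'_def)
    then have 1: "\<bar>M (real n * R) (real n * t) / real n\<bar> \<le> 1 + (\<rho>' * c0 + lam * (\<rho>' + 1))"
      using M_scaled_bound[OF n R(1), of \<rho>' t] by linarith
    have "K * (1 + T0 (real n * t)) \<le> K * (real n + real n * (\<bar>\<rho>\<bar> * c0))"
      unfolding T0_scale using T0_le[OF t] K n0 t by (intro mult_left_mono add_mono) auto
    also have "\<dots> = \<Gamma> * real n" by (simp add: \<Gamma>_def algebra_simps)
    finally have 2: "A (real n * R) (real n * t) \<le> \<Gamma> * real n" "B (real n * R) (real n * t) \<le> \<Gamma> * real n"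
      using K(2)[OF R' R(2), of "real n * t"] by linarith+
    have "A (real n * R) (real n * t) * B (real n * R) (real n * t) ^ (d - 1) \<le> (\<Gamma> * real n) * (\<Gamma> * real n) ^ (d - 1)"
      using 2 \<epsilon>(2)[OF R', of "real n * t"] by (intro mult_mono power_mono) auto
    also have "\<dots> = (\<Gamma> * real n) ^ d" using d3 by (simp add: power_eq_if[of _ d])
    finally show "\<bar>M (real n * R) (real n * t) / real n\<bar> \<le> 1 + (\<rho>' * c0 + lam * (\<rho>' + 1)) \<and>
    A (real n * R) (real n * t) \<le> \<Gamma> * real n \<and> B (real n * R) (real n * t) \<le> \<Gamma> * real n \<and>
    \<epsilon> \<le> A (real n * R) (real n * t) * B (real n * R) (real n * t) ^ (d - 1) \<and>
    A (real n * R) (real n * t) * B (real n * R) (real n * t) ^ (d - 1) \<le> (\<Gamma> * real n) ^ d"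
      using 1 2 \<epsilon>(2)[OF R', of "real n * t"] by blast
  qed (rule \<epsilon>(1))
qed

text \<open>The determinant in the limit is at least H > 0, and h' is continuous there.\<close>

lemma avg_density_tendsto:
  fixes z :: "(real^'n) \<times> real"
  assumes z: "z \<notin> singular_set"
  shows "(\<lambda>n. avg_density n \<psi> z) \<longlonglongrightarrow> sol_density \<psi> z"
proof -
  have R: "norm (fst z) > 0" "norm (fst z) \<noteq> \<sigma> * snd z" using z by (auto simp: singular_set_def)
  let ?R = "norm (fst z)" and ?t = "snd z"
  have a: "(\<lambda>n. A (real n * ?R) (real n * ?t)) \<longlonglongrightarrow> sol_stretch ?R ?t"
    unfolding sol_stretch_eq[OF R(1)] by (rule A_limit[OF R])
  have b: "(\<lambda>n. B (real n * ?R) (real n * ?t)) \<longlonglongrightarrow> w ?R ?t / ?R"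
  proof (rule Lim_transform_eventually)
    show "(\<lambda>n. M (real n * ?R) (real n * ?t) / real n / ?R) \<longlonglongrightarrow> w ?R ?t / ?R"
      by (intro tendsto_intros M_limit) (use R in auto)
    show "\<forall>\<^sub>F n in sequentially. M (real n * ?R) (real n * ?t) / real n / ?R = B (real n * ?R) (real n * ?t)"
      using eventually_gt_at_top[of 0] by eventually_elim (use R in \<open>simp add: B_def\<close>)
  qed
  have pos: "sol_stretch ?R ?t * (w ?R ?t / ?R) ^ (d - 1) > 0"
    using dw_det(1)[OF R(1), of ?t] H unfolding sol_stretch_eq[OF R(1)] by linarith
  show ?thesis unfolding avg_density_def sol_density_def Let_def wform_def
    by (intro tendsto_intros stress_tendsto[OF a b pos] M_limit[OF R(1)]) (use R in auto)
qed

end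

lemma integral_indicator_le:
  fixes f :: "'a::euclidean_space \<Rightarrow> real"
  assumes f: "f \<in> borel_measurable borel" and S: "S \<in> sets borel" "emeasure lborel S = ennreal V" "V \<ge> 0"
    and le: "\<And>z. \<bar>f z\<bar> \<le> k * indicator S z"
  shows "integrable lborel f" "\<bar>LINT z|lborel. f z\<bar> \<le> k * V"
proof -
  have i: "integrable lborel (\<lambda>z. k * indicator S z :: real)"
    using S by (intro integrable_mult_right integrable_real_indicator) auto
  show fi: "integrable lborel f"
    by (rule Bochner_Integration.integrable_bound[OF i]) (use f le in \<open>auto intro!: always_eventually intro: order_trans[OF le] abs_ge_self\<close>)
  have "\<bar>LINT z|lborel. f z\<bar> \<le> (LINT z|lborel. \<bar>f z\<bar>)" using integral_norm_bound[of lborel f] by simp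
  also have "\<dots> \<le> (LINT z|lborel. k * indicator S z)"
    by (rule integral_mono) (use i fi le in auto)
  also have "\<dots> = k * V" using S by (simp add: measure_def)
  finally show "\<bar>LINT z|lborel. f z\<bar> \<le> k * V" .
qed

lemma emeasure_cylinder:
  assumes "s \<ge> 0" "a \<le> b"
  shows "emeasure lborel (ball (0::'a::euclidean_space) s \<times> {a..b::real}) = ennreal (unit_ball_vol DIM('a) * s ^ DIM('a) * (b - a))"
proof -
  have "emeasure (lborel \<Otimes>\<^sub>M lborel) (ball (0::'a) s \<times> {a..b}) = emeasure lborel (ball (0::'a) s) * emeasure lborel {a..b}"
    by (rule lborel.emeasure_pair_measure_Times) auto
  then show ?thesis using assms by (simp add: lborel_prod emeasure_ball ennreal_mult)
qed

lemma cylinder_borel: "ball (0::'a::euclidean_space) s \<times> {a..b::real} \<in> sets borel"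
proof -
  have "ball (0::'a) s \<times> {a..b} \<in> sets (borel \<Otimes>\<^sub>M borel)" by (intro pair_measureI) auto
  then show ?thesis by (simp only: borel_prod)
qed

lemma norm_fst_snd_le: "norm (fst z) \<le> norm z" "\<bar>snd z\<bar> \<le> norm z" for z :: "'a::real_normed_vector \<times> real"
  using norm_fst_le[of "fst z" "snd z"] norm_snd_le[of "snd z" "fst z"] by simp_all

section \<open>The weak form of the solution for twice differentiable test functions\<close>

context cavitation
begin

definition sol_density0 :: "((real^'n) \<times> real \<Rightarrow> real^'n) \<Rightarrow> (real^'n) \<times> real \<Rightarrow> real" where
  "sol_density0 \<psi> z = (if fst z = 0 then 0 else sol_density \<psi> z)"

text \<open>C is chosen before \<psi>: one majorant then serves a whole sequence of test functions
  with a common bound K and a common radius \<rho>.\<close>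

lemma sol_density0_majorant:
  fixes \<rho> :: real
  obtains C where "C > 0" "\<And>(\<psi> :: (real^'n) \<times> real \<Rightarrow> real^'n) z K. norm (psi_tt \<psi> z) \<le> K \<Longrightarrow>
    (\<And>j. norm (dd \<psi> (axis j 1, 0) z) \<le> K) \<Longrightarrow>
    (\<And>m p q. norm z > \<rho> \<Longrightarrow> wform m p q \<psi> z = 0) \<Longrightarrow> \<bar>sol_density0 \<psi> z\<bar> \<le> K * C * majorant (d - 1) \<rho> z"
proof -
  obtain C where C: "C > 0" "\<And>R t. 0 < R \<Longrightarrow> R \<le> \<rho> \<Longrightarrow> \<bar>t\<bar> \<le> \<rho> \<Longrightarrow>
    \<bar>w R t\<bar> + \<bar>stress1 d h (sol_stretch R t) (w R t / R)\<bar> + \<bar>stress2 d h (sol_stretch R t) (w R t / R)\<bar> \<le> C * (1 + 1 / R ^ (d - 1))"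
    using sol_density_bound by blast
  show ?thesis
  proof (rule that[of "2 * real CARD('n) ^ 2 * C"])
    show "2 * real CARD('n) ^ 2 * C > 0" using C by simp
    fix \<psi> :: "(real^'n) \<times> real \<Rightarrow> real^'n" and z K
    assume K: "norm (psi_tt \<psi> z) \<le> K" "\<And>j. norm (dd \<psi> (axis j 1, 0) z) \<le> K"
      and z0: "\<And>m p q. norm z > \<rho> \<Longrightarrow> wform m p q \<psi> z = 0"
    have K0: "K \<ge> 0" using K(1) norm_ge_zero order_trans by blast
    show "\<bar>sol_density0 \<psi> z\<bar> \<le> K * (2 * real CARD('n) ^ 2 * C) * majorant (d - 1) \<rho> z"
    proof (cases "fst z = 0 \<or> norm z > \<rho>")
      case True
      then have "sol_density0 \<psi> z = 0" using z0 by (auto simp: sol_density0_def sol_density_def Let_def)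
      moreover have "majorant (d - 1) \<rho> z \<ge> 0" by (auto simp: majorant_def)
      ultimately show ?thesis using K0 C by simp
    next
      case False
      let ?R = "norm (fst z)" and ?t = "snd z"
      have R: "0 < ?R" "?R \<le> \<rho>" "\<bar>?t\<bar> \<le> \<rho>" using False norm_fst_snd_le[of z] by auto
      have "\<bar>sol_density0 \<psi> z\<bar> \<le> 2 * real CARD('n) ^ 2 * K *
         (\<bar>w ?R ?t\<bar> + \<bar>stress1 d h (sol_stretch ?R ?t) (w ?R ?t / ?R)\<bar> + \<bar>stress2 d h (sol_stretch ?R ?t) (w ?R ?t / ?R)\<bar>)"
        using False by (simp add: sol_density0_def sol_density_def Let_def wform_bound[OF K])
      also have "\<dots> \<le> 2 * real CARD('n) ^ 2 * K * (C * (1 + 1 / ?R ^ (d - 1)))"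
        using C(2)[OF R] K0 by (intro mult_left_mono) auto
      also have "\<dots> = K * (2 * real CARD('n) ^ 2 * C) * majorant (d - 1) \<rho> z"
        using R by (auto simp: majorant_def abs_le_iff)
      finally show ?thesis .
    qed
  qed
qed

lemma sol_density0_borel: "Ck 2 \<psi> \<Longrightarrow> sol_density0 \<psi> \<in> borel_measurable borel"
  using sol_density_borel unfolding sol_density0_def[abs_def] .

lemma majorant_integrable: "d = CARD('n) \<Longrightarrow> integrable lborel (majorant (d - 1) \<rho> :: (real^'n) \<times> real \<Rightarrow> real)"
  using d3 by (intro integrable_majorant) simp

lemma sol_density0_integrable:
  fixes \<psi> :: "(real^'n) \<times> real \<Rightarrow> real^'n"
  assumes dn: "d = CARD('n)" and \<psi>: "Ck 2 \<psi>" "compactly_supported \<psi>"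
  shows "integrable lborel (sol_density0 \<psi>)"
proof -
  obtain K \<rho> where K: "K > 0" "\<rho> > 0" "\<And>z. norm (psi_tt \<psi> z) \<le> K" "\<And>j z. norm (dd \<psi> (axis j 1, 0) z) \<le> K"
    "\<And>z m p q. norm z > \<rho> \<Longrightarrow> wform m p q \<psi> z = 0"
    using test_function_bounds[OF \<psi>] by metis
  obtain C where C: "C > 0" "\<And>(\<psi> :: (real^'n) \<times> real \<Rightarrow> real^'n) z K. norm (psi_tt \<psi> z) \<le> K \<Longrightarrow>
    (\<And>j. norm (dd \<psi> (axis j 1, 0) z) \<le> K) \<Longrightarrow>
    (\<And>m p q. norm z > \<rho> \<Longrightarrow> wform m p q \<psi> z = 0) \<Longrightarrow> \<bar>sol_density0 \<psi> z\<bar> \<le> K * C * majorant (d - 1) \<rho> z"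
    using sol_density0_majorant[where \<rho>=\<rho>] by blast
  have "\<bar>sol_density0 \<psi> z\<bar> \<le> K * C * majorant (d - 1) \<rho> z" for z by (rule C(2)[OF K(3,4,5)])
  then have le: "norm (sol_density0 \<psi> z) \<le> norm (K * C * majorant (d - 1) \<rho> z)" for z
    using abs_ge_self order_trans unfolding real_norm_def by blast
  show ?thesis
    by (rule Bochner_Integration.integrable_bound[of _ "\<lambda>z. K * C * majorant (d - 1) \<rho> z"])
      (use majorant_integrable[OF dn] sol_density0_borel[OF \<psi>(1)] le in auto)
qed

lemma solution_weak_form:
  fixes \<psi> :: "(real^'n) \<times> real \<Rightarrow> real^'n"
  assumes dn: "d = CARD('n)" and \<psi>: "Ck 2 \<psi>" "compactly_supported \<psi>"
  shows "weak_integral h (cavitating_map lam r) \<psi> = (LINT z|lborel. sol_density0 \<psi> z)"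
  unfolding weak_integral_def
proof (rule iterated_integral_AE(2)[OF sol_density0_integrable[OF dn \<psi>] singular_set_borel singular_set_section])
  fix x :: "real^'n" and t assume z: "(x, t) \<notin> singular_set"
  then have "x \<noteq> 0" by (auto simp: singular_set_def)
  then show "weak_integrand h (cavitating_map lam r) \<psi> x t = sol_density0 \<psi> (x, t)"
    using weak_integrand_sol[OF dn \<psi>(1) z] by (simp add: sol_density0_def)
qed

lemma tendsto_wform:
  fixes \<Psi> :: "nat \<Rightarrow> (real^'n) \<times> real \<Rightarrow> real^'n"
  assumes "(\<lambda>j. psi_tt (\<Psi> j) z) \<longlonglongrightarrow> psi_tt \<psi> z"
    and "\<And>i. (\<lambda>j. dd (\<Psi> j) (axis i 1, 0) z) \<longlonglongrightarrow> dd \<psi> (axis i 1, 0) z"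
  shows "(\<lambda>j. wform m p q (\<Psi> j) z) \<longlonglongrightarrow> wform m p q \<psi> z"
proof -
  have g: "(\<lambda>j. psi_grad (\<Psi> j) z $ i $ k) \<longlonglongrightarrow> psi_grad \<psi> z $ i $ k" for i k
    unfolding psi_grad_def vec_lambda_beta by (rule tendsto_vec_nth[OF assms(2)])
  have 1: "(\<lambda>j. u \<bullet> (psi_grad (\<Psi> j) z *v u)) \<longlonglongrightarrow> u \<bullet> (psi_grad \<psi> z *v u)" for u
    unfolding inner_vec_def matrix_vector_mult_def vec_lambda_beta inner_real_def
    by (intro tendsto_intros g)
  have 2: "(\<lambda>j. trace (psi_grad (\<Psi> j) z)) \<longlonglongrightarrow> trace (psi_grad \<psi> z)"
    unfolding trace_def by (intro tendsto_intros g)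
  show ?thesis unfolding wform_def by (intro tendsto_intros 1 2 assms(1))
qed

text \<open>Dominated convergence along mollified test functions, for which the weak form vanishes
  by hypothesis.\<close>

lemma weak_form_zero:
  fixes \<psi> :: "(real^'n) \<times> real \<Rightarrow> real^'n"
  assumes dn: "d = CARD('n)" and sol: "weak_solution h (cavitating_map lam r :: real^'n \<Rightarrow> real \<Rightarrow> real^'n)"
    and \<psi>: "Ck 2 \<psi>" "compactly_supported \<psi>"
  shows "(LINT z|lborel. sol_density0 \<psi> z) = 0"
proof -
  show ?thesis
  proof (rule C2_mollification[OF \<psi>])
  fix \<Psi> :: "nat \<Rightarrow> (real^'n) \<times> real \<Rightarrow> real^'n" and R
  assume \<Psi>: "\<And>j k. Ck k (\<Psi> j)" "\<And>j z. norm z > R \<Longrightarrow> \<Psi> j z = 0" "\<And>z. norm z > R \<Longrightarrow> \<psi> z = 0"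
    "\<And>v. \<exists>C. \<forall>j z. norm (dd (\<Psi> j) v z) \<le> C"
    "\<And>v. \<exists>C. \<forall>j z. norm (dd (dd (\<Psi> j) v) v z) \<le> C"
    "\<And>v z. (\<lambda>j. dd (\<Psi> j) v z) \<longlonglongrightarrow> dd \<psi> v z"
    "\<And>v z. (\<lambda>j. dd (dd (\<Psi> j) v) v z) \<longlonglongrightarrow> dd (dd \<psi> v) v z"
  have supp: "compactly_supported (\<Psi> j)" for j by (rule compactly_supportedI) (rule \<Psi>(2))
  obtain K1 where K1: "\<And>j z. norm (psi_tt (\<Psi> j) z) \<le> K1" using \<Psi>(5) unfolding psi_tt_def by blast
  have "\<forall>i. \<exists>C. \<forall>j z. norm (dd (\<Psi> j) (axis i 1, 0) z) \<le> C" using \<Psi>(4) by blast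
  from choice[OF this] obtain K2 where K2: "\<And>i j z. norm (dd (\<Psi> j) (axis (i::'n) 1, 0) z) \<le> K2 i" by blast
  define K where "K = K1 + (\<Sum>i\<in>UNIV. K2 i)"
  have K2nn: "0 \<le> K2 i" for i using K2[of 0 i 0] norm_ge_zero order_trans by blast
  have K1nn: "0 \<le> K1" using K1[of 0 0] norm_ge_zero order_trans by blast
  have Knn: "0 \<le> (\<Sum>i\<in>UNIV. K2 i)" by (rule sum_nonneg) (rule K2nn)
  have Ka: "norm (psi_tt (\<Psi> j) z) \<le> K" for j z using K1[of j z] Knn by (simp add: K_def)
  have Kb: "norm (dd (\<Psi> j) (axis i 1, 0) z) \<le> K" for i j z
  proof -
    have "K2 i \<le> (\<Sum>i\<in>UNIV. K2 i)" by (rule member_le_sum) (use K2nn in auto)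
    then show ?thesis using K2[of j i z] K1nn by (simp add: K_def)
  qed
  have z1: "dd (\<Psi> j) v z = 0" if "norm z > R" for j v z
    by (rule dd_eq_0_outside[of R]) (use \<Psi>(2) that in auto)
  have z2: "dd (dd (\<Psi> j) v) v' z = 0" if "norm z > R" for j v v' z
    by (rule dd_eq_0_outside[of R]) (use z1 that in auto)
  have Kc: "wform m p q (\<Psi> j) z = 0" if "norm z > R" for m p q j z
    by (rule wform_eq_0) (use z1[OF that] z2[OF that] in \<open>auto simp: psi_tt_def\<close>)
  obtain C where C: "C > 0" "\<And>(\<psi> :: (real^'n) \<times> real \<Rightarrow> real^'n) z K. norm (psi_tt \<psi> z) \<le> K \<Longrightarrow>
    (\<And>j. norm (dd \<psi> (axis j 1, 0) z) \<le> K) \<Longrightarrow>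
    (\<And>m p q. norm z > R \<Longrightarrow> wform m p q \<psi> z = 0) \<Longrightarrow> \<bar>sol_density0 \<psi> z\<bar> \<le> K * C * majorant (d - 1) R z"
    using sol_density0_majorant[where \<rho>=R] by blast
  have "(\<lambda>j. LINT z|lborel. sol_density0 (\<Psi> j) z) \<longlonglongrightarrow> (LINT z|lborel. sol_density0 \<psi> z)"
  proof (rule integral_dominated_convergence[where w="\<lambda>z. K * C * majorant (d - 1) R z"])
    show "AE z in lborel. (\<lambda>j. sol_density0 (\<Psi> j) z) \<longlonglongrightarrow> sol_density0 \<psi> z"
    proof (intro always_eventually allI)
      fix z :: "(real^'n) \<times> real"
      show "(\<lambda>j. sol_density0 (\<Psi> j) z) \<longlonglongrightarrow> sol_density0 \<psi> z"
        unfolding sol_density0_def sol_density_def Let_def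
        by (cases "fst z = 0") (auto intro!: tendsto_wform \<Psi>(6) \<Psi>(7) simp: psi_tt_def)
    qed
    show "AE z in lborel. norm (sol_density0 (\<Psi> j) z) \<le> K * C * majorant (d - 1) R z" for j
      unfolding real_norm_def by (intro always_eventually allI C(2)[OF Ka Kb Kc])
  qed (use majorant_integrable[OF dn] sol_density0_borel \<psi> \<Psi>(1) in auto)
  moreover have "(LINT z|lborel. sol_density0 (\<Psi> j) z) = 0" for j
  proof -
    have "weak_integral h (cavitating_map lam r) (\<Psi> j) = 0"
      using sol \<Psi>(1)[of _ j] supp[of j] unfolding weak_solution_def by blast
    then show ?thesis using solution_weak_form[OF dn \<Psi>(1) supp] by simp
  qed
  ultimately show "(LINT z|lborel. sol_density0 \<psi> z) = 0" by (simp add: LIMSEQ_const_iff)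
  qed
qed

end

section \<open>Outer and inner contributions to the averaged weak form\<close>

context averaging
begin

definition outer :: "nat \<Rightarrow> ((real^'n) \<times> real \<Rightarrow> real^'n) \<Rightarrow> (real^'n) \<times> real \<Rightarrow> real" where
  "outer n \<psi> z = (if 3 \<le> real n * norm (fst z) then avg_density n \<psi> z else 0)"

definition inner_part :: "nat \<Rightarrow> ((real^'n) \<times> real \<Rightarrow> real^'n) \<Rightarrow> (real^'n) \<times> real \<Rightarrow> real" where
  "inner_part n \<psi> z = (if 3 \<le> real n * norm (fst z) then 0 else avg_density n \<psi> z)"

lemma outer_set: "{z \<in> space borel. 3 \<le> real n * norm (fst z :: real^'n)} \<in> sets (borel :: ((real^'n) \<times> real) measure)"
proof -
  have "closed {z::(real^'n) \<times> real. 3 \<le> real n * norm (fst z)}" by (intro closed_Collect_le continuous_intros)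
  then show ?thesis by simp
qed

lemma outer_borel: "Ck 2 \<psi> \<Longrightarrow> outer n \<psi> \<in> borel_measurable borel"
  unfolding outer_def[abs_def] by (intro measurable_If avg_density_borel outer_set borel_measurable_const)

lemma inner_borel: "Ck 2 \<psi> \<Longrightarrow> inner_part n \<psi> \<in> borel_measurable borel"
  unfolding inner_part_def[abs_def] by (intro measurable_If avg_density_borel outer_set borel_measurable_const)

text \<open>Every point with x different from 0 eventually belongs to the outer region, so the
  densities converge almost everywhere; the majorant from \<open>coefficients_outer_bound\<close> is
  independent of n.\<close>

lemma outer_integral:
  fixes \<psi> :: "(real^'n) \<times> real \<Rightarrow> real^'n"
  assumes dn: "d = CARD('n)" and \<psi>: "Ck 2 \<psi>" "compactly_supported \<psi>"
  shows "n \<ge> 1 \<Longrightarrow> integrable lborel (outer n \<psi>)"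
    "(\<lambda>n. LINT z|lborel. outer n \<psi> z) \<longlonglongrightarrow> (LINT z|lborel. sol_density0 \<psi> z)"
proof -
  obtain K \<rho> where K: "K > 0" "\<rho> > 0" "\<And>z. norm (psi_tt \<psi> z) \<le> K" "\<And>j z. norm (dd \<psi> (axis j 1, 0) z) \<le> K"
    "\<And>z m p q. norm z > \<rho> \<Longrightarrow> wform m p q \<psi> z = 0"
    using test_function_bounds[OF \<psi>] by metis
  obtain C where C: "C > 0" "\<And>n R t. n \<ge> 1 \<Longrightarrow> 3 \<le> real n * R \<Longrightarrow> R \<le> \<rho> \<Longrightarrow> \<bar>t\<bar> \<le> \<rho> \<Longrightarrow>
    \<bar>M (real n * R) (real n * t) / real n\<bar>
     + \<bar>stress1 d h (A (real n * R) (real n * t)) (B (real n * R) (real n * t))\<bar>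
     + \<bar>stress2 d h (A (real n * R) (real n * t)) (B (real n * R) (real n * t))\<bar> \<le> C * (1 + 1 / R ^ (d - 1))"
    using coefficients_outer_bound by blast
  let ?C = "2 * real CARD('n) ^ 2 * K * C"
  have le: "norm (outer n \<psi> z) \<le> ?C * majorant (d - 1) \<rho> z" for n z
  proof (cases "3 \<le> real n * norm (fst z) \<and> norm z \<le> \<rho>")
    case False
    then have "outer n \<psi> z = 0" using K(5)[of z] by (cases "norm z > \<rho>") (auto simp: outer_def avg_density_def Let_def)
    moreover have "majorant (d - 1) \<rho> z \<ge> 0" by (auto simp: majorant_def)
    ultimately show ?thesis using K C by simp
  next
    case True
    let ?R = "norm (fst z)" and ?t = "snd z"
    have R: "3 \<le> real n * ?R" "?R \<le> \<rho>" "\<bar>?t\<bar> \<le> \<rho>" using True norm_fst_snd_le[of z] by auto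
    have n: "n \<ge> 1" using R(1) by (cases n) auto
    have "norm (outer n \<psi> z) \<le> 2 * real CARD('n) ^ 2 * K * (\<bar>M (real n * ?R) (real n * ?t) / real n\<bar>
     + \<bar>stress1 d h (A (real n * ?R) (real n * ?t)) (B (real n * ?R) (real n * ?t))\<bar>
     + \<bar>stress2 d h (A (real n * ?R) (real n * ?t)) (B (real n * ?R) (real n * ?t))\<bar>)"
      unfolding outer_def if_P[OF R(1)] avg_density_def Let_def real_norm_def by (rule wform_bound[OF K(3,4)])
    also have "\<dots> \<le> 2 * real CARD('n) ^ 2 * K * (C * (1 + 1 / ?R ^ (d - 1)))"
      using C(2)[OF n R] K by (intro mult_left_mono) auto
    also have "\<dots> = ?C * majorant (d - 1) \<rho> z"
      using R by (auto simp: majorant_def abs_le_iff)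
    finally show ?thesis .
  qed
  have mi: "integrable lborel (\<lambda>z. ?C * majorant (d - 1) \<rho> (z :: (real^'n) \<times> real))"
    using majorant_integrable[OF dn] by simp
  show "integrable lborel (outer n \<psi>)"
    by (rule Bochner_Integration.integrable_bound[OF mi])
      (use outer_borel[OF \<psi>(1)] le order_trans[OF le abs_ge_self] in auto)
  show "(\<lambda>n. LINT z|lborel. outer n \<psi> z) \<longlonglongrightarrow> (LINT z|lborel. sol_density0 \<psi> z)"
  proof (rule integral_dominated_convergence[where w="\<lambda>z. ?C * majorant (d - 1) \<rho> z"])
    show "AE z in lborel. (\<lambda>n. outer n \<psi> z) \<longlonglongrightarrow> sol_density0 \<psi> z"
      using singular_AE
    proof eventually_elim
      case (elim z)
      then have R: "norm (fst z) > 0" by (auto simp: singular_set_def)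
      obtain N where N: "real N > 3 / norm (fst z)" using reals_Archimedean2 by blast
      have "\<forall>\<^sub>F n in sequentially. avg_density n \<psi> z = outer n \<psi> z"
        using eventually_ge_at_top[of N]
      proof eventually_elim
        case (elim n)
        then have "real n > 3 / norm (fst z)" using N by (meson less_le_trans of_nat_le_iff)
        then have "3 \<le> real n * norm (fst z)" using R by (simp add: field_simps)
        then show ?case by (simp add: outer_def)
      qed
      from Lim_transform_eventually[OF avg_density_tendsto[OF elim] this] show ?case
        using R by (simp add: sol_density0_def)
    qed
  qed (use mi outer_borel sol_density0_borel \<psi> le in auto)
qed

text \<open>The determinant lies between \<epsilon> and (\<Gamma> n)^d, so the monotone h' is
  bounded by its values there. The stresses are then of order n + n^(d-1) (|h'(\<epsilon>)| +
  |h'((\<Gamma> n)^d)|), on a cylinder of volume V/n^d.\<close>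

lemma inner_integral_bound:
  fixes \<psi> :: "(real^'n) \<times> real \<Rightarrow> real^'n"
  assumes dn: "d = CARD('n)" and \<psi>: "Ck 2 \<psi>" "compactly_supported \<psi>"
  obtains C \<Gamma> \<epsilon> where "C > 0" "\<Gamma> > 0" "\<epsilon> > 0" "\<And>n. n \<ge> 1 \<Longrightarrow> integrable lborel (inner_part n \<psi>)"
    "\<And>n. n \<ge> 1 \<Longrightarrow> \<bar>LINT z|lborel. inner_part n \<psi> z\<bar> \<le>
       C * (1 / real n + (\<bar>deriv h \<epsilon>\<bar> + \<bar>deriv h ((\<Gamma> * real n) ^ d)\<bar>) / real n)"
proof -
  obtain K \<rho> where K: "K > 0" "\<rho> > 0" "\<And>z. norm (psi_tt \<psi> z) \<le> K" "\<And>j z. norm (dd \<psi> (axis j 1, 0) z) \<le> K"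
    "\<And>z m p q. norm z > \<rho> \<Longrightarrow> wform m p q \<psi> z = 0"
    using test_function_bounds[OF \<psi>] by metis
  obtain c \<Gamma> \<epsilon> where c: "c > 0" "\<Gamma> > 0" "\<epsilon> > 0" "\<And>n R t. n \<ge> 1 \<Longrightarrow> 0 \<le> R \<Longrightarrow> real n * R \<le> 3 \<Longrightarrow> \<bar>t\<bar> \<le> \<rho> \<Longrightarrow>
    \<bar>M (real n * R) (real n * t) / real n\<bar> \<le> c \<and>
    A (real n * R) (real n * t) \<le> \<Gamma> * real n \<and> B (real n * R) (real n * t) \<le> \<Gamma> * real n \<and>
    \<epsilon> \<le> A (real n * R) (real n * t) * B (real n * R) (real n * t) ^ (d - 1) \<and>
    A (real n * R) (real n * t) * B (real n * R) (real n * t) ^ (d - 1) \<le> (\<Gamma> * real n) ^ d"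
    using coefficients_inner_bound[of \<rho>] by blast
  define \<eta> where "\<eta> n = \<bar>deriv h \<epsilon>\<bar> + \<bar>deriv h ((\<Gamma> * real n) ^ d)\<bar>" for n
  define K' where "K' = 2 * real CARD('n) ^ 2 * K"
  define V where "V = unit_ball_vol (real CARD('n)) * 3 ^ d * (2 * \<rho>)"
  have K': "K' > 0" using K by (simp add: K'_def)
  have V: "V > 0" using K by (simp add: V_def)
  define E where "E = 1 + (c + 2 * \<Gamma>) + 2 * \<Gamma> ^ (d - 1)"
  have \<eta>0: "\<eta> n \<ge> 0" for n by (simp add: \<eta>_def)
  \<comment> \<open>K' passes from the coefficients to the integrand; c bounds the displacement, and
    the remaining term both principal stresses.\<close>
  define \<kappa> where "\<kappa> n = K' * (c + 2 * (\<Gamma> * real n + (\<Gamma> * real n) ^ (d - 1) * \<eta> n))" for n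
  have le: "\<bar>inner_part n \<psi> z\<bar> \<le> \<kappa> n * indicator (ball 0 (3 / real n) \<times> {-\<rho>..\<rho>}) z" if n: "n \<ge> 1" for n z
  proof (cases "real n * norm (fst z) < 3 \<and> norm z \<le> \<rho>")
    case False
    then have "inner_part n \<psi> z = 0" using K(5)[of z] by (cases "norm z > \<rho>") (auto simp: inner_part_def avg_density_def Let_def)
    moreover have "\<kappa> n \<ge> 0" using K' c \<eta>0 by (simp add: \<kappa>_def)
    ultimately show ?thesis by simp
  next
    case True
    let ?R = "norm (fst z)" and ?t = "snd z"
    let ?a = "A (real n * ?R) (real n * ?t)" and ?b = "B (real n * ?R) (real n * ?t)"
    have R: "0 \<le> ?R" "real n * ?R \<le> 3" "\<bar>?t\<bar> \<le> \<rho>" using True norm_fst_snd_le[of z] by auto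
    note cc = c(4)[OF n R]
    have ab: "?a > 0" "?b > 0" using AB_pos by simp_all
    have n0: "real n > 0" using n by simp
    have hd: "\<bar>deriv h (?a * ?b ^ (d - 1))\<bar> \<le> \<eta> n"
      unfolding \<eta>_def by (rule deriv_h_abs[OF c(3)]) (use cc in auto)
    have "\<bar>stress1 d h ?a ?b\<bar> \<le> ?a + ?b ^ (d - 1) * \<bar>deriv h (?a * ?b ^ (d - 1))\<bar>"
      unfolding stress1_def using ab by (intro order_trans[OF abs_triangle_ineq]) (simp add: abs_mult)
    also have "\<dots> \<le> \<Gamma> * real n + (\<Gamma> * real n) ^ (d - 1) * \<eta> n"
      using cc ab hd c n0 by (intro add_mono mult_mono power_mono) auto
    finally have s1: "\<bar>stress1 d h ?a ?b\<bar> \<le> \<Gamma> * real n + (\<Gamma> * real n) ^ (d - 1) * \<eta> n" .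
    have dd1: "(\<Gamma> * real n) * (\<Gamma> * real n) ^ (d - 2) = (\<Gamma> * real n) ^ (d - 1)"
    proof -
      have "d - 1 = Suc (d - 2)" using d3 by simp
      then show ?thesis by (simp only: power_Suc)
    qed
    have "\<bar>stress2 d h ?a ?b\<bar> \<le> ?b + ?a * ?b ^ (d - 2) * \<bar>deriv h (?a * ?b ^ (d - 1))\<bar>"
      unfolding stress2_def using ab by (intro order_trans[OF abs_triangle_ineq]) (simp add: abs_mult)
    also have "\<dots> \<le> \<Gamma> * real n + ((\<Gamma> * real n) * (\<Gamma> * real n) ^ (d - 2)) * \<eta> n"
      using cc ab hd c n0 by (intro add_mono mult_mono power_mono) auto
    finally have s2: "\<bar>stress2 d h ?a ?b\<bar> \<le> \<Gamma> * real n + (\<Gamma> * real n) ^ (d - 1) * \<eta> n" unfolding dd1 .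
    have "\<bar>inner_part n \<psi> z\<bar> \<le> K' * (\<bar>M (real n * ?R) (real n * ?t) / real n\<bar> + \<bar>stress1 d h ?a ?b\<bar> + \<bar>stress2 d h ?a ?b\<bar>)"
    proof -
      have "\<not> 3 \<le> real n * ?R" using True by simp
      then show ?thesis
        unfolding inner_part_def avg_density_def Let_def K'_def by (simp only: if_False) (rule wform_bound[OF K(3,4)])
    qed
    also have "\<dots> \<le> \<kappa> n"
      unfolding \<kappa>_def using cc s1 s2 K' by (intro mult_left_mono) auto
    also have "\<kappa> n = \<kappa> n * indicator (ball 0 (3 / real n) \<times> {-\<rho>..\<rho>}) z"
      using True R n0 by (auto simp: indicator_def mem_Times_iff field_simps abs_le_iff)
    finally show ?thesis .
  qed
  have em: "emeasure lborel (ball (0::real^'n) (3 / real n) \<times> {-\<rho>..\<rho>}) = ennreal (V / real n ^ d)" for n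
    using emeasure_cylinder[of "3 / real n" "-\<rho>" \<rho>, where 'a="real^'n"] K dn
    by (simp add: V_def power_divide mult_ac)
  have Vn: "V / real n ^ d \<ge> 0" for n using V by simp
  show ?thesis
  proof (rule that[of "K' * V * E" \<Gamma> \<epsilon>])
    show "K' * V * E > 0" using K' V c by (auto simp: E_def intro!: mult_pos_pos add_pos_nonneg)
    fix n :: nat assume n: "n \<ge> 1"
    have n0: "real n \<ge> 1" using n by simp
    note I = integral_indicator_le[OF inner_borel[OF \<psi>(1)] cylinder_borel em Vn le[OF n]]
    show "integrable lborel (inner_part n \<psi>)" by (rule I(1))
    have nd: "real n ^ d = real n * real n ^ (d - 1)" using d3 by (simp add: power_eq_if[of _ d])
    have nd1: "real n \<le> real n ^ (d - 1)" using n0 d3 by (intro self_le_power) auto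
    have nd2: "1 \<le> real n ^ (d - 1)" using n0 by (intro one_le_power)
    have "\<bar>LINT z|lborel. inner_part n \<psi> z\<bar> \<le> \<kappa> n * (V / real n ^ d)" by (rule I(2))
    also have "\<dots> = K' * V * ((c + 2 * \<Gamma> * real n + 2 * (\<Gamma> ^ (d - 1) * \<eta> n) * real n ^ (d - 1)) / real n ^ d)"
      by (simp add: \<kappa>_def power_mult_distrib algebra_simps add_divide_distrib)
    also have "\<dots> \<le> K' * V * (E * (1 / real n + \<eta> n / real n))"
    proof (rule mult_left_mono)
      have "c + 2 * \<Gamma> * real n + 2 * (\<Gamma> ^ (d - 1) * \<eta> n) * real n ^ (d - 1) \<le>
         c * real n ^ (d - 1) + 2 * \<Gamma> * real n ^ (d - 1) + 2 * (\<Gamma> ^ (d - 1) * \<eta> n) * real n ^ (d - 1)"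
        using nd1 nd2 c \<eta>0[of n] by (intro add_mono mult_left_mono) (auto simp: mult_le_cancel_left1)
      also have "\<dots> = (c + 2 * \<Gamma> + 2 * \<Gamma> ^ (d - 1) * \<eta> n) * real n ^ (d - 1)" by (simp add: algebra_simps)
      also have "\<dots> \<le> (E * (1 + \<eta> n)) * real n ^ (d - 1)"
      proof (rule mult_right_mono)
        have "c + 2 * \<Gamma> \<le> E * 1" "2 * \<Gamma> ^ (d - 1) \<le> E" using c by (simp_all add: E_def)
        then show "c + 2 * \<Gamma> + 2 * \<Gamma> ^ (d - 1) * \<eta> n \<le> E * (1 + \<eta> n)"
          using mult_right_mono[OF _ \<eta>0[of n], of "2 * \<Gamma> ^ (d - 1)" E] by (simp add: distrib_left)
      qed simp
      finally have "(c + 2 * \<Gamma> * real n + 2 * (\<Gamma> ^ (d - 1) * \<eta> n) * real n ^ (d - 1)) / real n ^ d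
          \<le> (E * (1 + \<eta> n)) * real n ^ (d - 1) / real n ^ d" using n0 by (intro divide_right_mono) auto
      also have "\<dots> = E * (1 / real n + \<eta> n / real n)"
        unfolding nd using n0 by (simp add: field_simps)
      finally show "(c + 2 * \<Gamma> * real n + 2 * (\<Gamma> ^ (d - 1) * \<eta> n) * real n ^ (d - 1)) / real n ^ d
          \<le> E * (1 / real n + \<eta> n / real n)" .
    qed (use K' V in simp)
    finally show "\<bar>LINT z|lborel. inner_part n \<psi> z\<bar> \<le>
       K' * V * E * (1 / real n + (\<bar>deriv h \<epsilon>\<bar> + \<bar>deriv h ((\<Gamma> * real n) ^ d)\<bar>) / real n)"
      by (simp only: \<eta>_def mult.assoc)
  qed (use c in auto)
qed

lemma avg_density_integral:
  fixes \<psi> :: "(real^'n) \<times> real \<Rightarrow> real^'n"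
  assumes dn: "d = CARD('n)" and \<psi>: "Ck 2 \<psi>" "compactly_supported \<psi>" and n: "n \<ge> 1"
  shows "integrable lborel (avg_density n \<psi>)"
    "(LINT z|lborel. avg_density n \<psi> z) = (LINT z|lborel. outer n \<psi> z) + (LINT z|lborel. inner_part n \<psi> z)"
proof -
  have i: "integrable lborel (outer n \<psi>)" "integrable lborel (inner_part n \<psi>)"
    using outer_integral(1)[OF dn \<psi> n] inner_integral_bound[OF dn \<psi>] n by metis+
  have eq: "avg_density n \<psi> = (\<lambda>z. outer n \<psi> z + inner_part n \<psi> z)" by (auto simp: outer_def inner_part_def)
  show "integrable lborel (avg_density n \<psi>)" unfolding eq using i by (rule Bochner_Integration.integrable_add)
  show "(LINT z|lborel. avg_density n \<psi> z) = (LINT z|lborel. outer n \<psi> z) + (LINT z|lborel. inner_part n \<psi> z)"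
    unfolding eq using i by (rule Bochner_Integration.integral_add)
qed

text \<open>Stated for any w' that agrees with w for R > 0, because the profile in the definition of
  a slic-solution is existentially quantified.\<close>

lemma averaged_weak_form:
  fixes \<psi> :: "(real^'n) \<times> real \<Rightarrow> real^'n"
  assumes dn: "d = CARD('n)" and w': "\<And>R' t. R' > 0 \<Longrightarrow> w' R' t = w R' t" and n: "n \<ge> 1"
    and \<psi>: "Ck 2 \<psi>" "compactly_supported \<psi>"
  shows "weak_integrable h (radial_map (averaged \<phi> n w')) \<psi>"
    "weak_integral h (radial_map (averaged \<phi> n w')) \<psi> = (LINT z|lborel. avg_density n \<psi> z)"
proof -
  have eq: "weak_integrand h (radial_map (averaged \<phi> n w')) \<psi> x t = avg_density n \<psi> (x, t)" if "(x, t) \<notin> singular_set" for x t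
    by (rule weak_integrand_avg[OF dn w' n \<psi>(1)]) (use that in \<open>auto simp: singular_set_def\<close>)
  note * = iterated_integral_AE[OF avg_density_integral(1)[OF dn \<psi> n] singular_set_borel singular_set_section eq]
  show "weak_integrable h (radial_map (averaged \<phi> n w')) \<psi>"
    unfolding weak_integrable_def by (rule *(1))
  show "weak_integral h (radial_map (averaged \<phi> n w')) \<psi> = (LINT z|lborel. avg_density n \<psi> z)"
    unfolding weak_integral_def by (rule *(2))
qed

text \<open>The growth condition is used at v = \<Gamma> n; the factor \<Gamma> turns h'(v^d)/v into
  h'((\<Gamma> n)^d)/n.\<close>

lemma inner_integral_vanishes:
  fixes \<psi> :: "(real^'n) \<times> real \<Rightarrow> real^'n"
  assumes dn: "d = CARD('n)" and \<psi>: "Ck 2 \<psi>" "compactly_supported \<psi>"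
    and growth: "((\<lambda>v. deriv h (v ^ d) / v) \<longlongrightarrow> 0) at_top"
  shows "(\<lambda>n. LINT z|lborel. inner_part n \<psi> z) \<longlonglongrightarrow> 0"
proof -
  obtain C \<Gamma> \<epsilon> where C: "C > 0" "\<Gamma> > 0" "\<epsilon> > 0" 
    "\<And>n. n \<ge> 1 \<Longrightarrow> \<bar>LINT z|lborel. inner_part n \<psi> z\<bar> \<le>
       C * (1 / real n + (\<bar>deriv h \<epsilon>\<bar> + \<bar>deriv h ((\<Gamma> * real n) ^ d)\<bar>) / real n)"
    using inner_integral_bound[OF dn \<psi>] by metis
  have f: "filterlim (\<lambda>n. \<Gamma> * real n) at_top sequentially"
    using C(2) by (intro filterlim_tendsto_pos_mult_at_top[OF tendsto_const _ filterlim_real_sequentially])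
  have "(\<lambda>n. \<Gamma> * \<bar>deriv h ((\<Gamma> * real n) ^ d) / (\<Gamma> * real n)\<bar>) \<longlonglongrightarrow> \<Gamma> * \<bar>0\<bar>"
    by (intro tendsto_intros filterlim_compose[OF growth f])
  moreover have "\<Gamma> * \<bar>deriv h ((\<Gamma> * real n) ^ d) / (\<Gamma> * real n)\<bar> = \<bar>deriv h ((\<Gamma> * real n) ^ d)\<bar> / real n" for n
    using C(2) by (simp add: abs_divide abs_mult)
  ultimately have l: "(\<lambda>n. \<bar>deriv h ((\<Gamma> * real n) ^ d)\<bar> / real n) \<longlonglongrightarrow> 0" by simp
  have "(\<lambda>n. C * (1 / real n + (\<bar>deriv h \<epsilon>\<bar> / real n + \<bar>deriv h ((\<Gamma> * real n) ^ d)\<bar> / real n))) \<longlonglongrightarrow> C * (0 + (0 + 0))"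
    by (intro tendsto_intros lim_const_over_n l)
  then have L: "(\<lambda>n. C * (1 / real n + (\<bar>deriv h \<epsilon>\<bar> + \<bar>deriv h ((\<Gamma> * real n) ^ d)\<bar>) / real n)) \<longlonglongrightarrow> 0"
    by (simp add: add_divide_distrib)
  show ?thesis
  proof (rule Lim_null_comparison[OF _ L])
    show "\<forall>\<^sub>F n in sequentially. norm (LINT z|lborel. inner_part n \<psi> z)
       \<le> C * (1 / real n + (\<bar>deriv h \<epsilon>\<bar> + \<bar>deriv h ((\<Gamma> * real n) ^ d)\<bar>) / real n)"
      using eventually_ge_at_top[of 1] by eventually_elim (use C(4) in simp)
  qed
qed

end

section \<open>A test function detecting the concentrated stress\<close>

lemma admissible_mollifier_exists: obtains \<phi> where "admissible_mollifier \<phi>"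
proof -
  obtain \<eta> :: "real \<Rightarrow> real" where \<eta>: "\<And>k. Ck k \<eta>" "\<And>z. \<eta> z \<ge> 0" 
    "\<And>z. norm z \<ge> 1 \<Longrightarrow> \<eta> z = 0" "\<And>z. norm z < 1 \<Longrightarrow> \<eta> z > 0" "\<And>z. \<eta> (- z) = \<eta> z"
    "integrable lborel \<eta>" "(LINT z|lborel. \<eta> z) = 1"
    using mollifier_exists[of 1] by (metis zero_less_one)
  have "closure {x. \<eta> x \<noteq> 0} \<subseteq> {-1..1}"
  proof (rule closure_minimal)
    show "{x. \<eta> x \<noteq> 0} \<subseteq> {-1..1}"
    proof
      fix x assume "x \<in> {x. \<eta> x \<noteq> 0}"
      then have "\<not> norm x \<ge> 1" using \<eta>(3)[of x] by auto
      then show "x \<in> {-1..1}" by auto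
    qed
  qed simp
  moreover have "(LINT x|lebesgue. \<eta> x) = 1"
    using \<eta>(6,7) by (subst integral_completion) auto
  ultimately have "admissible_mollifier \<eta>"
    using \<eta>(1,2,4,5) by (simp add: admissible_mollifier_def)
  then show ?thesis by (rule that)
qed

text \<open>At least 1/2 for |x| <= 1/2 and |t - 2| <= 1/2, and positive only for 1 < t < 3, when
  the cavity is open. It increases in |x| as long as |x|^2 < 1/2.\<close>

definition core_q :: "(real^'n) \<times> real \<Rightarrow> real" where
  "core_q z = 1 - (fst z \<bullet> fst z - 1 / 2)\<^sup>2 - (snd z - 2)\<^sup>2"

text \<open>Near \<open>x = 0\<close> the scalar factor increases with \<open>|x|\<close>, so that both coefficients of the gradient
  of this test function are nonnegative where the averaged stress concentrates.\<close>
definition core_test :: "(real^'n) \<times> real \<Rightarrow> real^'n" where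
  "core_test z = flat_exp 0 (core_q z) *\<^sub>R fst z"

lemma Ck_core_test: "Ck k (core_test :: (real^'n) \<times> real \<Rightarrow> real^'n)"
proof -
  have q: "Ck k (core_q :: (real^'n) \<times> real \<Rightarrow> real)" for k
    unfolding core_q_def[abs_def]
    by (intro Ck_diff Ck_power Ck_inner Ck_const Ck_bounded_linear bounded_linear_fst bounded_linear_snd)
  show ?thesis unfolding core_test_def[abs_def]
    by (intro Ck_scaleR Ck_flat_exp q Ck_bounded_linear bounded_linear_fst)
qed

text \<open>Positivity forces |t| < 3 and |x| < 2, so the radius 8 is generous.\<close>

lemma core_q_neg: "norm z > 8 \<Longrightarrow> core_q z \<le> 0" for z :: "(real^'n) \<times> real"
proof (rule ccontr)
  assume z: "norm z > 8" and "\<not> core_q z \<le> 0"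
  then have "(fst z \<bullet> fst z - 1 / 2)\<^sup>2 + (snd z - 2)\<^sup>2 < 1" by (simp add: core_q_def)
  then have "(snd z - 2)\<^sup>2 < 1" "(fst z \<bullet> fst z - 1 / 2)\<^sup>2 < 1"
    using zero_le_power2[of "fst z \<bullet> fst z - 1 / 2"] zero_le_power2[of "snd z - 2"] by linarith+
  then have "\<bar>snd z - 2\<bar> < 1" "\<bar>fst z \<bullet> fst z - 1 / 2\<bar> < 1"
    by (simp_all only: abs_square_less_1)
  then have "\<bar>snd z\<bar> < 3" "(norm (fst z))\<^sup>2 < 2\<^sup>2" by (auto simp: power2_norm_eq_inner)
  then have "norm (fst z) < 2" using power2_less_imp_less by fastforce
  moreover have "norm z \<le> norm (fst z) + \<bar>snd z\<bar>" using norm_Pair_le[of "fst z" "snd z"] by simp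
  ultimately show False using z \<open>\<bar>snd z\<bar> < 3\<close> by linarith
qed

lemma core_test_supported: "compactly_supported (core_test :: (real^'n) \<times> real \<Rightarrow> real^'n)"
  by (rule compactly_supportedI[of 8]) (simp add: core_test_def core_q_neg flat_exp_eq_0)

text \<open>core_g z times x is the spatial gradient of the scalar factor of
  \<open>core_test\<close>: the derivative of \<open>flat_exp 0\<close> is
  \<open>flat_exp 2\<close>, and the gradient of \<open>core_q\<close> in x is 4 (1/2 - |x|^2)
  x.\<close>

definition core_g :: "(real^'n) \<times> real \<Rightarrow> real" where
  "core_g z = flat_exp 2 (core_q z) * (4 * (1 / 2 - fst z \<bullet> fst z))"

lemma dd_core_test:
  "dd core_test (v, 0) z = flat_exp 0 (core_q z) *\<^sub>R v + (core_g z * (fst z \<bullet> v)) *\<^sub>R fst z"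
proof -
  have f: "(fst has_derivative fst) (at z)" by (rule bounded_linear_imp_has_derivative[OF bounded_linear_fst])
  have s: "(snd has_derivative snd) (at z)" by (rule bounded_linear_imp_has_derivative[OF bounded_linear_snd])
  have i: "((\<lambda>z. fst z \<bullet> fst z) has_derivative (\<lambda>v. 2 * (fst z \<bullet> fst v))) (at z)"
    using has_derivative_inner[OF f f] by (simp add: inner_commute)
  have q: "(core_q has_derivative (\<lambda>v. - (2 * (fst z \<bullet> fst z - 1 / 2) * (2 * (fst z \<bullet> fst v))) - 2 * (snd z - 2) * snd v)) (at z)"
    unfolding core_q_def[abs_def]
    by (auto intro!: derivative_eq_intros i s simp: algebra_simps inner_commute)
  have "(core_test has_derivative (\<lambda>v. flat_exp 0 (core_q z) *\<^sub>R fst v +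
     ((flat_exp (0 + 2) (core_q z) - real 0 * flat_exp (0 + 1) (core_q z)) *
       (- (2 * (fst z \<bullet> fst z - 1 / 2) * (2 * (fst z \<bullet> fst v))) - 2 * (snd z - 2) * snd v)) *\<^sub>R fst z)) (at z)"
    unfolding core_test_def[abs_def]
    by (rule has_derivative_scaleR[OF has_derivative_flat_exp_compose[OF q] f])
  from dd_eqI[OF this, of "(v, 0)"] show ?thesis
    by (simp add: core_g_def algebra_simps numeral_2_eq_2)
qed

lemma psi_grad_core_test:
  fixes z :: "(real^'n) \<times> real"
  assumes x: "fst z \<noteq> 0"
  shows "psi_grad core_test z = radial_matrix (flat_exp 0 (core_q z) + core_g z * (norm (fst z))\<^sup>2) (flat_exp 0 (core_q z)) (fst z /\<^sub>R norm (fst z))"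
proof -
  have "psi_grad core_test z $ i $ j =
     radial_matrix (flat_exp 0 (core_q z) + core_g z * (norm (fst z))\<^sup>2) (flat_exp 0 (core_q z)) (fst z /\<^sub>R norm (fst z)) $ i $ j" for i j
  proof -
    have "fst z \<bullet> axis j 1 = fst z $ j" by (simp only: inner_axis inner_real_def mult_1_right)
    moreover have "axis j 1 $ i = (if i = j then 1 else (0::real))" by (simp add: axis_def)
    ultimately show ?thesis
      using x by (simp add: psi_grad_def dd_core_test radial_matrix_def power2_eq_square field_simps)
  qed
  then show ?thesis by (simp add: vec_eq_iff)
qed

text \<open>The gradient of \<open>core_test\<close> is itself radial, so p and q are multiplied by
  its radial and tangential stretch. The time derivative is kept apart in the first term.\<close>

lemma wform_core_test:
  fixes z :: "(real^'n) \<times> real"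
  assumes x: "fst z \<noteq> 0"
  shows "wform m p q core_test z = wform m 0 0 core_test z
    + p * (flat_exp 0 (core_q z) + core_g z * (norm (fst z))\<^sup>2) + q * (real CARD('n) - 1) * flat_exp 0 (core_q z)"
proof -
  let ?u = "fst z /\<^sub>R norm (fst z)" and ?b = "flat_exp 0 (core_q z)"
  let ?a = "?b + core_g z * (norm (fst z))\<^sup>2"
  have u: "norm ?u = 1" using x by simp
  then have uu: "?u \<bullet> ?u = 1" by (simp only: norm_eq_1)
  have 1: "?u \<bullet> (psi_grad core_test z *v ?u) = ?a"
  proof -
    have "v \<bullet> (radial_matrix a b v *v v) = a" if "v \<bullet> v = 1" for a b and v :: "real^'n"
      by (simp add: radial_matrix_vector inner_add_right that)
    from this[OF uu] show ?thesis unfolding psi_grad_core_test[OF x] .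
  qed
  have 2: "trace (psi_grad core_test z) = ?a + (real CARD('n) - 1) * ?b"
  proof -
    have "trace (radial_matrix a b v) = a + (real CARD('n) - 1) * b" if "v \<bullet> v = 1" for a b and v :: "real^'n"
    proof -
      have "trace (radial_matrix a b v) = (a - b) * (v \<bullet> v) + real CARD('n) * b"
        by (simp add: trace_def radial_matrix_def sum.distrib inner_vec_def sum_distrib_left mult_ac)
      then show ?thesis by (simp add: that algebra_simps)
    qed
    from this[OF uu] show ?thesis unfolding psi_grad_core_test[OF x] .
  qed
  show ?thesis unfolding wform_def 1 2 by (simp add: algebra_simps)
qed

lemma flat_exp_le: "flat_exp 0 s \<le> 1" "flat_exp 2 s \<le> 2"
proof -
  show "flat_exp 0 s \<le> 1" by (simp add: flat_exp_def)
  show "flat_exp 2 s \<le> 2"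
  proof (cases "s > 0")
    case True
    have "(inverse s)\<^sup>2 \<le> 2 * exp (inverse s)"
    proof -
      have "0 < inverse s" using True by simp
      then show ?thesis using exp_lower_Taylor_quadratic[of "inverse s"] by linarith
    qed
    then have "(inverse s)\<^sup>2 * exp (- inverse s) \<le> 2 * exp (inverse s) * exp (- inverse s)"
      by (intro mult_right_mono) auto
    also have "2 * exp (inverse s) * exp (- inverse s) = 2" by (simp add: exp_minus)
    finally show ?thesis using True by (simp add: flat_exp_def)
  qed (simp add: flat_exp_def)
qed

text \<open>For |x| <= 1/2 the factor 4 (1/2 - |x|^2) lies between 1 and 2,
  \<open>flat_exp 2\<close> is at most 2, and |x|^2 is at most 1/4.\<close>

lemma core_coefficients:
  fixes z :: "(real^'n) \<times> real"
  assumes "norm (fst z) \<le> 1 / 2"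
  shows "0 \<le> core_g z * (norm (fst z))\<^sup>2" "core_g z * (norm (fst z))\<^sup>2 \<le> 1"
proof -
  have n: "(norm (fst z))\<^sup>2 \<le> (1 / 2)\<^sup>2" using assms by (intro power_mono) auto
  have nn: "fst z \<bullet> fst z = (norm (fst z))\<^sup>2" by (simp add: power2_norm_eq_inner)
  have s: "0 \<le> 4 * (1 / 2 - (norm (fst z))\<^sup>2)" "4 * (1 / 2 - (norm (fst z))\<^sup>2) \<le> 2"
    using n by (auto simp: power_divide)
  have "0 \<le> core_g z" "core_g z \<le> 2 * 2"
    unfolding core_g_def nn
    using mult_nonneg_nonneg[OF flat_exp_nonneg s(1)] mult_mono[OF flat_exp_le(2) s(2) _ s(1)] by auto
  then show "0 \<le> core_g z * (norm (fst z))\<^sup>2" "core_g z * (norm (fst z))\<^sup>2 \<le> 1"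
    using n mult_mono[of "core_g z" 4 "(norm (fst z))\<^sup>2" "1 / 4"] by (auto simp: power2_eq_square)
qed

context averaging
begin

text \<open>On a cylinder around the origin, of volume of order n^(-d), both stretches are at least
  of order n; the integrand there is at least of order n^d, and its integral stays away from 0. On
  the rest of the inner region h' is at least h'(\<epsilon>), so the integrand is bounded below by a
  negative term of order n^(d-1), which costs O(1/n). Large positive values of h' do no harm
  there.\<close>

lemma inner_integral_persists:
  assumes dn: "d = CARD('n)" and c: "c > 0" and growth: "\<And>v. v \<ge> v0 \<Longrightarrow> c * v \<le> deriv h (v ^ d)"
    and lim: "(\<lambda>n. LINT z|lborel. inner_part n (core_test :: (real^'n) \<times> real \<Rightarrow> real^'n) z) \<longlonglongrightarrow> 0"
  shows False
proof -
  let ?\<psi> = "core_test :: (real^'n) \<times> real \<Rightarrow> real^'n"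
  let ?N = "real CARD('n)"
  have \<psi>: "Ck 2 ?\<psi>" "compactly_supported ?\<psi>" by (rule Ck_core_test, rule core_test_supported)
  obtain K \<rho>0 where K: "K > 0" "\<rho>0 > 0" "\<And>z. norm (psi_tt ?\<psi> z) \<le> K" "\<And>j z. norm (dd ?\<psi> (axis j 1, 0) z) \<le> K"
    "\<And>z m p q. norm z > \<rho>0 \<Longrightarrow> wform m p q ?\<psi> z = 0"
    using test_function_bounds[OF \<psi>] by metis
  \<comment> \<open>At least 3, so that the time interval [3/2, 5/2] of the core lies in
    [-\<rho>, \<rho>].\<close>
  define \<rho> where "\<rho> = max \<rho>0 3"
  have \<rho>: "\<rho> \<ge> 3" "\<rho>0 \<le> \<rho>" by (auto simp: \<rho>_def)
  obtain C \<Gamma> \<epsilon> where C: "C > 0" "\<Gamma> > 0" "\<epsilon> > 0" "\<And>n R t. n \<ge> 1 \<Longrightarrow> 0 \<le> R \<Longrightarrow> real n * R \<le> 3 \<Longrightarrow> \<bar>t\<bar> \<le> \<rho> \<Longrightarrow>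
    \<bar>M (real n * R) (real n * t) / real n\<bar> \<le> C \<and>
    A (real n * R) (real n * t) \<le> \<Gamma> * real n \<and> B (real n * R) (real n * t) \<le> \<Gamma> * real n \<and>
    \<epsilon> \<le> A (real n * R) (real n * t) * B (real n * R) (real n * t) ^ (d - 1) \<and>
    A (real n * R) (real n * t) * B (real n * R) (real n * t) ^ (d - 1) \<le> (\<Gamma> * real n) ^ d"
    using coefficients_inner_bound[of \<rho>] by blast
  obtain \<kappa> \<delta> where \<kappa>: "\<kappa> > 0" "\<delta> > 0" "\<delta> \<le> 1"
    "\<And>R t. 0 \<le> R \<Longrightarrow> R \<le> \<delta> \<Longrightarrow> \<kappa> * T0 t \<le> A R t" "\<And>R t. 0 \<le> R \<Longrightarrow> R \<le> 3 \<Longrightarrow> \<kappa> * T0 t \<le> B R t"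
    using A_lower by metis
  \<comment> \<open>On the core t >= 1, so T0(n t) >= c0 n, and both stretches are at least \<theta>
    n.\<close>
  define \<theta> where "\<theta> = \<kappa> * c0"
  define \<eta> where "\<eta> = \<bar>deriv h \<epsilon>\<bar>"
  define f0 where "f0 = flat_exp 0 (1 / 2)"
  define X where "X n = (\<Gamma> * real n) ^ (d - 1) * \<eta>" for n
  \<comment> \<open>The largest possible negative contribution: the term with the time derivative,
    and the part of the stress that h' >= - \<eta> leaves uncontrolled in sign.\<close>
  define E where "E n = 2 * ?N ^ 2 * K * C + (2 + ?N) * X n" for n
  define L where "L n = f0 * (c * (\<theta> * real n) ^ d)" for n
  let ?D = "\<lambda>n. ball (0::real^'n) (3 / real n) \<times> {-\<rho>..\<rho>}"
  let ?core = "\<lambda>n. ball (0::real^'n) (\<delta> / real n) \<times> {3/2..5/2::real}"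
  have \<theta>: "\<theta> > 0" using \<kappa> c0 by (simp add: \<theta>_def)
  have f0: "f0 > 0" by (simp add: f0_def flat_exp_pos)
  have X0: "X n \<ge> 0" for n using C by (simp add: X_def \<eta>_def)
  have bound: "L n * indicator (?core n) z - E n * indicator (?D n) z \<le> inner_part n ?\<psi> z"
    \<comment> \<open>n >= 6 puts the inner region into |x| <= 1/2, where
      \<open>core_coefficients\<close> makes the coefficients of the stress nonnegative.\<close>
    if n: "n \<ge> 6" "\<theta> * real n \<ge> v0" and z: "fst z \<noteq> 0" for n z
  proof (cases "real n * norm (fst z) < 3")
    case False
    have n0: "real n > 0" using n by simp
    have "z \<notin> ?D n" using False n0 by (auto simp: mem_Times_iff field_simps)
    moreover have "z \<notin> ?core n"
    proof
      assume "z \<in> ?core n"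
      then have "norm (fst z) < \<delta> / real n" by (auto simp: mem_Times_iff)
      then have "real n * norm (fst z) < \<delta>" using n0 by (simp add: field_simps)
      then show False using False \<kappa> by simp
    qed
    ultimately show ?thesis using False by (simp add: inner_part_def)
  next
    case in3: True
    have n0: "real n > 0" "n \<ge> 1" using n by auto
    have inner: "inner_part n ?\<psi> z = avg_density n ?\<psi> z" using in3 by (simp add: inner_part_def)
    show ?thesis
    proof (cases "\<bar>snd z\<bar> \<le> \<rho>")
      case False
      then have "norm z > \<rho>0" using norm_fst_snd_le(2)[of z] \<rho> by linarith
      then have "avg_density n ?\<psi> z = 0" using K(5) by (simp add: avg_density_def Let_def)
      moreover have "z \<notin> ?D n" using False by (auto simp: mem_Times_iff)
      moreover have "z \<notin> ?core n" using False \<rho> by (auto simp: mem_Times_iff)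
      ultimately show ?thesis unfolding inner by simp
    next
      case True
      let ?R = "norm (fst z)" and ?t = "snd z"
      let ?a = "A (real n * ?R) (real n * ?t)" and ?b = "B (real n * ?R) (real n * ?t)"
      let ?m = "M (real n * ?R) (real n * ?t) / real n"
      let ?p = "stress1 d h ?a ?b" and ?q = "stress2 d h ?a ?b"
      let ?f = "flat_exp 0 (core_q z)"
      let ?g = "?f + core_g z * ?R\<^sup>2"
      have "6 * ?R \<le> real n * ?R" using n by (intro mult_right_mono) auto
      then have Rhalf: "?R \<le> 1 / 2" using in3 by linarith
      note cc = C(4)[OF n0(2) norm_ge_zero less_imp_le[OF in3] True]
      have ab: "?a > 0" "?b > 0" using AB_pos by simp_all
      have f: "0 \<le> ?f" "?f \<le> 1" using flat_exp_nonneg flat_exp_le by auto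
      have g: "?f \<le> ?g" "?g \<le> 2" using core_coefficients[OF Rhalf] f by linarith+
      have Dz: "indicator (?D n) z = (1::real)"
        using in3 True n0 by (auto simp: indicator_def mem_Times_iff field_simps abs_le_iff)
      have dens: "avg_density n ?\<psi> z = wform ?m 0 0 ?\<psi> z + ?p * ?g + ?q * (?N - 1) * ?f"
        unfolding avg_density_def Let_def by (rule wform_core_test[OF z])
      have m: "- (2 * ?N ^ 2 * K * C) \<le> wform ?m 0 0 ?\<psi> z"
      proof -
        have "\<bar>wform ?m 0 0 ?\<psi> z\<bar> \<le> 2 * ?N ^ 2 * K * (\<bar>?m\<bar> + \<bar>0\<bar> + \<bar>0\<bar>)" by (rule wform_bound[OF K(3,4)])
        also have "\<dots> \<le> 2 * ?N ^ 2 * K * C" using cc K by (intro mult_left_mono) auto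
        finally show ?thesis by linarith
      qed
      \<comment> \<open>Monotonicity of h' and the lower bound of the determinant give this
        one-sided control in the whole inner region.\<close>
      have hd: "- \<eta> \<le> deriv h (?a * ?b ^ (d - 1))"
        using deriv_h_mono[OF C(3), of "?a * ?b ^ (d - 1)"] cc unfolding \<eta>_def by linarith
      have p: "- X n \<le> ?p"
      proof -
        have "?b ^ (d - 1) * \<eta> \<le> X n"
          unfolding X_def using cc ab by (intro mult_right_mono power_mono) (auto simp: \<eta>_def)
        moreover have "?b ^ (d - 1) * (- \<eta>) \<le> ?b ^ (d - 1) * deriv h (?a * ?b ^ (d - 1))"
          using hd ab by (intro mult_left_mono) auto
        ultimately show ?thesis using ab unfolding stress1_def by linarith
      qed
      have q: "- X n \<le> ?q"
      proof -
        have e: "d - 1 = Suc (d - 2)" using d3 by simp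
        have "?a * ?b ^ (d - 2) \<le> (\<Gamma> * real n) * (\<Gamma> * real n) ^ (d - 2)"
          using cc ab C n0 by (intro mult_mono power_mono) auto
        also have "\<dots> = (\<Gamma> * real n) ^ (d - 1)" unfolding e by (simp only: power_Suc)
        finally have "?a * ?b ^ (d - 2) * \<eta> \<le> X n"
          unfolding X_def by (intro mult_right_mono) (auto simp: \<eta>_def)
        moreover have "?a * ?b ^ (d - 2) * (- \<eta>) \<le> ?a * ?b ^ (d - 2) * deriv h (?a * ?b ^ (d - 1))"
          using hd ab by (intro mult_left_mono) auto
        ultimately show ?thesis using ab unfolding stress2_def by linarith
      qed
      have N1: "?N - 1 \<ge> 0" by simp
      have pg: "- (2 * X n) \<le> ?p * ?g"
      proof -
        have "- X n * ?g \<le> ?p * ?g" using p f g by (intro mult_right_mono) auto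
        moreover have "X n * ?g \<le> X n * 2" using X0 g by (intro mult_left_mono) auto
        ultimately show ?thesis by linarith
      qed
      have qf: "- (?N * X n) \<le> ?q * (?N - 1) * ?f"
      proof -
        have "- X n * ((?N - 1) * ?f) \<le> ?q * ((?N - 1) * ?f)" using q N1 f by (intro mult_right_mono) auto
        moreover have "X n * ((?N - 1) * ?f) \<le> X n * (?N * 1)" using X0 f N1 by (intro mult_left_mono mult_mono) auto
        ultimately show ?thesis by (simp add: mult_ac)
      qed
      show ?thesis
      proof (cases "z \<in> ?core n")
        case False
        have "- E n \<le> avg_density n ?\<psi> z" unfolding dens E_def using m pg qf by (simp add: algebra_simps)
        then show ?thesis unfolding inner using False Dz by simp
      next
        case core: True
        then have core': "?R < \<delta> / real n" "3/2 \<le> ?t" "?t \<le> 5/2" by (auto simp: mem_Times_iff)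
        have nR: "real n * ?R \<le> \<delta>" using core'(1) n0 by (simp add: field_simps)
        have "real n * 1 \<le> real n * ?t" using core' n0 by (intro mult_left_mono) auto
        then have "c0 * real n \<le> c0 * (real n * ?t)" using c0 by (intro mult_left_mono) auto
        moreover have "real n * ?t > 0" using core' n0 by (intro mult_pos_pos) auto
        ultimately have "c0 * real n \<le> T0 (real n * ?t)" by (simp add: T0_def mult.commute)
        then have "\<theta> * real n \<le> \<kappa> * T0 (real n * ?t)"
          using mult_left_mono[of "c0 * real n" _ \<kappa>] \<kappa>(1) by (simp add: \<theta>_def mult.assoc)
        then have th: "\<theta> * real n \<le> ?a" "\<theta> * real n \<le> ?b"
          using \<kappa>(4)[OF _ nR, of "real n * ?t"] \<kappa>(5)[of "real n * ?R" "real n * ?t"] in3 n0 by (auto intro: order_trans)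
        have thn: "\<theta> * real n > 0" using \<theta> n0 by simp
        have "(\<theta> * real n) * (\<theta> * real n) ^ (d - 1) \<le> ?a * ?b ^ (d - 1)"
          using th thn by (intro mult_mono power_mono) auto
        then have "(\<theta> * real n) ^ d \<le> ?a * ?b ^ (d - 1)" using d3 by (simp add: power_eq_if[of _ d])
        then have "deriv h ((\<theta> * real n) ^ d) \<le> deriv h (?a * ?b ^ (d - 1))"
          using thn by (intro deriv_h_mono) auto
        then have hd2: "c * (\<theta> * real n) \<le> deriv h (?a * ?b ^ (d - 1))" using growth[OF n(2)] by linarith
        have cth: "0 \<le> c * (\<theta> * real n)" using c thn by simp
        have "c * (\<theta> * real n) ^ d = (\<theta> * real n) ^ (d - 1) * (c * (\<theta> * real n))"
          using d3 by (simp add: power_eq_if[of _ d] mult_ac)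
        also have "\<dots> \<le> ?b ^ (d - 1) * deriv h (?a * ?b ^ (d - 1))"
          using th thn hd2 cth by (intro mult_mono power_mono) auto
        also have "\<dots> \<le> ?p" using ab by (simp add: stress1_def)
        finally have p2: "c * (\<theta> * real n) ^ d \<le> ?p" .
        have q2: "0 \<le> ?q" using ab hd2 cth by (simp add: stress2_def)
        \<comment> \<open>On the core both squares in \<open>core_q\<close> are at most 1/4, so
          \<open>core_q\<close> is at least 1 - 1/4 - 1/4 = 1/2.\<close>
        have "f0 \<le> ?f"
        proof -
          have sq: "x\<^sup>2 \<le> 1 / 4" if "\<bar>x\<bar> \<le> 1 / 2" for x :: real
            using power_mono[OF that, of 2] by (simp add: power_divide)
          have "(norm (fst z))\<^sup>2 \<le> 1 / 4" using Rhalf by (intro sq) simp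
          then have "\<bar>fst z \<bullet> fst z - 1 / 2\<bar> \<le> 1 / 2"
            using zero_le_power2[of "norm (fst z)"] unfolding power2_norm_eq_inner by linarith
          then have s1: "(fst z \<bullet> fst z - 1 / 2)\<^sup>2 \<le> 1 / 4" by (rule sq)
          have "\<bar>?t - 2\<bar> \<le> 1 / 2" using core'(2,3) by linarith
          then have "(?t - 2)\<^sup>2 \<le> 1 / 4" by (rule sq)
          with s1 have "1 / 2 \<le> core_q z" unfolding core_q_def by linarith
          then show ?thesis unfolding f0_def by (rule flat_exp_0_mono)
        qed
        then have 1: "L n \<le> ?p * ?g"
          unfolding L_def mult.commute[of ?p] using p2 g f0 c thn by (intro mult_mono) auto
        have 2: "0 \<le> ?q * (?N - 1) * ?f" using q2 N1 f by (intro mult_nonneg_nonneg) auto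
        have 3: "0 \<le> (2 + ?N) * X n" using X0[of n] by simp
        have "l - (k + e) \<le> w0 + p' + q'" if "l \<le> p'" "0 \<le> q'" "0 \<le> e" "- k \<le> w0" for l k e w0 p' q' :: real
          using that by linarith
        from this[OF 1 2 3 m] have "L n - E n \<le> avg_density n ?\<psi> z" unfolding dens E_def .
        then show ?thesis unfolding inner using core Dz by simp
      qed
    qed
  qed
  define V where "V = unit_ball_vol ?N * 3 ^ d * (2 * \<rho>)"
  define V' where "V' = unit_ball_vol ?N * \<delta> ^ d"
  have em: "emeasure lborel (?D n) = ennreal (V / real n ^ d)" for n
    using emeasure_cylinder[of "3 / real n" "-\<rho>" \<rho>, where 'a="real^'n"] \<rho> dn
    by (simp add: V_def power_divide mult_ac)
  have em': "emeasure lborel (?core n) = ennreal (V' / real n ^ d)" for n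
    using emeasure_cylinder[of "\<delta> / real n" "3/2" "5/2", where 'a="real^'n"] \<kappa> dn
    by (simp add: V'_def power_divide mult_ac)
  have Vp: "V \<ge> 0" "V' > 0" using \<rho> \<kappa> by (auto simp: V_def V'_def)
  have int: "L n * (V' / real n ^ d) - E n * (V / real n ^ d) \<le> (LINT z|lborel. inner_part n ?\<psi> z)"
    if n: "n \<ge> 6" "\<theta> * real n \<ge> v0" for n
  proof -
    have i1: "integrable lborel (indicator (?core n) :: _ \<Rightarrow> real)" "integrable lborel (indicator (?D n) :: _ \<Rightarrow> real)"
      using cylinder_borel em em' by (auto intro!: integrable_real_indicator)
    have i: "integrable lborel (\<lambda>z. L n * indicator (?core n) z - E n * indicator (?D n) z :: real)"
      by (intro Bochner_Integration.integrable_diff integrable_mult_right i1)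
    have "L n * (V' / real n ^ d) - E n * (V / real n ^ d) = (LINT z|lborel. L n * indicator (?core n) z - E n * indicator (?D n) z)"
    proof -
      have "measure lborel (?core n) = V' / real n ^ d" "measure lborel (?D n) = V / real n ^ d"
        using Vp by (simp_all add: measure_def em em')
      then show ?thesis using i1 by simp
    qed
    also have "\<dots> \<le> (LINT z|lborel. inner_part n ?\<psi> z)"
    proof (rule integral_mono_AE[OF i])
      have "n \<ge> 1" using n by simp
      then show "integrable lborel (inner_part n ?\<psi>)" using inner_integral_bound[OF dn \<psi>] by metis
      show "AE z in lborel. L n * indicator (?core n) z - E n * indicator (?D n) z \<le> inner_part n ?\<psi> z"
        using singular_AE by eventually_elim (rule bound[OF n], auto simp: singular_set_def)
    qed
    finally show ?thesis .
  qed
  \<comment> \<open>The contribution L(n) V'/n^d of the core, in which all powers of n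
    cancel.\<close>
  let ?l = "f0 * (c * \<theta> ^ d) * V'"
  have "?l \<le> 0"
  proof (rule tendsto_le[OF _ lim])
    have n1: "real n ^ d = real n * real n ^ (d - 1)" for n using d3 by (simp add: power_eq_if[of _ d])
    have "(\<lambda>n. ?l - (2 * ?N ^ 2 * K * C * V / real n + (2 + ?N) * (\<Gamma> ^ (d - 1) * \<eta>) * V / real n)) \<longlonglongrightarrow> ?l - (0 + 0)"
      by (intro tendsto_intros lim_const_over_n)
    then show "(\<lambda>n. ?l - (2 * ?N ^ 2 * K * C * V / real n + (2 + ?N) * (\<Gamma> ^ (d - 1) * \<eta>) * V / real n)) \<longlonglongrightarrow> ?l" by simp
    obtain n1 where n1': "real n1 > v0 / \<theta>" using reals_Archimedean2 by blast
    show "\<forall>\<^sub>F n in sequentially. ?l - (2 * ?N ^ 2 * K * C * V / real n + (2 + ?N) * (\<Gamma> ^ (d - 1) * \<eta>) * V / real n)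
       \<le> (LINT z|lborel. inner_part n ?\<psi> z)"
      using eventually_ge_at_top[of 6] eventually_ge_at_top[of n1]
    proof eventually_elim
      case (elim n)
      have n0: "real n \<ge> 1" using elim by simp
      have "real n > v0 / \<theta>" using n1' elim by (meson less_le_trans of_nat_le_iff)
      then have "\<theta> * real n \<ge> v0" using \<theta> by (simp add: field_simps)
      note I = int[OF elim(1) this]
      have 1: "L n * (V' / real n ^ d) = ?l" using n0 by (simp add: L_def power_mult_distrib)
      have d1: "1 \<le> real n ^ (d - 1)" using n0 by (intro one_le_power)
      have "E n * (V / real n ^ d) = (2 * ?N ^ 2 * K * C * V) / real n ^ d + ((2 + ?N) * (\<Gamma> ^ (d - 1) * \<eta>) * V) * (real n ^ (d - 1) / real n ^ d)"
        by (simp add: E_def X_def power_mult_distrib algebra_simps add_divide_distrib)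
      also have "real n ^ (d - 1) / real n ^ d = 1 / real n" unfolding n1 using n0 by simp
      also have "(2 * ?N ^ 2 * K * C * V) / real n ^ d \<le> (2 * ?N ^ 2 * K * C * V) / real n"
        unfolding n1 using n0 K C Vp d1 by (intro divide_left_mono) (auto simp: mult_le_cancel_left1)
      finally have "E n * (V / real n ^ d) \<le> 2 * ?N ^ 2 * K * C * V / real n + (2 + ?N) * (\<Gamma> ^ (d - 1) * \<eta>) * V / real n"
        by simp
      then show ?case using I 1 by linarith
    qed
  qed simp
  moreover have "?l > 0" using f0 c \<theta> Vp by simp
  ultimately show False by simp
qed

end

section \<open>Measurability and local integrability of the solution\<close>

lemma (in cavitation) radial_map_w_borel:
  "(\<lambda>(x, t). radial_map w x t :: real^'n) \<in> borel_measurable borel"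
proof -
  have wm: "(\<lambda>z::(real^'n) \<times> real. w (norm (fst z)) (snd z)) \<in> borel_measurable borel"
    using measurable_compose[OF norm_time_measurable[of 1] w_abs_borel] by simp
  have f: "(\<lambda>z::(real^'n) \<times> real. fst z) \<in> borel_measurable borel"
    by (rule borel_measurable_continuous_onI) (intro continuous_intros)
  have nf: "(\<lambda>z::(real^'n) \<times> real. norm (fst z)) \<in> borel_measurable borel"
    by (rule borel_measurable_continuous_onI) (intro continuous_intros)
  show ?thesis unfolding radial_map_def case_prod_beta
    by (intro borel_measurable_scaleR wm f nf borel_measurable_inverse)
qed

text \<open>The map is bounded on compact sets, by T0 t + lam |x|.\<close>

lemma (in cavitation) radial_map_w_Linf_loc: "Linf_loc_L1_loc (radial_map w :: real^'n \<Rightarrow> real \<Rightarrow> real^'n)"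
  unfolding Linf_loc_L1_loc_def
proof (intro conjI allI impI)
  let ?y = "radial_map w :: real^'n \<Rightarrow> real \<Rightarrow> real^'n"
  show "(\<lambda>(x, t). ?y x t) \<in> borel_measurable lebesgue"
    by (rule measurable_completion) (use radial_map_w_borel in simp)
  fix I :: "real set" and K :: "(real^'n) set"
  assume "compact I \<and> compact K"
  then have K: "compact K" and "bounded I" "bounded K" using compact_imp_bounded by auto
  then obtain a b where a: "\<And>t. t \<in> I \<Longrightarrow> \<bar>t\<bar> \<le> a" and b: "\<And>x. x \<in> K \<Longrightarrow> norm x \<le> b"
    unfolding bounded_iff by auto
  define c where "c = \<bar>a\<bar> * c0 + lam * \<bar>b\<bar>"
  have Kl: "K \<in> lmeasurable" using K by (rule lmeasurable_compact)
  interpret K: finite_measure "lebesgue_on K" by (rule finite_measure_lebesgue_on[OF Kl])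
  have bd: "norm (?y x t) \<le> c" if "t \<in> I" "x \<in> K" for x t
  proof -
    have "norm (?y x t) \<le> \<bar>w (norm x) t\<bar>" by (cases "x = 0") (simp_all add: radial_map_def abs_mult mult.assoc)
    also have "\<dots> \<le> T0 t + lam * norm x"
      using w_bounds[of "norm x" t] T0_nonneg[of t] by simp
    also have "\<dots> \<le> c"
      unfolding c_def T0_def using a[OF that(1)] b[OF that(2)] c0 lam
      by (intro add_mono mult_right_mono mult_left_mono) auto
    finally show ?thesis .
  qed
  have meas: "(\<lambda>x. ?y x t) \<in> borel_measurable (lebesgue_on K)" for t
  proof -
    have "(\<lambda>x. case (x, t) of (x, t) \<Rightarrow> ?y x t) \<in> borel_measurable borel"
      by (rule measurable_compose[OF _ radial_map_w_borel]) (intro borel_measurable_continuous_onI continuous_intros)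
    then show ?thesis by (intro measurable_restrict_space1 measurable_completion) simp
  qed
  have "integrable (lebesgue_on K) (\<lambda>x. ?y x t) \<and> (LINT x|lebesgue_on K. norm (?y x t)) \<le> c * measure lebesgue K"
    if t: "t \<in> I" for t
  proof
    show i: "integrable (lebesgue_on K) (\<lambda>x. ?y x t)"
      by (rule K.integrable_const_bound[of _ c]) (use meas bd[OF t] in \<open>auto intro!: AE_I2\<close>)
    have "(LINT x|lebesgue_on K. norm (?y x t)) \<le> (LINT x|lebesgue_on K. c)"
      by (rule integral_mono) (use i bd[OF t] in auto)
    also have "\<dots> = c * measure lebesgue K"
      using Kl by (simp add: measure_restrict_space fmeasurableD)
    finally show "(LINT x|lebesgue_on K. norm (?y x t)) \<le> c * measure lebesgue K" .
  qed
  then show "\<exists>C. AE t in lebesgue_on I. integrable (lebesgue_on K) (\<lambda>x. ?y x t) \<and> (LINT x|lebesgue_on K. norm (?y x t)) \<le> C"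
    by (intro exI[of _ "c * measure lebesgue K"] AE_I2) (simp add: space_restrict_space)
qed

theorem theorem3p8:
  fixes h r :: "real \<Rightarrow> real" and H lam \<sigma> :: real
    and y :: "real^'d \<Rightarrow> real \<Rightarrow> real^'d"
  assumes "CARD('d) \<ge> 3"
    and "energy_function h"
    and "H > 0" and "deriv h H = 0"
    and "lam > 0"
    and "cavitating_profile CARD('d) h H lam \<sigma> r"
    and "cavitating_profile_properties CARD('d) H lam \<sigma> r"
    and "y = cavitating_map lam r"
    and "weak_solution h y"
  shows "(((\<lambda>v. deriv h (v ^ CARD('d)) / v) \<longlongrightarrow> 0) at_top \<longrightarrow> slic_solution h lam y) \<and>
         (Liminf at_top (\<lambda>v. ereal (deriv h (v ^ CARD('d)) / v)) > 0 \<longrightarrow> \<not> slic_solution h lam y)"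
proof -
  interpret cavitation "CARD('d)" h r H lam \<sigma>
    by unfold_locales (fact assms)+
  have y: "y = radial_map w" using assms(8) cavitating_map_eq by simp
  have sol: "weak_solution h (cavitating_map lam r :: real^'d \<Rightarrow> real \<Rightarrow> real^'d)" using assms(8,9) by simp
  show ?thesis
  proof (intro conjI impI)
    assume growth: "((\<lambda>v. deriv h (v ^ CARD('d)) / v) \<longlongrightarrow> 0) at_top"
    show "slic_solution h lam y"
      unfolding slic_solution_def
    proof (intro conjI exI[of _ w])
      show "Linf_loc_L1_loc y" unfolding y by (rule radial_map_w_Linf_loc)
      show "\<forall>x. \<forall>t\<le>0. y x t = lam *\<^sub>R x" by (auto simp: assms(8) cavitating_map_def)
      show "\<exists>rbar>0. \<forall>t>0. \<forall>x. rbar * t < norm x \<longrightarrow> y x t = lam *\<^sub>R x"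
      proof (intro exI[of _ \<sigma>] conjI allI impI \<sigma>)
        fix t :: real and x :: "real^'d" assume t: "t > 0" "\<sigma> * t < norm x"
        then have "r (norm x / t) = lam * (norm x / t)" by (intro r_outer) (simp add: field_simps)
        moreover have "0 < \<sigma> * t" using \<sigma> t by simp
        then have "x \<noteq> 0" using t by auto
        ultimately show "y x t = lam *\<^sub>R x" using t by (simp add: y radial_map_def w_def)
      qed
      show "\<forall>x t. x \<noteq> 0 \<longrightarrow> y x t = radial_map w x t" by (simp add: y)
      show "\<forall>t. mono_on {0..} (\<lambda>R. w R t)"
        using w_increment(1) by (auto intro!: mono_onI)
      show "\<forall>\<phi>. admissible_mollifier \<phi> \<longrightarrow>
           (\<forall>n\<ge>1. \<exists>\<epsilon>>0. \<forall>x t.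
              det (grad_x (radial_map (averaged \<phi> n w) :: real^'d \<Rightarrow> real \<Rightarrow> real^'d) x t) \<ge> \<epsilon>) \<and>
           (\<forall>\<psi> :: (real^'d) \<times> real \<Rightarrow> real^'d. Ck 2 \<psi> \<and> compactly_supported \<psi> \<longrightarrow>
              (\<forall>n\<ge>1. weak_integrable h (radial_map (averaged \<phi> n w)) \<psi>) \<and>
              (\<lambda>n. weak_integral h (radial_map (averaged \<phi> n w)) \<psi>) \<longlonglongrightarrow> 0)"
      proof (intro allI impI conjI)
        fix \<phi> assume "admissible_mollifier \<phi>"
        then interpret averaging "CARD('d)" h r H lam \<sigma> \<phi> by unfold_locales
        obtain \<epsilon> where \<epsilon>: "\<epsilon> > 0" "\<And>R t. R \<ge> 0 \<Longrightarrow> A R t > 0 \<and> B R t > 0 \<and> \<epsilon> \<le> A R t * B R t ^ (CARD('d) - 1)"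
          using det_lower by blast
        have "\<epsilon> \<le> det (grad_x (radial_map (averaged \<phi> n w)) x t)" if "n \<ge> 1" for n t and x :: "real^'d"
          unfolding det_averaged[where w'=w, OF refl refl that] using \<epsilon>(2) by simp
        then show "\<exists>\<epsilon>>0. \<forall>x t. det (grad_x (radial_map (averaged \<phi> n w) :: real^'d \<Rightarrow> real \<Rightarrow> real^'d) x t) \<ge> \<epsilon>"
          if "n \<ge> 1" for n using \<epsilon>(1) that by blast
        fix \<psi> :: "(real^'d) \<times> real \<Rightarrow> real^'d" assume "Ck 2 \<psi> \<and> compactly_supported \<psi>"
        then have \<psi>: "Ck 2 \<psi>" "compactly_supported \<psi>" by auto
        show "weak_integrable h (radial_map (averaged \<phi> n w)) \<psi>" if "n \<ge> 1" for n
          by (rule averaged_weak_form(1)[OF refl refl that \<psi>])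
        have "(\<lambda>n. (LINT z|lborel. outer n \<psi> z) + (LINT z|lborel. inner_part n \<psi> z)) \<longlonglongrightarrow> (LINT z|lborel. sol_density0 \<psi> z) + 0"
          by (intro tendsto_add outer_integral(2)[OF refl \<psi>] inner_integral_vanishes[OF refl \<psi> growth])
        then have lim: "(\<lambda>n. (LINT z|lborel. outer n \<psi> z) + (LINT z|lborel. inner_part n \<psi> z)) \<longlonglongrightarrow> 0"
          using weak_form_zero[OF refl sol \<psi>] by simp
        have "\<forall>\<^sub>F n in sequentially. (LINT z|lborel. outer n \<psi> z) + (LINT z|lborel. inner_part n \<psi> z)
            = weak_integral h (radial_map (averaged \<phi> n w)) \<psi>"
          using eventually_ge_at_top[of 1]
          by eventually_elim (simp add: averaged_weak_form(2)[where w'=w, OF refl refl _ \<psi>] avg_density_integral(2)[OF refl \<psi>])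
        from Lim_transform_eventually[OF lim this]
        show "(\<lambda>n. weak_integral h (radial_map (averaged \<phi> n w)) \<psi>) \<longlonglongrightarrow> 0" .
      qed
    qed
  next
    assume "Liminf at_top (\<lambda>v. ereal (deriv h (v ^ CARD('d)) / v)) > 0"
    \<comment> \<open>The lower limit may be infinite, so a real number strictly between 0 and it is
      chosen.\<close>
    then obtain c where "ereal 0 < ereal c" and c: "ereal c < Liminf at_top (\<lambda>v. ereal (deriv h (v ^ CARD('d)) / v))"
      using ereal_dense2[of "ereal 0"] by (auto simp: zero_ereal_def)
    then have c0: "c > 0" by simp
    have "\<forall>\<^sub>F v in at_top. ereal c < ereal (deriv h (v ^ CARD('d)) / v)" by (rule less_LiminfD[OF c])
    then have "\<forall>\<^sub>F v in at_top. c * v \<le> deriv h (v ^ CARD('d))"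
      using eventually_gt_at_top[of 0] by eventually_elim (simp add: field_simps)
    then obtain v0 where v0: "\<And>v. v \<ge> v0 \<Longrightarrow> c * v \<le> deriv h (v ^ CARD('d))"
      unfolding eventually_at_top_linorder by blast
    show "\<not> slic_solution h lam y"
    proof
      assume "slic_solution h lam y"
      then obtain w' where w': "\<And>x t. x \<noteq> 0 \<Longrightarrow> y x t = radial_map w' x t"
        and slic: "\<And>\<phi> \<psi>. admissible_mollifier \<phi> \<Longrightarrow> Ck 2 \<psi> \<and> compactly_supported \<psi> \<Longrightarrow>
            (\<lambda>n. weak_integral h (radial_map (averaged \<phi> n w') :: real^'d \<Rightarrow> real \<Rightarrow> real^'d) \<psi>) \<longlonglongrightarrow> 0"
        unfolding slic_solution_def by blast
      \<comment> \<open>Every sphere of positive radius contains a point, and there y determines the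
        profile of any radial representation.\<close>
      have agree: "w' R t = w R t" if R: "R > 0" for R t
      proof -
        obtain x :: "real^'d" where x: "norm x = R" using vector_choose_size[of R] R by auto
        then have x0: "x \<noteq> 0" using R by auto
        have "radial_map w x t = radial_map w' x t" using w'[OF x0, of t] by (simp add: y)
        then show ?thesis using x0 x R by (auto simp: radial_map_def)
      qed
      obtain \<phi> where \<phi>: "admissible_mollifier \<phi>" using admissible_mollifier_exists .
      then interpret averaging "CARD('d)" h r H lam \<sigma> \<phi> by unfold_locales
      let ?\<psi> = "core_test :: (real^'d) \<times> real \<Rightarrow> real^'d"
      have \<psi>: "Ck 2 ?\<psi>" "compactly_supported ?\<psi>" by (rule Ck_core_test, rule core_test_supported)
      \<comment> \<open>The outer part tends to the weak form of y, which is 0. For a slic-solution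
        the inner part would therefore have to tend to 0 as well.\<close>
      have "(\<lambda>n. weak_integral h (radial_map (averaged \<phi> n w') :: real^'d \<Rightarrow> real \<Rightarrow> real^'d) ?\<psi> - (LINT z|lborel. outer n ?\<psi> z)) \<longlonglongrightarrow> 0 - (LINT z|lborel. sol_density0 ?\<psi> z)"
        by (intro tendsto_diff slic[OF \<phi>] outer_integral(2)[OF refl \<psi>] conjI \<psi>)
      then have lim: "(\<lambda>n. weak_integral h (radial_map (averaged \<phi> n w') :: real^'d \<Rightarrow> real \<Rightarrow> real^'d) ?\<psi> - (LINT z|lborel. outer n ?\<psi> z)) \<longlonglongrightarrow> 0"
        using weak_form_zero[OF refl sol \<psi>] by simp
      have "\<forall>\<^sub>F n in sequentially. weak_integral h (radial_map (averaged \<phi> n w') :: real^'d \<Rightarrow> real \<Rightarrow> real^'d) ?\<psi> - (LINT z|lborel. outer n ?\<psi> z)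
            = (LINT z|lborel. inner_part n ?\<psi> z)"
        using eventually_ge_at_top[of 1]
        by eventually_elim (simp add: averaged_weak_form(2)[where w'=w', OF refl agree _ \<psi>] avg_density_integral(2)[OF refl \<psi>])
      from inner_integral_persists[OF refl c0 v0 Lim_transform_eventually[OF lim this]]
      show False .
    qed
  qed
qed

end
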